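(* Let $(M^{3},\varphi,\xi,\eta,g)$ be a three-dimensional paracosymplectic manifold with scalar curvature $r$, and suppose that $g$ is a Yamabe soliton, i.e. there are a vector field $V$ on $M$ and a real number $\lambda$ with $\mathcal{L}_V g=(\lambda-r)g$. Then $r$ is constant. Consequently, if $r\neq 0$, then the manifold is $\eta$-Einstein, and if $r=0$, then the manifold is Ricci flat.
   Context: All manifolds are smooth and connected. An almost paracontact structure on a $(2n+1)$-dimensional manifold $M$ consists of a $(1,1)$-tensor field $\varphi$, a vector field $\xi$ and a $1$-form $\eta$ with $\eta(\xi)=1$, $\varphi^2=I-\eta\otimes\xi$, such that the $\pm1$-eigendistributions of $\varphi$ restricted to $\ker\eta$ both have dimension $n$ (so $\varphi\xi=0$, $\eta\circ\varphi=0$). It is an almost paracontact metric manifold if equipped with a semi-Riemannian metric $g$ with $g(\varphi X,\varphi Y)=-g(X,Y)+\eta(X)\eta(Y)$ for all $X,Y$. Its fundamental $2$-form is $\Phi(X,Y)=g(X,\varphi Y)$. It is normal if $[\varphi,\varphi]-2d\eta\otimes\xi=0$, where $[\varphi,\varphi](X,Y)=\varphi^2[X,Y]+[\varphi X,\varphi Y]-\varphi[\varphi X,Y]-\varphi[X,\varphi Y]$. A paracosymplectic manifold is a normal almost paracontact metric manifold with $d\eta=0$ and $d\Phi=0$; such a manifold satisfies $\nabla\varphi=0$ and $\nabla\xi=0$, where $\nabla$ is the Levi-Civita connection. Curvature convention: $R(X,Y)Z=\nabla_X\nabla_YZ-\nabla_Y\nabla_XZ-\nabla_{[X,Y]}Z$,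 the Ricci tensor is $S(X,Y)=\operatorname{trace}\{Z\mapsto R(Z,X)Y\}$, the Ricci operator $Q$ is defined by $S(X,Y)=g(QX,Y)$, and the scalar curvature $r$ is the $g$-trace of $S$. The manifold is $\eta$-Einstein if $Q=\alpha\,\mathrm{id}+\beta\,\eta\otimes\xi$ for smooth functions $\alpha,\beta$; it is Ricci flat if $S=0$. $\mathcal{L}$ denotes the Lie derivative. *)

theory Defs
  imports "HOL-Analysis.Analysis"
begin

primrec Ck_on :: "nat \<Rightarrow> 'e::euclidean_space set \<Rightarrow> ('e \<Rightarrow> 'f::real_normed_vector) \<Rightarrow> bool" where
  "Ck_on 0 D f \<longleftrightarrow> continuous_on D f"
| "Ck_on (Suc k) D f \<longleftrightarrow> (\<forall>x\<in>D. f differentiable (at x)) \<and>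
      (\<forall>v. Ck_on k D (\<lambda>x. frechet_derivative f (at x) v))"

text \<open>Only meaningful for open \<open>D\<close>, which is how it is used throughout.\<close>

definition smooth_on :: "'e::euclidean_space set \<Rightarrow> ('e \<Rightarrow> 'f::real_normed_vector) \<Rightarrow> bool" where
  "smooth_on D f \<longleftrightarrow> (\<forall>k. Ck_on k D f)"

text \<open>A chart is a pair of an open set and a coordinate map.  A smooth structure is given by a
  (not necessarily maximal) atlas of smoothly compatible charts.\<close>

type_synonym ('a, 'n) chart = "'a set \<times> ('a \<Rightarrow> real ^ 'n)"

definition chart_image :: "('a, 'n) chart \<Rightarrow> (real ^ 'n) set" where
  "chart_image c = snd c ` fst c"

definition chart_inv :: "('a, 'n) chart \<Rightarrow> real ^ 'n \<Rightarrow> 'a" where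
  "chart_inv c = inv_into (fst c) (snd c)"

definition overlap :: "('a, 'n) chart \<Rightarrow> ('a, 'n) chart \<Rightarrow> (real ^ 'n) set" where
  "overlap c d = snd c ` (fst c \<inter> fst d)"

definition transition :: "('a, 'n) chart \<Rightarrow> ('a, 'n) chart \<Rightarrow> real ^ 'n \<Rightarrow> real ^ 'n" where
  "transition c d = snd d \<circ> chart_inv c"

definition d_transition ::
    "('a, 'n::finite) chart \<Rightarrow> ('a, 'n) chart \<Rightarrow> real ^ 'n \<Rightarrow> real ^ 'n \<Rightarrow> real ^ 'n" where
  "d_transition c d x = frechet_derivative (transition c d) (at x)"

definition smooth_manifold :: "'a topology \<Rightarrow> ('a, 'n::finite) chart set \<Rightarrow> bool" where
  "smooth_manifold M A \<longleftrightarrow>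
     Hausdorff_space M \<and> second_countable M \<and> topspace M = (\<Union>c\<in>A. fst c) \<and>
     (\<forall>c\<in>A. openin M (fst c) \<and> open (chart_image c) \<and>
        homeomorphic_map (subtopology M (fst c)) (top_of_set (chart_image c)) (snd c)) \<and>
     (\<forall>c\<in>A. \<forall>d\<in>A. smooth_on (overlap c d) (transition c d))"

definition smooth_function :: "('a, 'n::finite) chart set \<Rightarrow> ('a \<Rightarrow> real) \<Rightarrow> bool" where
  "smooth_function A f \<longleftrightarrow> (\<forall>c\<in>A. smooth_on (chart_image c) (f \<circ> chart_inv c))"

text \<open>Tensor fields on an open subset of Euclidean space are functions of the point and of tangent
  vectors.  A tensor field on a manifold is a family, indexed by the charts, of such local
  representatives on the chart images, related by the tensorial transformation law.\<close>

type_synonym 'n vec_field = "real ^ 'n \<Rightarrow> real ^ 'n"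
type_synonym 'n one_form = "real ^ 'n \<Rightarrow> real ^ 'n \<Rightarrow> real"
type_synonym 'n endo_field = "real ^ 'n \<Rightarrow> real ^ 'n \<Rightarrow> real ^ 'n"
type_synonym 'n bil_field = "real ^ 'n \<Rightarrow> real ^ 'n \<Rightarrow> real ^ 'n \<Rightarrow> real"

definition vector_field ::
    "('a, 'n::finite) chart set \<Rightarrow> (('a, 'n) chart \<Rightarrow> 'n vec_field) \<Rightarrow> bool" where
  "vector_field A X \<longleftrightarrow>
     (\<forall>c\<in>A. smooth_on (chart_image c) (X c)) \<and>
     (\<forall>c\<in>A. \<forall>d\<in>A. \<forall>x\<in>overlap c d. X d (transition c d x) = d_transition c d x (X c x))"

definition one_form_field ::
    "('a, 'n::finite) chart set \<Rightarrow> (('a, 'n) chart \<Rightarrow> 'n one_form) \<Rightarrow> bool" where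
  "one_form_field A \<eta> \<longleftrightarrow>
     (\<forall>c\<in>A. (\<forall>x\<in>chart_image c. linear (\<eta> c x)) \<and> (\<forall>v. smooth_on (chart_image c) (\<lambda>x. \<eta> c x v))) \<and>
     (\<forall>c\<in>A. \<forall>d\<in>A. \<forall>x\<in>overlap c d. \<forall>v.
        \<eta> d (transition c d x) (d_transition c d x v) = \<eta> c x v)"

definition endomorphism_field ::
    "('a, 'n::finite) chart set \<Rightarrow> (('a, 'n) chart \<Rightarrow> 'n endo_field) \<Rightarrow> bool" where
  "endomorphism_field A \<phi> \<longleftrightarrow>
     (\<forall>c\<in>A. (\<forall>x\<in>chart_image c. linear (\<phi> c x)) \<and> (\<forall>v. smooth_on (chart_image c) (\<lambda>x. \<phi> c x v))) \<and>
     (\<forall>c\<in>A. \<forall>d\<in>A. \<forall>x\<in>overlap c d. \<forall>v.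
        \<phi> d (transition c d x) (d_transition c d x v) = d_transition c d x (\<phi> c x v))"

definition bilinear_field ::
    "('a, 'n::finite) chart set \<Rightarrow> (('a, 'n) chart \<Rightarrow> 'n bil_field) \<Rightarrow> bool" where
  "bilinear_field A g \<longleftrightarrow>
     (\<forall>c\<in>A. (\<forall>x\<in>chart_image c. bilinear (g c x)) \<and>
        (\<forall>u v. smooth_on (chart_image c) (\<lambda>x. g c x u v))) \<and>
     (\<forall>c\<in>A. \<forall>d\<in>A. \<forall>x\<in>overlap c d. \<forall>u v.
        g d (transition c d x) (d_transition c d x u) (d_transition c d x v) = g c x u v)"

text \<open>No condition on the index: on a connected manifold it is automatically constant.\<close>

definition semi_riemannian_metric ::
    "('a, 'n::finite) chart set \<Rightarrow> (('a, 'n) chart \<Rightarrow> 'n bil_field) \<Rightarrow> bool" where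
  "semi_riemannian_metric A g \<longleftrightarrow> bilinear_field A g \<and>
     (\<forall>c\<in>A. \<forall>x\<in>chart_image c. (\<forall>u v. g c x u v = g c x v u) \<and>
        (\<forall>u. (\<forall>v. g c x u v = 0) \<longrightarrow> u = 0))"

definition dir_deriv ::
    "'n::finite vec_field \<Rightarrow> (real ^ 'n \<Rightarrow> 'f::real_normed_vector) \<Rightarrow> real ^ 'n \<Rightarrow> 'f" where
  "dir_deriv X f x = frechet_derivative f (at x) (X x)"

definition lie_bracket :: "'n::finite vec_field \<Rightarrow> 'n vec_field \<Rightarrow> 'n vec_field" where
  "lie_bracket X Y x = dir_deriv X Y x - dir_deriv Y X x"

text \<open>Exterior derivatives carry the factors \<open>1/2\<close> and \<open>1/3\<close>, the convention to which the factor
  \<open>2\<close> in the normality condition below belongs.\<close>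

definition ext_deriv1 :: "'n::finite one_form \<Rightarrow> 'n vec_field \<Rightarrow> 'n vec_field \<Rightarrow> real ^ 'n \<Rightarrow> real" where
  "ext_deriv1 \<eta> X Y x = (1/2) *
     (dir_deriv X (\<lambda>y. \<eta> y (Y y)) x - dir_deriv Y (\<lambda>y. \<eta> y (X y)) x - \<eta> x (lie_bracket X Y x))"

definition ext_deriv2 ::
    "'n::finite bil_field \<Rightarrow> 'n vec_field \<Rightarrow> 'n vec_field \<Rightarrow> 'n vec_field \<Rightarrow> real ^ 'n \<Rightarrow> real" where
  "ext_deriv2 \<omega> X Y Z x = (1/3) *
     (dir_deriv X (\<lambda>y. \<omega> y (Y y) (Z y)) x + dir_deriv Y (\<lambda>y. \<omega> y (Z y) (X y)) x
        + dir_deriv Z (\<lambda>y. \<omega> y (X y) (Y y)) x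
      - \<omega> x (lie_bracket X Y x) (Z x) - \<omega> x (lie_bracket Y Z x) (X x)
      - \<omega> x (lie_bracket Z X x) (Y x))"

definition lie_deriv_metric ::
    "'n::finite vec_field \<Rightarrow> 'n bil_field \<Rightarrow> 'n vec_field \<Rightarrow> 'n vec_field \<Rightarrow> real ^ 'n \<Rightarrow> real" where
  "lie_deriv_metric V g X Y x =
     dir_deriv V (\<lambda>y. g y (X y) (Y y)) x - g x (lie_bracket V X x) (Y x) - g x (X x) (lie_bracket V Y x)"

definition nijenhuis :: "'n::finite endo_field \<Rightarrow> 'n vec_field \<Rightarrow> 'n vec_field \<Rightarrow> 'n vec_field" where
  "nijenhuis \<phi> X Y x =
     \<phi> x (\<phi> x (lie_bracket X Y x)) + lie_bracket (\<lambda>y. \<phi> y (X y)) (\<lambda>y. \<phi> y (Y y)) x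
     - \<phi> x (lie_bracket (\<lambda>y. \<phi> y (X y)) Y x) - \<phi> x (lie_bracket X (\<lambda>y. \<phi> y (Y y)) x)"

type_synonym 'n connection = "'n vec_field \<Rightarrow> 'n vec_field \<Rightarrow> 'n vec_field"

definition affine_connection_on :: "(real ^ 'n::finite) set \<Rightarrow> 'n connection \<Rightarrow> bool" where
  "affine_connection_on D N \<longleftrightarrow>
     (\<forall>X Y. smooth_on D X \<longrightarrow> smooth_on D Y \<longrightarrow> smooth_on D (N X Y)) \<and>
     (\<forall>X X' Y. smooth_on D X \<longrightarrow> smooth_on D X' \<longrightarrow> smooth_on D Y \<longrightarrow>
        (\<forall>x\<in>D. N (\<lambda>y. X y + X' y) Y x = N X Y x + N X' Y x)) \<and>
     (\<forall>f X Y. smooth_on D f \<longrightarrow> smooth_on D X \<longrightarrow> smooth_on D Y \<longrightarrow>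
        (\<forall>x\<in>D. N (\<lambda>y. f y *\<^sub>R X y) Y x = f x *\<^sub>R N X Y x)) \<and>
     (\<forall>X Y Y'. smooth_on D X \<longrightarrow> smooth_on D Y \<longrightarrow> smooth_on D Y' \<longrightarrow>
        (\<forall>x\<in>D. N X (\<lambda>y. Y y + Y' y) x = N X Y x + N X Y' x)) \<and>
     (\<forall>f X Y. smooth_on D f \<longrightarrow> smooth_on D X \<longrightarrow> smooth_on D Y \<longrightarrow>
        (\<forall>x\<in>D. N X (\<lambda>y. f y *\<^sub>R Y y) x = dir_deriv X f x *\<^sub>R Y x + f x *\<^sub>R N X Y x))"

definition levi_civita_on :: "(real ^ 'n::finite) set \<Rightarrow> 'n bil_field \<Rightarrow> 'n connection \<Rightarrow> bool" where
  "levi_civita_on D g N \<longleftrightarrow> affine_connection_on D N \<and>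
     (\<forall>X Y. smooth_on D X \<longrightarrow> smooth_on D Y \<longrightarrow>
        (\<forall>x\<in>D. N X Y x - N Y X x = lie_bracket X Y x)) \<and>
     (\<forall>X Y Z. smooth_on D X \<longrightarrow> smooth_on D Y \<longrightarrow> smooth_on D Z \<longrightarrow>
        (\<forall>x\<in>D. dir_deriv X (\<lambda>y. g y (Y y) (Z y)) x = g x (N X Y x) (Z x) + g x (Y x) (N X Z x)))"

text \<open>By uniqueness of the Levi-Civita connection, the local connections belonging to different
  charts automatically agree on overlaps, so no transformation law has to be imposed.\<close>

definition levi_civita ::
    "('a, 'n::finite) chart set \<Rightarrow> (('a, 'n) chart \<Rightarrow> 'n bil_field) \<Rightarrow>
     (('a, 'n) chart \<Rightarrow> 'n connection) \<Rightarrow> bool" where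
  "levi_civita A g nabla \<longleftrightarrow> (\<forall>c\<in>A. levi_civita_on (chart_image c) (g c) (nabla c))"

definition riemann ::
    "'n::finite connection \<Rightarrow> 'n vec_field \<Rightarrow> 'n vec_field \<Rightarrow> 'n vec_field \<Rightarrow> 'n vec_field" where
  "riemann N X Y Z x = N X (N Y Z) x - N Y (N X Z) x - N (lie_bracket X Y) Z x"

text \<open>\<open>R\<close> is tensorial, so its value on tangent vectors at a point is computed by extending them to
  vector fields with constant coefficients.\<close>

definition ricci :: "'n::finite connection \<Rightarrow> 'n bil_field" where
  "ricci N x u v = trace (matrix (\<lambda>z. riemann N (\<lambda>_. z) (\<lambda>_. u) (\<lambda>_. v) x))"

definition ricci_operator :: "'n::finite bil_field \<Rightarrow> 'n connection \<Rightarrow> 'n endo_field" where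
  "ricci_operator g N x u = (THE w. \<forall>v. ricci N x u v = g x w v)"

definition scalar_curvature :: "'n::finite bil_field \<Rightarrow> 'n connection \<Rightarrow> real ^ 'n \<Rightarrow> real" where
  "scalar_curvature g N x = trace (matrix (ricci_operator g N x))"

definition almost_paracontact ::
    "('a, 'n::finite) chart set \<Rightarrow> (('a, 'n) chart \<Rightarrow> 'n endo_field) \<Rightarrow>
     (('a, 'n) chart \<Rightarrow> 'n vec_field) \<Rightarrow> (('a, 'n) chart \<Rightarrow> 'n one_form) \<Rightarrow> bool" where
  "almost_paracontact A \<phi> \<xi> \<eta> \<longleftrightarrow>
     endomorphism_field A \<phi> \<and> vector_field A \<xi> \<and> one_form_field A \<eta> \<and>
     (\<exists>n. CARD('n) = 2 * n + 1 \<and>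
       (\<forall>c\<in>A. \<forall>x\<in>chart_image c.
          \<eta> c x (\<xi> c x) = 1 \<and>
          (\<forall>v. \<phi> c x (\<phi> c x v) = v - \<eta> c x v *\<^sub>R \<xi> c x) \<and>
          dim {v. \<eta> c x v = 0 \<and> \<phi> c x v = v} = n \<and>
          dim {v. \<eta> c x v = 0 \<and> \<phi> c x v = - v} = n))"

definition almost_paracontact_metric ::
    "('a, 'n::finite) chart set \<Rightarrow> (('a, 'n) chart \<Rightarrow> 'n endo_field) \<Rightarrow>
     (('a, 'n) chart \<Rightarrow> 'n vec_field) \<Rightarrow> (('a, 'n) chart \<Rightarrow> 'n one_form) \<Rightarrow>
     (('a, 'n) chart \<Rightarrow> 'n bil_field) \<Rightarrow> bool" where
  "almost_paracontact_metric A \<phi> \<xi> \<eta> g \<longleftrightarrow>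
     almost_paracontact A \<phi> \<xi> \<eta> \<and> semi_riemannian_metric A g \<and>
     (\<forall>c\<in>A. \<forall>x\<in>chart_image c. \<forall>u v.
        g c x (\<phi> c x u) (\<phi> c x v) = - g c x u v + \<eta> c x u * \<eta> c x v)"

definition fundamental_form :: "'n::finite endo_field \<Rightarrow> 'n bil_field \<Rightarrow> 'n bil_field" where
  "fundamental_form \<phi> g x u v = g x u (\<phi> x v)"

definition normal_structure ::
    "('a, 'n::finite) chart set \<Rightarrow> (('a, 'n) chart \<Rightarrow> 'n endo_field) \<Rightarrow>
     (('a, 'n) chart \<Rightarrow> 'n vec_field) \<Rightarrow> (('a, 'n) chart \<Rightarrow> 'n one_form) \<Rightarrow> bool" where
  "normal_structure A \<phi> \<xi> \<eta> \<longleftrightarrow>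
     (\<forall>c\<in>A. \<forall>X Y. smooth_on (chart_image c) X \<longrightarrow> smooth_on (chart_image c) Y \<longrightarrow>
        (\<forall>x\<in>chart_image c.
           nijenhuis (\<phi> c) X Y x - (2 * ext_deriv1 (\<eta> c) X Y x) *\<^sub>R \<xi> c x = 0))"

definition closed_one_form ::
    "('a, 'n::finite) chart set \<Rightarrow> (('a, 'n) chart \<Rightarrow> 'n one_form) \<Rightarrow> bool" where
  "closed_one_form A \<eta> \<longleftrightarrow>
     (\<forall>c\<in>A. \<forall>X Y. smooth_on (chart_image c) X \<longrightarrow> smooth_on (chart_image c) Y \<longrightarrow>
        (\<forall>x\<in>chart_image c. ext_deriv1 (\<eta> c) X Y x = 0))"

definition closed_two_form ::
    "('a, 'n::finite) chart set \<Rightarrow> (('a, 'n) chart \<Rightarrow> 'n bil_field) \<Rightarrow> bool" where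
  "closed_two_form A \<omega> \<longleftrightarrow>
     (\<forall>c\<in>A. \<forall>X Y Z. smooth_on (chart_image c) X \<longrightarrow> smooth_on (chart_image c) Y \<longrightarrow>
        smooth_on (chart_image c) Z \<longrightarrow> (\<forall>x\<in>chart_image c. ext_deriv2 (\<omega> c) X Y Z x = 0))"

definition paracosymplectic ::
    "('a, 'n::finite) chart set \<Rightarrow> (('a, 'n) chart \<Rightarrow> 'n endo_field) \<Rightarrow>
     (('a, 'n) chart \<Rightarrow> 'n vec_field) \<Rightarrow> (('a, 'n) chart \<Rightarrow> 'n one_form) \<Rightarrow>
     (('a, 'n) chart \<Rightarrow> 'n bil_field) \<Rightarrow> bool" where
  "paracosymplectic A \<phi> \<xi> \<eta> g \<longleftrightarrow>
     almost_paracontact_metric A \<phi> \<xi> \<eta> g \<and> normal_structure A \<phi> \<xi> \<eta> \<and>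
     closed_one_form A \<eta> \<and> closed_two_form A (\<lambda>c. fundamental_form (\<phi> c) (g c))"

definition yamabe_soliton ::
    "('a, 'n::finite) chart set \<Rightarrow> (('a, 'n) chart \<Rightarrow> 'n bil_field) \<Rightarrow>
     (('a, 'n) chart \<Rightarrow> 'n connection) \<Rightarrow> bool" where
  "yamabe_soliton A g nabla \<longleftrightarrow>
     (\<exists>V (lam::real). vector_field A V \<and>
       (\<forall>c\<in>A. \<forall>X Y. smooth_on (chart_image c) X \<longrightarrow> smooth_on (chart_image c) Y \<longrightarrow>
          (\<forall>x\<in>chart_image c. lie_deriv_metric (V c) (g c) X Y x =
             (lam - scalar_curvature (g c) (nabla c) x) * g c x (X x) (Y x))))"

definition eta_einstein ::
    "('a, 'n::finite) chart set \<Rightarrow> (('a, 'n) chart \<Rightarrow> 'n vec_field) \<Rightarrow>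
     (('a, 'n) chart \<Rightarrow> 'n one_form) \<Rightarrow> (('a, 'n) chart \<Rightarrow> 'n bil_field) \<Rightarrow>
     (('a, 'n) chart \<Rightarrow> 'n connection) \<Rightarrow> bool" where
  "eta_einstein A \<xi> \<eta> g nabla \<longleftrightarrow>
     (\<exists>\<alpha> \<beta>. smooth_function A \<alpha> \<and> smooth_function A \<beta> \<and>
       (\<forall>c\<in>A. \<forall>p\<in>fst c. \<forall>v. ricci_operator (g c) (nabla c) (snd c p) v =
          \<alpha> p *\<^sub>R v + (\<beta> p * \<eta> c (snd c p) v) *\<^sub>R \<xi> c (snd c p)))"

definition ricci_flat ::
    "('a, 'n::finite) chart set \<Rightarrow> (('a, 'n) chart \<Rightarrow> 'n connection) \<Rightarrow> bool" where
  "ricci_flat A nabla \<longleftrightarrow> (\<forall>c\<in>A. \<forall>x\<in>chart_image c. \<forall>u v. ricci (nabla c) x u v = 0)"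

end

theory Submission
  imports Defs
begin

text \<open>Normality, \<open>d\<eta> = 0\<close> and \<open>d\<Phi> = 0\<close> make the brackets of a local frame \<open>(E1, E2, \<xi>)\<close>, with \<open>E1\<close> and
  \<open>E2\<close> null eigenvectors of \<open>\<phi>\<close>, so special that Koszul's formula gives \<open>\<nabla>E1 = \<omega> E1\<close>,
  \<open>\<nabla>E2 = - \<omega> E2\<close>, \<open>\<nabla>\<xi> = 0\<close>.  Hence the curvature is one function \<open>\<kappa>\<close>, with
  \<open>S = \<kappa> (g - \<eta> \<otimes> \<eta>)\<close> and \<open>r = 2 \<kappa>\<close>, and \<open>\<xi> \<kappa> = 0\<close>.  For a conformal field \<open>V\<close> with
  \<open>L\<^sub>V g = 2 \<sigma> g\<close> and \<open>\<xi> \<sigma> = 0\<close>, differentiating the components of this equation twice along \<open>\<xi>\<close> shows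
  that the Hessian of \<open>\<sigma>\<close> vanishes, so \<open>\<kappa> d\<sigma> = 0\<close> by the Ricci identity.  For a Yamabe soliton
  \<open>\<sigma> = \<lambda> / 2 - \<kappa>\<close>, so \<open>\<kappa>\<close> is locally constant.  The scalar curvatures computed in different charts
  agree because the Lie derivative of the metric is natural and determines \<open>\<lambda> - r\<close>.\<close>

section \<open>Calculus of smooth functions\<close>

text \<open>The given connection is an operator on fields that are smooth on a whole chart image,
  and nothing is known about its values on other fields. A null frame exists only near a point,
  because its normalisation divides by a function that may have zeros, so the operator cannot be
  applied to it. Christoffel symbols do restrict to open subsets; hence the connection is replaced
  by its values on constant fields, and the curvature by a formula at a point. The function \<kappa>
  is d\<omega>(E1, E2). By the first Bianchi identity d\<omega> vanishes on pairs containing \<xi>,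
  and then d(d\<omega>) = 0 gives \<xi> \<kappa> = 0. The Hessian of \<sigma> is reached through the
  function f = g(V, \<xi>), because \<xi> f = \<sigma>: one derivative along \<xi> turns the
  conformal equation into Hessian equations for f, the next one carries them over to \<sigma>. The
  final equation \<kappa> d\<kappa> = 0 cannot be divided by \<kappa>, which may vanish somewhere;
  instead it is read as the vanishing of the derivative of the square of \<kappa>.\<close>

lemma has_frechet_derivative:
  "f differentiable (at x) \<Longrightarrow> (f has_derivative frechet_derivative f (at x)) (at x)"
  by (simp add: frechet_derivative_works)

lemma frechet_derivative_eqI:
  "(f has_derivative f') (at x) \<Longrightarrow> frechet_derivative f (at x) = f'"
  using frechet_derivative_at by metis

text \<open>\<open>frechet_derivative\<close> is a choice among all derivatives at the point.
  Functions that agree near the point have the same derivatives, so the same choice is made, even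
  where neither is differentiable.\<close>

lemma frechet_derivative_cong_open:
  assumes "open D" "x \<in> D" "\<And>y. y \<in> D \<Longrightarrow> f y = h y"
  shows "frechet_derivative f (at x) = frechet_derivative h (at x)"
proof -
  have "(f has_derivative f') (at x) \<longleftrightarrow> (h has_derivative f') (at x)" for f'
    using assms has_derivative_transform_within_open[of f f' x UNIV D h]
      has_derivative_transform_within_open[of h f' x UNIV D f] by auto
  then show ?thesis by (simp add: frechet_derivative_def)
qed

lemma frechet_derivative_bilinear:
  assumes "bounded_bilinear B" "f differentiable (at x)" "h differentiable (at x)"
  shows "frechet_derivative (\<lambda>y. B (f y) (h y)) (at x) v =
    B (f x) (frechet_derivative h (at x) v) + B (frechet_derivative f (at x) v) (h x)"
  using frechet_derivative_eqI[OF bounded_bilinear.FDERIV[OF assms(1) has_frechet_derivative[OF assms(2)]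
      has_frechet_derivative[OF assms(3)]]] by simp

lemma frechet_derivative_add:
  assumes "f differentiable (at x)" "h differentiable (at x)"
  shows "frechet_derivative (\<lambda>y. f y + h y) (at x) v =
    frechet_derivative f (at x) v + frechet_derivative h (at x) v"
  using frechet_derivative_eqI[OF has_derivative_add[OF has_frechet_derivative[OF assms(1)] has_frechet_derivative[OF assms(2)]]] by simp

lemma frechet_derivative_bounded_linear:
  assumes "bounded_linear L" "f differentiable (at x)"
  shows "frechet_derivative (\<lambda>y. L (f y)) (at x) v = L (frechet_derivative f (at x) v)"
  using frechet_derivative_eqI[OF bounded_linear.has_derivative[OF assms(1) has_frechet_derivative[OF assms(2)]]] by simp

text \<open>A derivative at \<open>x\<close> sees a full neighbourhood of \<open>x\<close>; openness
  of \<open>D\<close> places one inside the region where the functions agree.\<close>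

lemma Ck_on_cong:
  assumes "open D" "Ck_on k D f" "\<And>x. x \<in> D \<Longrightarrow> f x = h x"
  shows "Ck_on k D h"
  using assms(2,3)
proof (induction k arbitrary: f h)
  case 0
  then show ?case by (simp cong: continuous_on_cong)
next
  case (Suc k)
  have fd: "frechet_derivative f (at x) = frechet_derivative h (at x)" if "x \<in> D" for x
    using frechet_derivative_cong_open[OF assms(1) that Suc.prems(2)] .
  have "h differentiable (at x)" if "x \<in> D" for x
    by (rule differentiableI[OF has_derivative_transform_within_open[OF has_frechet_derivative[of f] assms(1)]])
      (use Suc.prems that in auto)
  moreover have "Ck_on k D (\<lambda>x. frechet_derivative h (at x) v)" for v
    using Suc.IH[of "\<lambda>x. frechet_derivative f (at x) v" "\<lambda>x. frechet_derivative h (at x) v"]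
      Suc.prems(1) fd by simp
  ultimately show ?case by simp
qed

lemma Ck_on_SucD: "Ck_on (Suc k) D f \<Longrightarrow> Ck_on k D f"
proof (induction k arbitrary: f)
  case 0
  then show ?case
    using continuous_at_imp_continuous_on differentiable_imp_continuous_within by fastforce
next
  case (Suc k)
  have "Ck_on k D (\<lambda>x. frechet_derivative f (at x) v)" for v
  proof (rule Suc.IH)
    show "Ck_on (Suc k) D (\<lambda>x. frechet_derivative f (at x) v)"
      using Suc.prems by (simp only: Ck_on.simps(2)[of "Suc k"])
  qed
  with Suc.prems show ?case by simp
qed

lemma Ck_on_subset: "Ck_on k D f \<Longrightarrow> U \<subseteq> D \<Longrightarrow> Ck_on k U f"
  by (induction k arbitrary: f) (auto intro: continuous_on_subset)

lemma Ck_on_const: "Ck_on k D (\<lambda>_. c)"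
  by (induction k arbitrary: c) auto

lemma Ck_on_add:
  assumes "open D" "Ck_on k D f" "Ck_on k D h"
  shows "Ck_on k D (\<lambda>x. f x + h x)"
  using assms(2,3)
proof (induction k arbitrary: f h)
  case 0
  then show ?case by (simp add: continuous_on_add)
next
  case (Suc k)
  have "Ck_on k D (\<lambda>x. frechet_derivative (\<lambda>x. f x + h x) (at x) v)" for v
    by (rule Ck_on_cong[OF assms(1) Suc.IH[of "\<lambda>x. frechet_derivative f (at x) v"
        "\<lambda>x. frechet_derivative h (at x) v"]])
      (use Suc.prems in \<open>auto simp: frechet_derivative_add\<close>)
  then show ?case using Suc.prems by (auto intro: differentiable_add)
qed

text \<open>The product rule yields two terms, each with one factor differentiated and the other
  kept, so the induction goes down one order in both. A general \<open>B\<close> covers products of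
  functions and scaling of vector fields at once.\<close>

lemma Ck_on_bilinear:
  assumes "open D" "bounded_bilinear B" "Ck_on k D f" "Ck_on k D h"
  shows "Ck_on k D (\<lambda>x. B (f x) (h x))"
  using assms(3,4)
proof (induction k arbitrary: f h)
  case 0
  then show ?case by (simp add: bounded_bilinear.continuous_on[OF assms(2)])
next
  case (Suc k)
  have "Ck_on k D (\<lambda>x. B (f x) (frechet_derivative h (at x) v))"
    "Ck_on k D (\<lambda>x. B (frechet_derivative f (at x) v) (h x))" for v
    using Suc.prems Ck_on_SucD[OF Suc.prems(1)] Ck_on_SucD[OF Suc.prems(2)]
    by (auto intro!: Suc.IH)
  then have "Ck_on k D (\<lambda>x. B (f x) (frechet_derivative h (at x) v) +
      B (frechet_derivative f (at x) v) (h x))" for v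
    using Ck_on_add[OF assms(1)] by blast
  then have "Ck_on k D (\<lambda>x. frechet_derivative (\<lambda>x. B (f x) (h x)) (at x) v)" for v
    by (rule Ck_on_cong[OF assms(1)])
      (use Suc.prems in \<open>auto simp: frechet_derivative_bilinear[OF assms(2)]\<close>)
  moreover have "(\<lambda>x. B (f x) (h x)) differentiable (at x)" if "x \<in> D" for x
    by (rule differentiableI[OF bounded_bilinear.FDERIV[OF assms(2) has_frechet_derivative
            has_frechet_derivative]])
      (use Suc.prems that in auto)
  ultimately show ?case by auto
qed

lemma Ck_on_bounded_linear:
  assumes "open D" "bounded_linear L" "Ck_on k D f"
  shows "Ck_on k D (\<lambda>x. L (f x))"
  using assms(3)
proof (induction k arbitrary: f)
  case 0
  then show ?case by (simp add: bounded_linear.continuous_on[OF assms(2)])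
next
  case (Suc k)
  have "Ck_on k D (\<lambda>x. frechet_derivative (\<lambda>x. L (f x)) (at x) v)" for v
    by (rule Ck_on_cong[OF assms(1) Suc.IH[of "\<lambda>x. frechet_derivative f (at x) v"]])
      (use Suc.prems in \<open>auto simp: frechet_derivative_bounded_linear[OF assms(2)]\<close>)
  moreover have "(\<lambda>x. L (f x)) differentiable (at x)" if "x \<in> D" for x
    by (rule differentiableI[OF bounded_linear.has_derivative[OF assms(2) has_frechet_derivative]])
      (use Suc.prems that in simp)
  ultimately show ?case by auto
qed

lemma frechet_derivative_inverse:
  fixes f :: "'e::real_normed_vector \<Rightarrow> real"
  assumes "f differentiable (at x)" "f x \<noteq> 0"
  shows "frechet_derivative (\<lambda>y. inverse (f y)) (at x) v =
    - (inverse (f x) * frechet_derivative f (at x) v * inverse (f x))"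
  using frechet_derivative_eqI[OF Deriv.has_derivative_inverse[OF assms(2) has_frechet_derivative[OF assms(1)]]] by simp

text \<open>The derivative of \<open>1 / f\<close> is again a product of factors
  \<open>1 / f\<close> and a derivative of \<open>f\<close>, so the induction hypothesis and the
  product rule suffice.\<close>

lemma Ck_on_inverse:
  fixes f :: "'e::euclidean_space \<Rightarrow> real"
  assumes "open D" "\<And>x. x \<in> D \<Longrightarrow> f x \<noteq> 0" "Ck_on k D f"
  shows "Ck_on k D (\<lambda>x. inverse (f x))"
  using assms(3)
proof (induction k)
  case 0
  then show ?case using assms(2) by (simp add: continuous_on_inverse)
next
  case (Suc k)
  note mult = Ck_on_bilinear[OF assms(1) bounded_bilinear_mult]
  \<comment> \<open>The sign is written as the constant factor \<open>-1\<close> so that the product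
    rule alone covers the term.\<close>
  have "Ck_on k D (\<lambda>x. (-1) * (inverse (f x) * frechet_derivative f (at x) v * inverse (f x)))" for v
    using Suc Ck_on_SucD by (intro mult Ck_on_const) auto
  then have "Ck_on k D (\<lambda>x. frechet_derivative (\<lambda>y. inverse (f y)) (at x) v)" for v
    by (rule Ck_on_cong[OF assms(1)])
      (use Suc.prems assms(2) in \<open>auto simp: frechet_derivative_inverse\<close>)
  then show ?case using Suc.prems assms(2) by (auto intro: differentiable_inverse)
qed

section \<open>Closure properties of smooth functions\<close>

lemma smooth_on_differentiable: "smooth_on D f \<Longrightarrow> x \<in> D \<Longrightarrow> f differentiable (at x)"
  unfolding smooth_on_def by (drule spec[of _ "Suc 0"]) simp

lemma smooth_on_continuous_on: "smooth_on D f \<Longrightarrow> continuous_on D f"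
  unfolding smooth_on_def by (drule spec[of _ 0]) simp

lemma smooth_on_frechet_derivative:
  "smooth_on D f \<Longrightarrow> smooth_on D (\<lambda>x. frechet_derivative f (at x) v)"
  unfolding smooth_on_def
proof
  fix k assume "\<forall>k. Ck_on k D f"
  then have "Ck_on (Suc k) D f" ..
  then show "Ck_on k D (\<lambda>x. frechet_derivative f (at x) v)" by simp
qed

lemma smooth_on_cong:
  "smooth_on D f \<Longrightarrow> open D \<Longrightarrow> (\<And>x. x \<in> D \<Longrightarrow> f x = h x) \<Longrightarrow> smooth_on D h"
  unfolding smooth_on_def by (intro allI, rule Ck_on_cong[of D _ f h]) simp_all

lemma smooth_on_subset: "smooth_on D f \<Longrightarrow> U \<subseteq> D \<Longrightarrow> smooth_on U f"
  unfolding smooth_on_def by (intro allI, rule Ck_on_subset[of _ D f U]) simp_all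

lemma smooth_on_const: "smooth_on D (\<lambda>_. c)"
  unfolding smooth_on_def by (intro allI Ck_on_const)

lemma smooth_on_add:
  "open D \<Longrightarrow> smooth_on D f \<Longrightarrow> smooth_on D h \<Longrightarrow> smooth_on D (\<lambda>x. f x + h x)"
  unfolding smooth_on_def by (intro allI, rule Ck_on_add[of D _ f h]) simp_all

lemma smooth_on_bilinear:
  "open D \<Longrightarrow> bounded_bilinear B \<Longrightarrow> smooth_on D f \<Longrightarrow> smooth_on D h \<Longrightarrow>
    smooth_on D (\<lambda>x. B (f x) (h x))"
  unfolding smooth_on_def by (intro allI, rule Ck_on_bilinear[of D B _ f h]) simp_all

lemmas smooth_on_mult = smooth_on_bilinear[OF _ bounded_bilinear_mult]
lemmas smooth_on_scaleR = smooth_on_bilinear[OF _ bounded_bilinear_scaleR]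

lemma smooth_on_bounded_linear:
  "open D \<Longrightarrow> bounded_linear L \<Longrightarrow> smooth_on D f \<Longrightarrow> smooth_on D (\<lambda>x. L (f x))"
  unfolding smooth_on_def by (intro allI, rule Ck_on_bounded_linear[of D L _ f]) simp_all

lemmas smooth_on_minus = smooth_on_bounded_linear[OF _ bounded_linear_minus[OF bounded_linear_ident]]

lemma smooth_on_diff:
  assumes "open D" "smooth_on D f" "smooth_on D h"
  shows "smooth_on D (\<lambda>x. f x - h x)"
  using smooth_on_add[OF assms(1,2) smooth_on_minus[OF assms(1,3)]] by simp

lemma smooth_on_inverse:
  fixes f :: "'e::euclidean_space \<Rightarrow> real"
  shows "open D \<Longrightarrow> smooth_on D f \<Longrightarrow> (\<And>x. x \<in> D \<Longrightarrow> f x \<noteq> 0) \<Longrightarrow> smooth_on D (\<lambda>x. inverse (f x))"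
  unfolding smooth_on_def by (intro allI, rule Ck_on_inverse[of D f]) simp_all

lemma smooth_on_sum:
  assumes "open D" "\<And>i. i \<in> I \<Longrightarrow> smooth_on D (f i)"
  shows "smooth_on D (\<lambda>x. \<Sum>i\<in>I. f i x)"
  using assms(2)
proof (induction I rule: infinite_finite_induct)
  case (insert i I)
  then have "smooth_on D (\<lambda>x. f i x + (\<Sum>i\<in>I. f i x))"
    by (intro smooth_on_add[OF assms(1)]) simp_all
  with insert.hyps show ?case by simp
qed (simp_all add: smooth_on_const)

lemma linear_euclidean_sum:
  fixes F :: "'e::euclidean_space \<Rightarrow> 'f::real_vector"
  assumes "linear F"
  shows "F v = (\<Sum>b\<in>Basis. (v \<bullet> b) *\<^sub>R F b)"
proof -
  have "F v = F (\<Sum>b\<in>Basis. (v \<bullet> b) *\<^sub>R b)" by (simp only: euclidean_representation)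
  then show ?thesis by (simp add: linear_sum[OF assms] linear_scale[OF assms])
qed

text \<open>Tensor fields are assumed smooth on constant arguments only. Expanding the argument in
  the standard basis turns a varying argument into smooth coefficients of constant ones.\<close>

lemma smooth_on_linear_apply:
  fixes F :: "'e::euclidean_space \<Rightarrow> 'h::euclidean_space \<Rightarrow> 'f::real_normed_vector"
  assumes D: "open D" and lin: "\<And>x. x \<in> D \<Longrightarrow> linear (F x)"
    and F: "\<And>v. smooth_on D (\<lambda>x. F x v)" and X: "smooth_on D X"
  shows "smooth_on D (\<lambda>x. F x (X x))"
proof (rule smooth_on_cong[OF _ D])
  show "smooth_on D (\<lambda>x. \<Sum>b\<in>Basis. (X x \<bullet> b) *\<^sub>R F x b)"
    by (intro smooth_on_sum D smooth_on_scaleR F smooth_on_bounded_linear[OF D bounded_linear_inner_left X])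
  show "(\<Sum>b\<in>Basis. (X x \<bullet> b) *\<^sub>R F x b) = F x (X x)" if "x \<in> D" for x
    using linear_euclidean_sum[OF lin[OF that]] by metis
qed

text \<open>Product rule for a field of linear maps: one term with the argument frozen at
  \<open>X x\<close>, one with the map frozen at \<open>x\<close>. Linearity is available on
  \<open>D\<close> only, so the basis expansions are compared on that neighbourhood.\<close>

lemma has_derivative_linear_apply:
  fixes F :: "'e::euclidean_space \<Rightarrow> 'h::euclidean_space \<Rightarrow> 'f::real_normed_vector"
  assumes D: "open D" and lin: "\<And>x. x \<in> D \<Longrightarrow> linear (F x)" and x: "x \<in> D"
    and F: "\<And>v. (\<lambda>y. F y v) differentiable (at x)" and X: "X differentiable (at x)"
  shows "((\<lambda>y. F y (X y)) has_derivative
    (\<lambda>v. frechet_derivative (\<lambda>y. F y (X x)) (at x) v + F x (frechet_derivative X (at x) v))) (at x)"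
proof -
  let ?X' = "frechet_derivative X (at x)" and ?F' = "\<lambda>b. frechet_derivative (\<lambda>y. F y b) (at x)"
  note dF = has_frechet_derivative[OF F]
  note dX = has_frechet_derivative[OF X]
  have "((\<lambda>y. \<Sum>b\<in>Basis. (X y \<bullet> b) *\<^sub>R F y b) has_derivative
      (\<lambda>v. \<Sum>b\<in>Basis. (X x \<bullet> b) *\<^sub>R ?F' b v + (?X' v \<bullet> b) *\<^sub>R F x b)) (at x)"
    by (intro has_derivative_sum has_derivative_scaleR has_derivative_inner_left dF dX)
  then have 1: "((\<lambda>y. F y (X y)) has_derivative
      (\<lambda>v. \<Sum>b\<in>Basis. (X x \<bullet> b) *\<^sub>R ?F' b v + (?X' v \<bullet> b) *\<^sub>R F x b)) (at x)"
    by (rule has_derivative_transform_within_open[OF _ D x])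
      (use linear_euclidean_sum[OF lin] in metis)
  have "((\<lambda>y. \<Sum>b\<in>Basis. (X x \<bullet> b) *\<^sub>R F y b) has_derivative
      (\<lambda>v. \<Sum>b\<in>Basis. (X x \<bullet> b) *\<^sub>R ?F' b v)) (at x)"
    by (intro has_derivative_sum has_derivative_scaleR_right dF)
  then have 2: "((\<lambda>y. F y (X x)) has_derivative
      (\<lambda>v. \<Sum>b\<in>Basis. (X x \<bullet> b) *\<^sub>R ?F' b v)) (at x)"
    by (rule has_derivative_transform_within_open[OF _ D x])
      (use linear_euclidean_sum[OF lin] in metis)
  show ?thesis
    using 1 unfolding frechet_derivative_eqI[OF 2] linear_euclidean_sum[OF lin[OF x], of "?X' _"]
    by (simp add: sum.distrib)
qed

lemmas frechet_derivative_linear_apply = has_derivative_linear_apply[THEN frechet_derivative_eqI, THEN fun_cong]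

lemma smooth_on_dir_deriv:
  fixes X :: "'n::finite vec_field"
  assumes "open D" "smooth_on D X" "smooth_on D f"
  shows "smooth_on D (dir_deriv X f)"
proof -
  have "smooth_on D (\<lambda>x. frechet_derivative f (at x) (X x))"
  proof (rule smooth_on_linear_apply[where F = "\<lambda>x. frechet_derivative f (at x)", OF assms(1)])
    show "linear (frechet_derivative f (at x))" if "x \<in> D" for x
      by (rule linear_frechet_derivative[OF smooth_on_differentiable[OF assms(3) that]])
    show "smooth_on D (\<lambda>x. frechet_derivative f (at x) v)" for v
      by (rule smooth_on_frechet_derivative[OF assms(3)])
  qed (rule assms)
  then show ?thesis by (simp add: dir_deriv_def[abs_def])
qed

text \<open>Two applications of the mean value theorem to the mixed difference over a parallelogram.
  This difference is symmetric in \<open>u\<close> and \<open>v\<close>, while the derivative on the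
  right has a fixed order; the symmetry of second derivatives rests on this.\<close>

lemma second_difference:
  fixes f :: "'e::euclidean_space \<Rightarrow> real"
  assumes D: "open D" "smooth_on D f" and s: "0 < s"
    and sub: "\<And>p q. 0 \<le> p \<Longrightarrow> p \<le> s \<Longrightarrow> 0 \<le> q \<Longrightarrow> q \<le> s \<Longrightarrow> x + p *\<^sub>R u + q *\<^sub>R v \<in> D"
  shows "\<exists>p q. 0 \<le> p \<and> p \<le> s \<and> 0 \<le> q \<and> q \<le> s \<and>
    f (x + s *\<^sub>R u + s *\<^sub>R v) - f (x + s *\<^sub>R u) - f (x + s *\<^sub>R v) + f x =
    s * s * frechet_derivative (\<lambda>y. frechet_derivative f (at y) u) (at (x + p *\<^sub>R u + q *\<^sub>R v)) v"
proof -
  let ?fu = "\<lambda>y. frechet_derivative f (at y) u"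
  have fu: "smooth_on D ?fu" by (rule smooth_on_frechet_derivative[OF D(2)])
  have chain: "((\<lambda>t. h (a + t *\<^sub>R w)) has_real_derivative frechet_derivative h (at (a + t *\<^sub>R w)) w) (at t)"
    if "smooth_on D h" "a + t *\<^sub>R w \<in> D" for h :: "'e \<Rightarrow> real" and a w t
  proof -
    note dh = has_frechet_derivative[OF smooth_on_differentiable[OF that]]
    have "((\<lambda>t. a + t *\<^sub>R w) has_derivative (\<lambda>r. r *\<^sub>R w)) (at t)"
      by (auto intro!: derivative_eq_intros)
    then have "((\<lambda>t. h (a + t *\<^sub>R w)) has_derivative (\<lambda>r. frechet_derivative h (at (a + t *\<^sub>R w)) (r *\<^sub>R w))) (at t)"
      by (rule has_derivative_compose[where f = "\<lambda>t. a + t *\<^sub>R w" and g = h, OF _ dh])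
    moreover have "frechet_derivative h (at (a + t *\<^sub>R w)) (r *\<^sub>R w) =
        frechet_derivative h (at (a + t *\<^sub>R w)) w * r" for r
      using linear_scale[OF has_derivative_linear[OF dh]] by simp
    ultimately show ?thesis by (simp add: has_field_derivative_def)
  qed
  \<comment> \<open>The function of \<open>t\<close> is a difference of \<open>f\<close> along two
    edges parallel to \<open>u\<close>; its derivative is a difference of \<open>?fu\<close> in
    direction \<open>v\<close>, ready for the second application.\<close>
  have "\<exists>p>0. p < s \<and> (f (x + s *\<^sub>R v + s *\<^sub>R u) - f (x + s *\<^sub>R u)) - (f (x + s *\<^sub>R v + 0 *\<^sub>R u) - f (x + 0 *\<^sub>R u)) =
      (s - 0) * (?fu (x + s *\<^sub>R v + p *\<^sub>R u) - ?fu (x + p *\<^sub>R u))"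
  proof (rule MVT2[OF s])
    fix t :: real assume "0 \<le> t" "t \<le> s"
    then show "((\<lambda>t. f (x + s *\<^sub>R v + t *\<^sub>R u) - f (x + t *\<^sub>R u)) has_real_derivative
        ?fu (x + s *\<^sub>R v + t *\<^sub>R u) - ?fu (x + t *\<^sub>R u)) (at t)"
      using sub[of t s] sub[of t 0] s
      by (intro DERIV_diff chain D) (auto simp: algebra_simps)
  qed
  then obtain p where p: "0 < p" "p < s" and
    1: "f (x + s *\<^sub>R v + s *\<^sub>R u) - f (x + s *\<^sub>R u) - (f (x + s *\<^sub>R v) - f x) =
      s * (?fu (x + s *\<^sub>R v + p *\<^sub>R u) - ?fu (x + p *\<^sub>R u))" by auto
  have "\<exists>q>0. q < s \<and> ?fu (x + p *\<^sub>R u + s *\<^sub>R v) - ?fu (x + p *\<^sub>R u + 0 *\<^sub>R v) =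
      (s - 0) * frechet_derivative ?fu (at (x + p *\<^sub>R u + q *\<^sub>R v)) v"
    by (rule MVT2[OF s]) (use sub p in \<open>auto intro!: chain fu\<close>)
  then obtain q where q: "0 < q" "q < s" and
    2: "?fu (x + p *\<^sub>R u + s *\<^sub>R v) - ?fu (x + p *\<^sub>R u) =
      s * frechet_derivative ?fu (at (x + p *\<^sub>R u + q *\<^sub>R v)) v" by auto
  have comm: "x + s *\<^sub>R v + p *\<^sub>R u = x + p *\<^sub>R u + s *\<^sub>R v" "x + s *\<^sub>R v + s *\<^sub>R u = x + s *\<^sub>R u + s *\<^sub>R v"
    by simp_all
  show ?thesis
    by (rule exI[of _ p], rule exI[of _ q]) (use p q 1 2 in \<open>simp add: comm\<close>)
qed

text \<open>If the mixed derivatives differed at \<open>x\<close>, continuity would keep them apart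
  on a small parallelogram, but the mixed difference over it is \<open>s * s\<close> times a value
  of either of them.\<close>

lemma second_derivative_symmetric_real:
  fixes f :: "'e::euclidean_space \<Rightarrow> real"
  assumes D: "open D" "smooth_on D f" and x: "x \<in> D"
  shows "frechet_derivative (\<lambda>y. frechet_derivative f (at y) u) (at x) v =
    frechet_derivative (\<lambda>y. frechet_derivative f (at y) v) (at x) u"
    (is "?A x = ?B x")
proof (rule ccontr)
  assume ne: "?A x \<noteq> ?B x"
  have "continuous_on D ?A" "continuous_on D ?B"
    by (intro smooth_on_continuous_on smooth_on_frechet_derivative D)+
  then have cont: "isCont ?A x" "isCont ?B x"
    using D(1) x continuous_on_eq_continuous_at by blast+
  \<comment> \<open>Half the gap: a value within \<open>e\<close> of \<open>?A x\<close> and a value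
    within \<open>e\<close> of \<open>?B x\<close> cannot be equal.\<close>
  define e where "e = \<bar>?A x - ?B x\<bar> / 2"
  have e: "0 < e" using ne by (simp add: e_def)
  obtain d1 where d1: "d1 > 0" "\<And>y. dist y x < d1 \<Longrightarrow> dist (?A y) (?A x) < e"
    using cont(1) e unfolding continuous_at_eps_delta by blast
  obtain d2 where d2: "d2 > 0" "\<And>y. dist y x < d2 \<Longrightarrow> dist (?B y) (?B x) < e"
    using cont(2) e unfolding continuous_at_eps_delta by blast
  obtain d3 where d3: "d3 > 0" "ball x d3 \<subseteq> D"
    using D(1) x open_contains_ball by blast
  define d where "d = Min {d1, d2, d3}"
  have d: "0 < d" "d \<le> d1" "d \<le> d2" "d \<le> d3" using d1 d2 d3 by (auto simp: d_def)
  \<comment> \<open>All points of the parallelogram then lie within \<open>d / 2\<close> of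
    \<open>x\<close>; the summand \<open>1\<close> keeps the denominator positive when
    \<open>u\<close> and \<open>v\<close> are zero.\<close>
  define s where "s = d / (2 * (norm u + norm v + 1))"
  have pos: "norm u + norm v + 1 > 0" by (simp add: add_nonneg_pos)
  have s: "0 < s" using d pos by (simp add: s_def)
  have near: "dist (x + p *\<^sub>R u + q *\<^sub>R v) x < d"
    if "0 \<le> p" "p \<le> s" "0 \<le> q" "q \<le> s" for p q
  proof -
    have "dist (x + p *\<^sub>R u + q *\<^sub>R v) x \<le> p * norm u + q * norm v"
      using that norm_triangle_ineq[of "p *\<^sub>R u" "q *\<^sub>R v"] by (simp add: dist_norm add.assoc)
    also have "\<dots> \<le> s * norm u + s * norm v"
      using that by (intro add_mono mult_right_mono) auto
    also have "\<dots> \<le> s * (norm u + norm v + 1)" using s by (simp add: algebra_simps)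
    also have "\<dots> = d / 2"
    proof -
      have "d / (2 * c) * c = d / 2" if "c > 0" for c :: real using that by simp
      then show ?thesis using pos unfolding s_def by blast
    qed
    finally show ?thesis using d by simp
  qed
  have sub: "x + p *\<^sub>R u + q *\<^sub>R v \<in> D"
    if "0 \<le> p" "p \<le> s" "0 \<le> q" "q \<le> s" for p q
    using near[OF that] d d3 by (auto simp: dist_commute subset_iff)
  have sub': "x + p *\<^sub>R v + q *\<^sub>R u \<in> D"
    if "0 \<le> p" "p \<le> s" "0 \<le> q" "q \<le> s" for p q
    using sub[of q p] that by (simp add: algebra_simps)
  obtain p q where pq: "0 \<le> p" "p \<le> s" "0 \<le> q" "q \<le> s"
    and 1: "f (x + s *\<^sub>R u + s *\<^sub>R v) - f (x + s *\<^sub>R u) - f (x + s *\<^sub>R v) + f x =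
      s * s * ?A (x + p *\<^sub>R u + q *\<^sub>R v)"
    using second_difference[OF D s sub] by blast
  obtain p' q' where pq': "0 \<le> p'" "p' \<le> s" "0 \<le> q'" "q' \<le> s"
    and 2: "f (x + s *\<^sub>R v + s *\<^sub>R u) - f (x + s *\<^sub>R v) - f (x + s *\<^sub>R u) + f x =
      s * s * ?B (x + p' *\<^sub>R v + q' *\<^sub>R u)"
    using second_difference[OF D s sub'] by blast
  have "x + s *\<^sub>R v + s *\<^sub>R u = x + s *\<^sub>R u + s *\<^sub>R v" by simp
  with 1 2 have eq: "s * s * ?A (x + p *\<^sub>R u + q *\<^sub>R v) = s * s * ?B (x + p' *\<^sub>R v + q' *\<^sub>R u)"
    by (smt (verit))
  have "?A (x + p *\<^sub>R u + q *\<^sub>R v) = ?B (x + p' *\<^sub>R v + q' *\<^sub>R u)"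
    by (rule mult_left_cancel[THEN iffD1, OF _ eq]) (use s in simp)
  moreover have "dist (?A (x + p *\<^sub>R u + q *\<^sub>R v)) (?A x) < e"
    using near[OF pq] d d1 by simp
  moreover have "dist (?B (x + p' *\<^sub>R v + q' *\<^sub>R u)) (?B x) < e"
    using near[of q' p'] pq' d d2(2)[of "x + p' *\<^sub>R v + q' *\<^sub>R u"] by (simp add: algebra_simps)
  ultimately show False by (simp add: e_def dist_real_def abs_if split: if_splits)
qed

lemma second_derivative_symmetric:
  fixes f :: "'e::euclidean_space \<Rightarrow> 'f::euclidean_space"
  assumes D: "open D" "smooth_on D f" and x: "x \<in> D"
  shows "frechet_derivative (\<lambda>y. frechet_derivative f (at y) u) (at x) v =
    frechet_derivative (\<lambda>y. frechet_derivative f (at y) v) (at x) u"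
proof (rule euclidean_eqI)
  fix b :: 'f assume "b \<in> Basis"
  have fb: "smooth_on D (\<lambda>y. f y \<bullet> b)"
    by (rule smooth_on_bounded_linear[OF D(1) bounded_linear_inner_left D(2)])
  have comp: "frechet_derivative (\<lambda>y. frechet_derivative f (at y) u) (at x) v \<bullet> b =
      frechet_derivative (\<lambda>y. frechet_derivative (\<lambda>y. f y \<bullet> b) (at y) u) (at x) v" for u v
  proof -
    have "frechet_derivative (\<lambda>y. frechet_derivative (\<lambda>y. f y \<bullet> b) (at y) u) (at x) =
        frechet_derivative (\<lambda>y. frechet_derivative f (at y) u \<bullet> b) (at x)"
      by (rule frechet_derivative_cong_open[OF D(1) x])
        (simp add: frechet_derivative_bounded_linear[OF bounded_linear_inner_left
            smooth_on_differentiable[OF D(2)]])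
    then show ?thesis
      by (simp add: frechet_derivative_bounded_linear[OF bounded_linear_inner_left
            smooth_on_differentiable[OF smooth_on_frechet_derivative[OF D(2)] x]])
  qed
  show "frechet_derivative (\<lambda>y. frechet_derivative f (at y) u) (at x) v \<bullet> b =
    frechet_derivative (\<lambda>y. frechet_derivative f (at y) v) (at x) u \<bullet> b"
    unfolding comp by (rule second_derivative_symmetric_real[OF D(1) fb x])
qed

section \<open>Vector fields and connections in a chart\<close>

lemma bilinearD:
  assumes "bilinear B"
  shows "linear (B u)" "linear (\<lambda>u. B u v)"
  using assms by (auto simp: bilinear_def eta_contract_eq)

lemma smooth_on_bilinear_apply:
  fixes B :: "'e::euclidean_space \<Rightarrow> 'h::euclidean_space \<Rightarrow> 'k::euclidean_space \<Rightarrow> 'f::real_normed_vector"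
  assumes D: "open D" and bil: "\<And>x. x \<in> D \<Longrightarrow> bilinear (B x)"
    and B: "\<And>u v. smooth_on D (\<lambda>x. B x u v)" and Y: "smooth_on D Y" and Z: "smooth_on D Z"
  shows "smooth_on D (\<lambda>x. B x (Y x) (Z x))"
  by (rule smooth_on_linear_apply[where F = "\<lambda>x. B x (Y x)", OF D bilinearD(1)[OF bil]
        smooth_on_linear_apply[where F = "\<lambda>x u. B x u v" for v, OF D bilinearD(2)[OF bil] B Y] Z])

lemma frechet_derivative_bilinear_apply:
  fixes B :: "'e::euclidean_space \<Rightarrow> 'h::euclidean_space \<Rightarrow> 'k::euclidean_space \<Rightarrow> 'f::real_normed_vector"
  assumes D: "open D" and bil: "\<And>x. x \<in> D \<Longrightarrow> bilinear (B x)" and x: "x \<in> D"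
    and B: "\<And>u v. (\<lambda>y. B y u v) differentiable (at x)"
    and Y: "Y differentiable (at x)" and Z: "Z differentiable (at x)"
  shows "frechet_derivative (\<lambda>y. B y (Y y) (Z y)) (at x) w =
    frechet_derivative (\<lambda>y. B y (Y x) (Z x)) (at x) w +
    B x (frechet_derivative Y (at x) w) (Z x) + B x (Y x) (frechet_derivative Z (at x) w)"
proof -
  note left = D bilinearD(2)[OF bil] x B Y
  have "(\<lambda>y. B y (Y y) v) differentiable (at x)" for v
    by (rule differentiableI[OF has_derivative_linear_apply[where F = "\<lambda>y u. B y u v", OF left]])
  then show ?thesis
    using frechet_derivative_linear_apply[where F = "\<lambda>y. B y (Y y)", OF D bilinearD(1)[OF bil] x _ Z, of w]
      frechet_derivative_linear_apply[where F = "\<lambda>y u. B y u (Z x)", OF left, of w]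
    by simp
qed

section \<open>Directional derivatives and Lie brackets\<close>

lemma dir_deriv_cong:
  "open D \<Longrightarrow> x \<in> D \<Longrightarrow> (\<And>y. y \<in> D \<Longrightarrow> f y = h y) \<Longrightarrow> dir_deriv X f x = dir_deriv X h x"
  unfolding dir_deriv_def using frechet_derivative_cong_open[of D x f h] by simp

lemma dir_deriv_const [simp]: "dir_deriv X (\<lambda>_. c) x = 0"
  by (simp add: dir_deriv_def)

lemma dir_deriv_const_on:
  assumes "open D" "x \<in> D" "\<And>y. y \<in> D \<Longrightarrow> f y = c"
  shows "dir_deriv X f x = 0"
  using dir_deriv_cong[of D x f "\<lambda>_. c" X] assms by simp

lemma dir_deriv_add:
  "smooth_on D f \<Longrightarrow> smooth_on D h \<Longrightarrow> x \<in> D \<Longrightarrow>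
    dir_deriv X (\<lambda>y. f y + h y) x = dir_deriv X f x + dir_deriv X h x"
  unfolding dir_deriv_def by (rule frechet_derivative_add) (rule smooth_on_differentiable; assumption)+

lemma dir_deriv_bounded_linear:
  "bounded_linear L \<Longrightarrow> smooth_on D f \<Longrightarrow> x \<in> D \<Longrightarrow> dir_deriv X (\<lambda>y. L (f y)) x = L (dir_deriv X f x)"
  unfolding dir_deriv_def
  by (rule frechet_derivative_bounded_linear) (assumption | rule smooth_on_differentiable; assumption)+

lemmas dir_deriv_minus = dir_deriv_bounded_linear[OF bounded_linear_minus[OF bounded_linear_ident]]

lemma dir_deriv_diff:
  assumes "open D" "smooth_on D f" "smooth_on D h" "x \<in> D"
  shows "dir_deriv X (\<lambda>y. f y - h y) x = dir_deriv X f x - dir_deriv X h x"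
  using dir_deriv_add[OF assms(2) smooth_on_minus[OF assms(1,3)] assms(4)]
    dir_deriv_minus[OF assms(3,4)] by simp

lemma dir_deriv_bilinear:
  assumes "bounded_bilinear B" "smooth_on D f" "smooth_on D h" "x \<in> D"
  shows "dir_deriv X (\<lambda>y. B (f y) (h y)) x = B (f x) (dir_deriv X h x) + B (dir_deriv X f x) (h x)"
  unfolding dir_deriv_def
  by (rule frechet_derivative_bilinear[OF assms(1) smooth_on_differentiable[OF assms(2,4)]
        smooth_on_differentiable[OF assms(3,4)]])

lemmas dir_deriv_scaleR = dir_deriv_bilinear[OF bounded_bilinear_scaleR]
lemmas dir_deriv_mult = dir_deriv_bilinear[OF bounded_bilinear_mult]

lemma smooth_on_lie_bracket:
  fixes X Y :: "'n::finite vec_field"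
  assumes "open D" "smooth_on D X" "smooth_on D Y"
  shows "smooth_on D (lie_bracket X Y)"
  unfolding lie_bracket_def[abs_def]
  by (intro smooth_on_diff smooth_on_dir_deriv assms)

lemma lie_bracket_cong:
  assumes "open D" "x \<in> D" "\<And>y. y \<in> D \<Longrightarrow> X y = X' y" "\<And>y. y \<in> D \<Longrightarrow> Y y = Y' y"
  shows "lie_bracket X Y x = lie_bracket X' Y' x"
  using frechet_derivative_cong_open[OF assms(1,2,3)] frechet_derivative_cong_open[OF assms(1,2,4)]
    assms(2-4)
  by (simp add: lie_bracket_def dir_deriv_def)

lemma lie_bracket_scaleR_right:
  fixes X Y :: "'n::finite vec_field"
  assumes "smooth_on D f" "smooth_on D Y" "smooth_on D X" "x \<in> D"
  shows "lie_bracket X (\<lambda>y. f y *\<^sub>R Y y) x = f x *\<^sub>R lie_bracket X Y x + dir_deriv X f x *\<^sub>R Y x"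
  using linear_scale[OF linear_frechet_derivative[OF smooth_on_differentiable[OF assms(3,4)]]]
  by (simp add: lie_bracket_def dir_deriv_scaleR[OF assms(1,2,4)] algebra_simps)
    (simp add: dir_deriv_def)

text \<open>Separates the second derivative of \<open>f\<close>, which is symmetric in the two
  directions and cancels in a commutator, from the term that differentiates \<open>Y\<close> and
  survives in the bracket.\<close>

lemma dir_deriv_dir_deriv:
  fixes X Y :: "'n::finite vec_field"
  assumes D: "open D" and s: "smooth_on D Y" "smooth_on D f" and x: "x \<in> D"
  shows "dir_deriv X (dir_deriv Y f) x =
    frechet_derivative (\<lambda>y. frechet_derivative f (at y) (Y x)) (at x) (X x) +
    frechet_derivative f (at x) (dir_deriv X Y x)"
  unfolding dir_deriv_def[abs_def]
  by (rule frechet_derivative_linear_apply[where F = "\<lambda>y. frechet_derivative f (at y)",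
        OF D linear_frechet_derivative[OF smooth_on_differentiable[OF s(2)]] x
          smooth_on_differentiable[OF smooth_on_frechet_derivative[OF s(2)] x]
          smooth_on_differentiable[OF s(1) x]])

lemma dir_deriv_lie_bracket:
  fixes X Y :: "'n::finite vec_field" and f :: "real ^ 'n \<Rightarrow> 'f::euclidean_space"
  assumes D: "open D" and s: "smooth_on D X" "smooth_on D Y" "smooth_on D f" and x: "x \<in> D"
  shows "dir_deriv (lie_bracket X Y) f x = dir_deriv X (dir_deriv Y f) x - dir_deriv Y (dir_deriv X f) x"
  unfolding dir_deriv_dir_deriv[OF D s(2,3) x] dir_deriv_dir_deriv[OF D s(1,3) x]
  using second_derivative_symmetric[OF D s(3) x, of "Y x" "X x"]
    linear_diff[OF linear_frechet_derivative[OF smooth_on_differentiable[OF s(3) x]]]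
  by (simp add: dir_deriv_def lie_bracket_def)

text \<open>A Levi-Civita connection given by data at points, so that it makes sense on every open
  subset: \<open>sym_\<Gamma>\<close> is the vanishing of the torsion and \<open>compat\<close> the
  compatibility with the metric, both tested on constant fields.\<close>

locale christoffel_chart =
  fixes D :: "(real ^ 'n::finite) set" and g :: "'n bil_field"
    and \<Gamma> :: "real ^ 'n \<Rightarrow> real ^ 'n \<Rightarrow> real ^ 'n \<Rightarrow> real ^ 'n"
  assumes open_D: "open D"
    and bil_g: "x \<in> D \<Longrightarrow> bilinear (g x)"
    and smooth_g: "smooth_on D (\<lambda>x. g x u v)"
    and sym_g: "x \<in> D \<Longrightarrow> g x u v = g x v u"
    and nondegenerate_g: "x \<in> D \<Longrightarrow> (\<And>v. g x u v = 0) \<Longrightarrow> u = 0"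
    and bil_\<Gamma>: "x \<in> D \<Longrightarrow> bilinear (\<Gamma> x)"
    and smooth_\<Gamma>: "smooth_on D (\<lambda>x. \<Gamma> x u v)"
    and sym_\<Gamma>: "x \<in> D \<Longrightarrow> \<Gamma> x u v = \<Gamma> x v u"
    and compat: "x \<in> D \<Longrightarrow> frechet_derivative (\<lambda>y. g y v w) (at x) u = g x (\<Gamma> x u v) w + g x v (\<Gamma> x u w)"
begin

definition cov :: "'n connection" where
  "cov X Y x = dir_deriv X Y x + \<Gamma> x (X x) (Y x)"

text \<open>The coordinate formula of the curvature tensor. It takes vectors instead of fields and
  is therefore unaffected by a change of the domain on which fields are smooth.\<close>

definition curv :: "real ^ 'n \<Rightarrow> real ^ 'n \<Rightarrow> real ^ 'n \<Rightarrow> real ^ 'n \<Rightarrow> real ^ 'n" where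
  "curv x u v w = frechet_derivative (\<lambda>y. \<Gamma> y v w) (at x) u - frechet_derivative (\<lambda>y. \<Gamma> y u w) (at x) v
     + \<Gamma> x u (\<Gamma> x v w) - \<Gamma> x v (\<Gamma> x u w)"

text \<open>For null frames, which are found only on a neighbourhood of a given point.\<close>

lemma restrict:
  assumes "open U" "U \<subseteq> D"
  shows "christoffel_chart U g \<Gamma>"
  by unfold_locales
    (use assms(2) in \<open>auto intro: assms(1) smooth_on_subset[OF smooth_g] smooth_on_subset[OF smooth_\<Gamma>]
      bil_g bil_\<Gamma> sym_g sym_\<Gamma> nondegenerate_g simp: compat\<close>)

lemmas g_simps =
  bilinear_ladd[OF bil_g] bilinear_radd[OF bil_g] bilinear_lmul[OF bil_g] bilinear_rmul[OF bil_g]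
  bilinear_lneg[OF bil_g] bilinear_rneg[OF bil_g] bilinear_lsub[OF bil_g] bilinear_rsub[OF bil_g]
  bilinear_lzero[OF bil_g] bilinear_rzero[OF bil_g]

lemmas \<Gamma>_simps =
  bilinear_ladd[OF bil_\<Gamma>] bilinear_radd[OF bil_\<Gamma>] bilinear_lmul[OF bil_\<Gamma>] bilinear_rmul[OF bil_\<Gamma>]
  bilinear_lneg[OF bil_\<Gamma>] bilinear_rneg[OF bil_\<Gamma>] bilinear_lsub[OF bil_\<Gamma>] bilinear_rsub[OF bil_\<Gamma>]
  bilinear_lzero[OF bil_\<Gamma>] bilinear_rzero[OF bil_\<Gamma>]

lemma smooth_metric:
  "smooth_on D Y \<Longrightarrow> smooth_on D Z \<Longrightarrow> smooth_on D (\<lambda>x. g x (Y x) (Z x))"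
  by (rule smooth_on_bilinear_apply[OF open_D bil_g smooth_g])

lemma smooth_on_\<Gamma>_apply:
  "smooth_on D Y \<Longrightarrow> smooth_on D Z \<Longrightarrow> smooth_on D (\<lambda>x. \<Gamma> x (Y x) (Z x))"
  by (rule smooth_on_bilinear_apply[OF open_D bil_\<Gamma> smooth_\<Gamma>])

lemma cov_metric:
  assumes "smooth_on D Y" "smooth_on D Z" "x \<in> D"
  shows "dir_deriv X (\<lambda>y. g y (Y y) (Z y)) x = g x (cov X Y x) (Z x) + g x (Y x) (cov X Z x)"
  using frechet_derivative_bilinear_apply[where B = g, OF open_D bil_g assms(3)
      smooth_on_differentiable[OF smooth_g assms(3)] smooth_on_differentiable[OF assms(1,3)]
      smooth_on_differentiable[OF assms(2,3)], of "X x"] assms(3)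
  by (simp add: cov_def dir_deriv_def g_simps compat)

lemma cov_torsion: "x \<in> D \<Longrightarrow> cov X Y x - cov Y X x = lie_bracket X Y x"
  by (simp add: cov_def lie_bracket_def sym_\<Gamma>[of x "X x"])

lemma cov_scaleR:
  "smooth_on D f \<Longrightarrow> smooth_on D Y \<Longrightarrow> x \<in> D \<Longrightarrow>
    cov X (\<lambda>y. f y *\<^sub>R Y y) x = dir_deriv X f x *\<^sub>R Y x + f x *\<^sub>R cov X Y x"
  by (simp add: cov_def dir_deriv_scaleR \<Gamma>_simps algebra_simps)

lemma cov_cong:
  "(\<And>y. y \<in> D \<Longrightarrow> Y y = Z y) \<Longrightarrow> x \<in> D \<Longrightarrow> cov X Y x = cov X Z x"
  using dir_deriv_cong[OF open_D, of x Y Z X] by (simp add: cov_def)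

lemma linear_dir:
  assumes "smooth_on D Y" "x \<in> D"
  shows "linear (\<lambda>u. cov (\<lambda>_. u) Y x)"
  unfolding cov_def dir_deriv_def
  by (rule linear_compose_add[OF linear_frechet_derivative[OF smooth_on_differentiable[OF assms]]
        bilinearD(2)[OF bil_\<Gamma>[OF assms(2)]]])

lemma cov_at: "cov X Y x = cov (\<lambda>_. X x) Y x"
  by (simp add: cov_def dir_deriv_def)

lemma linear_\<Gamma>_derivative:
  assumes "x \<in> D"
  shows "linear (\<lambda>v. frechet_derivative (\<lambda>y. \<Gamma> y v w) (at x) u)"
    "linear (\<lambda>w. frechet_derivative (\<lambda>y. \<Gamma> y v w) (at x) u)"
    "linear (frechet_derivative (\<lambda>y. \<Gamma> y v w) (at x))"
proof -
  note d = smooth_on_differentiable[OF smooth_\<Gamma> assms]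
  note cong = frechet_derivative_cong_open[OF open_D assms]
  show "linear (frechet_derivative (\<lambda>y. \<Gamma> y v w) (at x))"
    by (rule linear_frechet_derivative[OF d])
  show "linear (\<lambda>v. frechet_derivative (\<lambda>y. \<Gamma> y v w) (at x) u)"
  proof (rule linearI)
    fix a b :: "real ^ 'n" and c :: real
    have "frechet_derivative (\<lambda>y. \<Gamma> y (a + b) w) (at x) =
        frechet_derivative (\<lambda>y. \<Gamma> y a w + \<Gamma> y b w) (at x)"
      by (rule cong) (simp add: \<Gamma>_simps)
    then show "frechet_derivative (\<lambda>y. \<Gamma> y (a + b) w) (at x) u =
        frechet_derivative (\<lambda>y. \<Gamma> y a w) (at x) u + frechet_derivative (\<lambda>y. \<Gamma> y b w) (at x) u"
      using frechet_derivative_add[OF d d] by simp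
    have "frechet_derivative (\<lambda>y. \<Gamma> y (c *\<^sub>R a) w) (at x) =
        frechet_derivative (\<lambda>y. c *\<^sub>R \<Gamma> y a w) (at x)"
      by (rule cong) (simp add: \<Gamma>_simps)
    then show "frechet_derivative (\<lambda>y. \<Gamma> y (c *\<^sub>R a) w) (at x) u =
        c *\<^sub>R frechet_derivative (\<lambda>y. \<Gamma> y a w) (at x) u"
      using frechet_derivative_bounded_linear[OF bounded_linear_scaleR_right d] by simp
  qed
  show "linear (\<lambda>w. frechet_derivative (\<lambda>y. \<Gamma> y v w) (at x) u)"
  proof (rule linearI)
    fix a b :: "real ^ 'n" and c :: real
    have "frechet_derivative (\<lambda>y. \<Gamma> y v (a + b)) (at x) =
        frechet_derivative (\<lambda>y. \<Gamma> y v a + \<Gamma> y v b) (at x)"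
      by (rule cong) (simp add: \<Gamma>_simps)
    then show "frechet_derivative (\<lambda>y. \<Gamma> y v (a + b)) (at x) u =
        frechet_derivative (\<lambda>y. \<Gamma> y v a) (at x) u + frechet_derivative (\<lambda>y. \<Gamma> y v b) (at x) u"
      using frechet_derivative_add[OF d d] by simp
    have "frechet_derivative (\<lambda>y. \<Gamma> y v (c *\<^sub>R a)) (at x) =
        frechet_derivative (\<lambda>y. c *\<^sub>R \<Gamma> y v a) (at x)"
      by (rule cong) (simp add: \<Gamma>_simps)
    then show "frechet_derivative (\<lambda>y. \<Gamma> y v (c *\<^sub>R a)) (at x) u =
        c *\<^sub>R frechet_derivative (\<lambda>y. \<Gamma> y v a) (at x) u"
      using frechet_derivative_bounded_linear[OF bounded_linear_scaleR_right d] by simp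
  qed
qed

lemma curv_antisym: "curv x u v w = - curv x v u w"
  by (simp add: curv_def)

lemma linear_curv:
  assumes "x \<in> D"
  shows "linear (\<lambda>u. curv x u v w)" "linear (\<lambda>v. curv x u v w)" "linear (\<lambda>w. curv x u v w)"
proof -
  note lin = linear_\<Gamma>_derivative[OF assms]
  note simps = linear_add[OF lin(1)] linear_add[OF lin(2)] linear_add[OF lin(3)]
    linear_scale[OF lin(1)] linear_scale[OF lin(2)] linear_scale[OF lin(3)]
  show *: "linear (\<lambda>u. curv x u v w)" for v
    by (rule linearI) (simp_all add: curv_def simps \<Gamma>_simps[OF assms] algebra_simps)
  show "linear (\<lambda>v. curv x u v w)"
    by (subst curv_antisym) (rule linear_compose_neg[OF *])
  show "linear (\<lambda>w. curv x u v w)"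
    by (rule linearI) (simp_all add: curv_def simps \<Gamma>_simps[OF assms] algebra_simps)
qed

text \<open>After exchanging the arguments of \<open>\<Gamma>\<close>, which vanishing torsion
  allows, every derivative term and every quadratic term of the cyclic sum occurs twice with
  opposite signs.\<close>

lemma curv_Bianchi:
  assumes "x \<in> D"
  shows "curv x u v w + curv x v w u + curv x w u v = 0"
proof -
  have "frechet_derivative (\<lambda>y. \<Gamma> y a b) (at x) = frechet_derivative (\<lambda>y. \<Gamma> y b a) (at x)" for a b
    by (rule frechet_derivative_cong_open[OF open_D assms]) (rule sym_\<Gamma>)
  note 1 = this[of u v] this[of v w] this[of w u]
  have 2: "\<Gamma> x u v = \<Gamma> x v u" "\<Gamma> x v w = \<Gamma> x w v" "\<Gamma> x w u = \<Gamma> x u w"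
    using sym_\<Gamma>[OF assms] by blast+
  show ?thesis unfolding curv_def 1 2 by simp
qed

text \<open>Second derivatives of \<open>Z\<close> cancel by symmetry, and the derivatives of
  \<open>X\<close> and \<open>Y\<close> are absorbed by the bracket term; what remains depends on
  values at \<open>x\<close> alone.\<close>

lemma riemann_cov:
  assumes s: "smooth_on D X" "smooth_on D Y" "smooth_on D Z" and x: "x \<in> D"
  shows "riemann cov X Y Z x = curv x (X x) (Y x) (Z x)"
proof -
  \<comment> \<open>The terms that combine \<open>\<Gamma>\<close> with a first derivative of
    \<open>Z\<close> are together symmetric in \<open>X\<close> and \<open>Y\<close>, so they drop
    out of the commutator.\<close>
  have cc: "cov X (cov Y Z) x =
      frechet_derivative (\<lambda>y. frechet_derivative Z (at y) (Y x)) (at x) (X x)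
      + frechet_derivative Z (at x) (dir_deriv X Y x)
      + frechet_derivative (\<lambda>y. \<Gamma> y (Y x) (Z x)) (at x) (X x)
      + \<Gamma> x (dir_deriv X Y x) (Z x) + \<Gamma> x (Y x) (dir_deriv X Z x)
      + \<Gamma> x (X x) (dir_deriv Y Z x) + \<Gamma> x (X x) (\<Gamma> x (Y x) (Z x))"
    if s: "smooth_on D X" "smooth_on D Y" for X Y
  proof -
    have "dir_deriv X (cov Y Z) x = dir_deriv X (dir_deriv Y Z) x + dir_deriv X (\<lambda>y. \<Gamma> y (Y y) (Z y)) x"
      unfolding cov_def[abs_def]
      by (rule dir_deriv_add[OF smooth_on_dir_deriv[OF open_D s(2) assms(3)]
            smooth_on_\<Gamma>_apply[OF s(2) assms(3)] x])
    moreover have "dir_deriv X (\<lambda>y. \<Gamma> y (Y y) (Z y)) x =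
        frechet_derivative (\<lambda>y. \<Gamma> y (Y x) (Z x)) (at x) (X x)
        + \<Gamma> x (dir_deriv X Y x) (Z x) + \<Gamma> x (Y x) (dir_deriv X Z x)"
      unfolding dir_deriv_def
      by (rule frechet_derivative_bilinear_apply[OF open_D bil_\<Gamma> x
            smooth_on_differentiable[OF smooth_\<Gamma> x] smooth_on_differentiable[OF s(2) x]
            smooth_on_differentiable[OF assms(3) x]])
    ultimately show ?thesis
      unfolding dir_deriv_dir_deriv[OF open_D s(2) assms(3) x]
      by (simp add: cov_def[of X "cov Y Z"] cov_def[of Y Z] \<Gamma>_simps[OF x] algebra_simps)
  qed
  have "frechet_derivative Z (at x) (dir_deriv X Y x - dir_deriv Y X x) =
    frechet_derivative Z (at x) (dir_deriv X Y x) - frechet_derivative Z (at x) (dir_deriv Y X x)"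
    by (rule linear_diff[OF linear_frechet_derivative[OF smooth_on_differentiable[OF s(3) x]]])
  then show ?thesis
    unfolding riemann_def cc[OF s(1,2)] cc[OF s(2,1)]
    using second_derivative_symmetric[OF open_D s(3) x, of "Y x" "X x"]
    by (simp add: cov_def lie_bracket_def curv_def \<Gamma>_simps[OF x] dir_deriv_def[of "\<lambda>_. _"]
        dir_deriv_def[of "lie_bracket X Y"])
qed

end

text \<open>Expand both fields in the standard basis: the connection is linear over functions in the
  first argument and obeys the Leibniz rule in the second, so its values on constant fields
  determine it. Brackets of constant fields vanish, which makes \<open>\<Gamma>\<close>
  symmetric.\<close>

lemma levi_civita_on_christoffel:
  fixes N :: "'n::finite connection"
  assumes D: "open D" and bil: "\<And>x. x \<in> D \<Longrightarrow> bilinear (g x)"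
    and smooth: "\<And>u v. smooth_on D (\<lambda>x. g x u v)"
    and sym: "\<And>x u v. x \<in> D \<Longrightarrow> g x u v = g x v u"
    and nondeg: "\<And>x u. x \<in> D \<Longrightarrow> (\<And>v. g x u v = 0) \<Longrightarrow> u = 0"
    and LC: "levi_civita_on D g N"
  defines "\<Gamma> \<equiv> \<lambda>x u v. N (\<lambda>_. u) (\<lambda>_. v) x"
  shows "christoffel_chart D g \<Gamma>"
    and "\<And>X Y x. smooth_on D X \<Longrightarrow> smooth_on D Y \<Longrightarrow> x \<in> D \<Longrightarrow>
      N X Y x = christoffel_chart.cov \<Gamma> X Y x"
proof -
  note c = smooth_on_const
  note LC' = LC[unfolded levi_civita_on_def affine_connection_on_def]
  note conn = LC'[THEN conjunct1]
  have N_smooth: "smooth_on D (N X Y)" if "smooth_on D X" "smooth_on D Y" for X Y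
    by (rule conn[THEN conjunct1, rule_format, OF that])
  have N_add: "N (\<lambda>y. X y + X' y) Y x = N X Y x + N X' Y x"
    if "smooth_on D X" "smooth_on D X'" "smooth_on D Y" "x \<in> D" for X X' Y x
    by (rule conn[THEN conjunct2, THEN conjunct1, rule_format, OF that])
  have N_scale: "N (\<lambda>y. f y *\<^sub>R X y) Y x = f x *\<^sub>R N X Y x"
    if "smooth_on D f" "smooth_on D X" "smooth_on D Y" "x \<in> D" for f X Y x
    by (rule conn[THEN conjunct2, THEN conjunct2, THEN conjunct1, rule_format, OF that])
  have N_add': "N X (\<lambda>y. Y y + Y' y) x = N X Y x + N X Y' x"
    if "smooth_on D X" "smooth_on D Y" "smooth_on D Y'" "x \<in> D" for X Y Y' x
    by (rule conn[THEN conjunct2, THEN conjunct2, THEN conjunct2, THEN conjunct1, rule_format, OF that])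
  have N_scale': "N X (\<lambda>y. f y *\<^sub>R Y y) x = dir_deriv X f x *\<^sub>R Y x + f x *\<^sub>R N X Y x"
    if "smooth_on D f" "smooth_on D X" "smooth_on D Y" "x \<in> D" for f X Y x
    by (rule conn[THEN conjunct2, THEN conjunct2, THEN conjunct2, THEN conjunct2, rule_format, OF that])
  have torsion: "N X Y x - N Y X x = lie_bracket X Y x"
    if "smooth_on D X" "smooth_on D Y" "x \<in> D" for X Y x
    by (rule LC'[THEN conjunct2, THEN conjunct1, rule_format, OF that])
  have metric: "dir_deriv X (\<lambda>y. g y (Y y) (Z y)) x = g x (N X Y x) (Z x) + g x (Y x) (N X Z x)"
    if "smooth_on D X" "smooth_on D Y" "smooth_on D Z" "x \<in> D" for X Y Z x
    by (rule LC'[THEN conjunct2, THEN conjunct2, rule_format, OF that])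
  show chart: "christoffel_chart D g \<Gamma>"
  proof
    show "bilinear (\<Gamma> x)" if x: "x \<in> D" for x
      unfolding bilinear_def \<Gamma>_def
    proof (intro conjI allI linearI)
      fix u v w :: "real ^ 'n" and r :: real
      show "N (\<lambda>_. u) (\<lambda>_. v + w) x = N (\<lambda>_. u) (\<lambda>_. v) x + N (\<lambda>_. u) (\<lambda>_. w) x"
        using N_add'[of "\<lambda>_. u" "\<lambda>_. v" "\<lambda>_. w" x] x by (simp add: c)
      show "N (\<lambda>_. u) (\<lambda>_. r *\<^sub>R v) x = r *\<^sub>R N (\<lambda>_. u) (\<lambda>_. v) x"
        using N_scale'[of "\<lambda>_. r" "\<lambda>_. u" "\<lambda>_. v" x] x by (simp add: c)
      show "N (\<lambda>_. u + v) (\<lambda>_. w) x = N (\<lambda>_. u) (\<lambda>_. w) x + N (\<lambda>_. v) (\<lambda>_. w) x"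
        using N_add[of "\<lambda>_. u" "\<lambda>_. v" "\<lambda>_. w" x] x by (simp add: c)
      show "N (\<lambda>_. r *\<^sub>R u) (\<lambda>_. v) x = r *\<^sub>R N (\<lambda>_. u) (\<lambda>_. v) x"
        using N_scale[of "\<lambda>_. r" "\<lambda>_. u" "\<lambda>_. v" x] x by (simp add: c)
    qed
    show "smooth_on D (\<lambda>x. \<Gamma> x u v)" for u v
      unfolding \<Gamma>_def by (rule N_smooth[OF c c])
    show "\<Gamma> x u v = \<Gamma> x v u" if "x \<in> D" for x u v
      using torsion[OF c c that, of u v] by (simp add: \<Gamma>_def lie_bracket_def)
    show "frechet_derivative (\<lambda>y. g y v w) (at x) u = g x (\<Gamma> x u v) w + g x v (\<Gamma> x u w)"
      if "x \<in> D" for x u v w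
      using metric[OF c c c that, of u v w] by (simp add: \<Gamma>_def dir_deriv_def)
  qed (use D bil smooth sym nondeg in auto)
  interpret christoffel_chart D g \<Gamma> by (rule chart)
  fix X Y :: "'n vec_field" and x assume X: "smooth_on D X" and Y: "smooth_on D Y" and x: "x \<in> D"
  note comp = smooth_on_bounded_linear[OF D bounded_linear_inner_left]
  have zero: "N (\<lambda>_. 0) Y x = 0" if "smooth_on D Y" for Y
    using N_scale[of "\<lambda>_. 0" "\<lambda>_. 0" Y x] that x by (simp add: c)
  have zero': "N X (\<lambda>_. 0) x = 0" if "smooth_on D X" for X
    using N_scale'[of "\<lambda>_. 0" X "\<lambda>_. 0" x] that x by (simp add: c)
  \<comment> \<open>The axioms give additivity for two fields, so the basis expansion is built up by
    induction over finite sets of basis vectors; the zero field is the base case.\<close>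
  have N1: "N (\<lambda>y. \<Sum>b\<in>I. (X y \<bullet> b) *\<^sub>R b) Y x = (\<Sum>b\<in>I. (X x \<bullet> b) *\<^sub>R N (\<lambda>_. b) Y x)"
    if "finite I" for I
    using that
  proof (induction I)
    case (insert b I)
    have "N (\<lambda>y. (X y \<bullet> b) *\<^sub>R b + (\<Sum>b\<in>I. (X y \<bullet> b) *\<^sub>R b)) Y x =
        N (\<lambda>y. (X y \<bullet> b) *\<^sub>R b) Y x + N (\<lambda>y. \<Sum>b\<in>I. (X y \<bullet> b) *\<^sub>R b) Y x"
      by (intro N_add smooth_on_scaleR smooth_on_sum D comp X Y x c)
    moreover have "N (\<lambda>y. (X y \<bullet> b) *\<^sub>R b) Y x = (X x \<bullet> b) *\<^sub>R N (\<lambda>_. b) Y x"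
      by (rule N_scale[OF comp[OF X] c Y x])
    ultimately show ?case using insert by simp
  qed (simp add: zero Y)
  have N2: "N (\<lambda>_. u) (\<lambda>y. \<Sum>b\<in>I. (Y y \<bullet> b) *\<^sub>R b) x =
      (\<Sum>b\<in>I. (dir_deriv (\<lambda>_. u) Y x \<bullet> b) *\<^sub>R b + (Y x \<bullet> b) *\<^sub>R \<Gamma> x u b)"
    if "finite I" for I u
    using that
  proof (induction I)
    case (insert b I)
    have "N (\<lambda>_. u) (\<lambda>y. (Y y \<bullet> b) *\<^sub>R b + (\<Sum>b\<in>I. (Y y \<bullet> b) *\<^sub>R b)) x =
        N (\<lambda>_. u) (\<lambda>y. (Y y \<bullet> b) *\<^sub>R b) x + N (\<lambda>_. u) (\<lambda>y. \<Sum>b\<in>I. (Y y \<bullet> b) *\<^sub>R b) x"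
      by (intro N_add' smooth_on_scaleR smooth_on_sum D comp Y x c)
    moreover have "N (\<lambda>_. u) (\<lambda>y. (Y y \<bullet> b) *\<^sub>R b) x =
        (dir_deriv (\<lambda>_. u) Y x \<bullet> b) *\<^sub>R b + (Y x \<bullet> b) *\<^sub>R \<Gamma> x u b"
      using N_scale'[OF comp[OF Y, of b] c[of D u] c[of D b] x]
        dir_deriv_bounded_linear[OF bounded_linear_inner_left Y x, of "\<lambda>_. u" b]
      by (simp add: \<Gamma>_def)
    ultimately show ?case using insert by simp
  qed (simp add: zero' c)
  have "N (\<lambda>_. u) Y x = dir_deriv (\<lambda>_. u) Y x + \<Gamma> x u (Y x)" for u
    using N2[OF finite_Basis, of u] linear_euclidean_sum[OF bilinearD(1)[OF bil_\<Gamma>[OF x]], of u "Y x"]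
    by (simp add: euclidean_representation sum.distrib)
  then have Nc: "N (\<lambda>_. u) Y x = cov (\<lambda>_. u) Y x" for u by (simp add: cov_def)
  have "N X Y x = (\<Sum>b\<in>Basis. (X x \<bullet> b) *\<^sub>R cov (\<lambda>_. b) Y x)"
    using N1[OF finite_Basis] by (simp add: euclidean_representation Nc)
  also have "\<dots> = cov (\<lambda>_. X x) Y x"
    using linear_euclidean_sum[OF linear_dir[OF Y x], of "X x"] by simp
  finally show "N X Y x = cov X Y x" using cov_at by metis
qed

section \<open>Null frames\<close>

text \<open>Serves twice: for the endomorphism whose trace is the Ricci tensor, and for the part of
  the Ricci operator along \<open>\<xi>\<close>.\<close>

lemma trace_rank_one:
  fixes w :: "real ^ 'n"
  assumes "linear \<alpha>"
  shows "trace (matrix (\<lambda>z. \<alpha> z *\<^sub>R w)) = \<alpha> w"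
proof -
  have "\<alpha> w = (\<Sum>i\<in>UNIV. w $ i * \<alpha> (axis i 1))"
    using linear_sum[OF assms, of "\<lambda>i. w $ i *\<^sub>R axis i 1" UNIV] linear_scale[OF assms]
    by (simp add: basis_expansion scalar_mult_eq_scaleR[symmetric])
  then show ?thesis by (simp add: trace_def matrix_def mult.commute)
qed

text \<open>\<open>w1\<close>, \<open>w2\<close>, \<open>w3\<close> are the values on the frame of
  the one-form \<omega> with \<nabla>E1 = \<omega> E1, \<nabla>E2 = -\<omega> E2 and \<nabla>E3 = 0;
  vanishing torsion then prescribes exactly these brackets. As \<open>E1\<close> and
  \<open>E2\<close> are null with product one, the coefficient of a vector along one of them is its
  product with the other.\<close>

locale null_frame = christoffel_chart D g \<Gamma>
  for D :: "(real ^ 'n::finite) set" and g \<Gamma> +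
  fixes E1 E2 E3 :: "'n vec_field" and w1 w2 w3 :: "real ^ 'n \<Rightarrow> real"
  assumes smooth_E: "smooth_on D E1" "smooth_on D E2" "smooth_on D E3"
    and smooth_w: "smooth_on D w1" "smooth_on D w2" "smooth_on D w3"
    and g_E: "x \<in> D \<Longrightarrow> g x (E1 x) (E1 x) = 0" "x \<in> D \<Longrightarrow> g x (E1 x) (E2 x) = 1"
      "x \<in> D \<Longrightarrow> g x (E2 x) (E2 x) = 0" "x \<in> D \<Longrightarrow> g x (E1 x) (E3 x) = 0"
      "x \<in> D \<Longrightarrow> g x (E2 x) (E3 x) = 0" "x \<in> D \<Longrightarrow> g x (E3 x) (E3 x) = 1"
    and expand: "x \<in> D \<Longrightarrow>
      v = g x v (E2 x) *\<^sub>R E1 x + g x v (E1 x) *\<^sub>R E2 x + g x v (E3 x) *\<^sub>R E3 x"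
    and bracket: "x \<in> D \<Longrightarrow> lie_bracket E3 E1 x = w3 x *\<^sub>R E1 x"
      "x \<in> D \<Longrightarrow> lie_bracket E3 E2 x = - (w3 x *\<^sub>R E2 x)"
      "x \<in> D \<Longrightarrow> lie_bracket E1 E2 x = - (w2 x *\<^sub>R E1 x) - w1 x *\<^sub>R E2 x"
begin

lemma g_E': "x \<in> D \<Longrightarrow> g x (E2 x) (E1 x) = 1" "x \<in> D \<Longrightarrow> g x (E3 x) (E1 x) = 0"
    "x \<in> D \<Longrightarrow> g x (E3 x) (E2 x) = 0"
  using g_E sym_g by metis+

text \<open>Exchanging the null fields replaces \<omega> by -\<omega>, and its first two values
  change places. Through this symmetry each computation for \<open>E1\<close> is also one for
  \<open>E2\<close>.\<close>

lemma swap: "null_frame D g \<Gamma> E2 E1 E3 (\<lambda>x. - w2 x) (\<lambda>x. - w1 x) (\<lambda>x. - w3 x)"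
proof
  show "smooth_on D (\<lambda>x. - w2 x)" "smooth_on D (\<lambda>x. - w1 x)" "smooth_on D (\<lambda>x. - w3 x)"
    by (intro smooth_on_minus open_D smooth_w)+
  show "v = g x v (E1 x) *\<^sub>R E2 x + g x v (E2 x) *\<^sub>R E1 x + g x v (E3 x) *\<^sub>R E3 x" if "x \<in> D" for x v
    using expand[OF that, of v] by (simp add: add.commute)
  show "lie_bracket E2 E1 x = - (- w1 x *\<^sub>R E2 x) - - w2 x *\<^sub>R E1 x" if "x \<in> D" for x
    using bracket(3)[OF that] by (simp add: lie_bracket_def algebra_simps)
qed (simp_all add: smooth_E g_E g_E' bracket)

lemma eqI:
  assumes "x \<in> D" "g x u (E1 x) = g x v (E1 x)" "g x u (E2 x) = g x v (E2 x)" "g x u (E3 x) = g x v (E3 x)"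
  shows "u = v"
  using expand[OF assms(1), of u] expand[OF assms(1), of v] assms(2-4) by simp

text \<open>Scalar products of frame fields are constant, so the three derivative terms of the
  general formula are taken to be zero.\<close>

lemma Koszul:
  assumes s: "smooth_on D X" "smooth_on D Y" "smooth_on D Z"
    and "dir_deriv Z (\<lambda>y. g y (X y) (Y y)) x = 0" "dir_deriv X (\<lambda>y. g y (Y y) (Z y)) x = 0"
      "dir_deriv Y (\<lambda>y. g y (Z y) (X y)) x = 0"
    and x: "x \<in> D"
  shows "2 * g x (cov X Y x) (Z x) = g x (lie_bracket X Y x) (Z x) - g x (lie_bracket Y Z x) (X x)
    + g x (lie_bracket Z X x) (Y x)"
  using cov_metric[OF s(1,2) x, of Z] cov_metric[OF s(2,3) x, of X] cov_metric[OF s(3,1) x, of Y] assms(4-6)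
  unfolding cov_torsion[OF x, symmetric]
  by (simp add: g_simps x sym_g[OF x, of "Y x"] sym_g[OF x, of "X x"] sym_g[OF x, of "Z x"])

lemma cov_frame:
  assumes x: "x \<in> D"
  shows "cov E1 E1 x = w1 x *\<^sub>R E1 x" "cov E2 E1 x = w2 x *\<^sub>R E1 x" "cov E3 E1 x = w3 x *\<^sub>R E1 x"
    "cov E1 E2 x = - w1 x *\<^sub>R E2 x" "cov E2 E2 x = - w2 x *\<^sub>R E2 x" "cov E3 E2 x = - w3 x *\<^sub>R E2 x"
    "cov E1 E3 x = 0" "cov E2 E3 x = 0" "cov E3 E3 x = 0"
proof -
  have anti: "lie_bracket Y X x = - lie_bracket X Y x" "lie_bracket X X x = 0" for X Y :: "'n vec_field"
    by (simp_all add: lie_bracket_def)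
  note b = bracket[OF x] anti(1)[of E2 E1] anti(1)[of E1 E3] anti(1)[of E2 E3] anti(2)
  have K: "2 * g x (cov X Y x) (Z x) = g x (lie_bracket X Y x) (Z x) - g x (lie_bracket Y Z x) (X x)
      + g x (lie_bracket Z X x) (Y x)" if "X \<in> {E1, E2, E3}" "Y \<in> {E1, E2, E3}" "Z \<in> {E1, E2, E3}" for X Y Z
  proof -
    have sm: "smooth_on D X" if "X \<in> {E1, E2, E3}" for X using that smooth_E by auto
    have "dir_deriv W (\<lambda>y. g y (X y) (Y y)) x = 0" if "X \<in> {E1, E2, E3}" "Y \<in> {E1, E2, E3}" for X Y W
      using that
        dir_deriv_const_on[OF open_D x g_E(1)] dir_deriv_const_on[OF open_D x g_E(2)]
        dir_deriv_const_on[OF open_D x g_E(3)] dir_deriv_const_on[OF open_D x g_E(4)]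
        dir_deriv_const_on[OF open_D x g_E(5)] dir_deriv_const_on[OF open_D x g_E(6)]
        dir_deriv_const_on[OF open_D x g_E'(1)] dir_deriv_const_on[OF open_D x g_E'(2)]
        dir_deriv_const_on[OF open_D x g_E'(3)]
      by (elim insertE emptyE) simp_all
    note d = this[OF that(1,2)] this[OF that(2,3)] this[OF that(3,1)]
    show ?thesis by (rule Koszul[OF sm[OF that(1)] sm[OF that(2)] sm[OF that(3)] d x])
  qed
  note simps = b g_E[OF x] g_E'[OF x] g_simps[OF x]
  show "cov E1 E1 x = w1 x *\<^sub>R E1 x"
    by (rule eqI[OF x]) (use K[of E1 E1 E1] K[of E1 E1 E2] K[of E1 E1 E3] in \<open>simp_all add: simps\<close>)
  show "cov E2 E1 x = w2 x *\<^sub>R E1 x"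
    by (rule eqI[OF x]) (use K[of E2 E1 E1] K[of E2 E1 E2] K[of E2 E1 E3] in \<open>simp_all add: simps\<close>)
  show "cov E3 E1 x = w3 x *\<^sub>R E1 x"
    by (rule eqI[OF x]) (use K[of E3 E1 E1] K[of E3 E1 E2] K[of E3 E1 E3] in \<open>simp_all add: simps\<close>)
  show "cov E1 E2 x = - w1 x *\<^sub>R E2 x"
    by (rule eqI[OF x]) (use K[of E1 E2 E1] K[of E1 E2 E2] K[of E1 E2 E3] in \<open>simp_all add: simps\<close>)
  show "cov E2 E2 x = - w2 x *\<^sub>R E2 x"
    by (rule eqI[OF x]) (use K[of E2 E2 E1] K[of E2 E2 E2] K[of E2 E2 E3] in \<open>simp_all add: simps\<close>)
  show "cov E3 E2 x = - w3 x *\<^sub>R E2 x"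
    by (rule eqI[OF x]) (use K[of E3 E2 E1] K[of E3 E2 E2] K[of E3 E2 E3] in \<open>simp_all add: simps\<close>)
  show "cov E1 E3 x = 0"
    by (rule eqI[OF x]) (use K[of E1 E3 E1] K[of E1 E3 E2] K[of E1 E3 E3] in \<open>simp_all add: simps\<close>)
  show "cov E2 E3 x = 0"
    by (rule eqI[OF x]) (use K[of E2 E3 E1] K[of E2 E3 E2] K[of E2 E3 E3] in \<open>simp_all add: simps\<close>)
  show "cov E3 E3 x = 0"
    by (rule eqI[OF x]) (use K[of E3 E3 E1] K[of E3 E3 E2] K[of E3 E3 E3] in \<open>simp_all add: simps\<close>)
qed

section \<open>The curvature as a single function\<close>

abbreviation "D1 \<equiv> dir_deriv E1 :: (real ^ 'n \<Rightarrow> real) \<Rightarrow> real ^ 'n \<Rightarrow> real"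
abbreviation "D2 \<equiv> dir_deriv E2 :: (real ^ 'n \<Rightarrow> real) \<Rightarrow> real ^ 'n \<Rightarrow> real"
abbreviation "D3 \<equiv> dir_deriv E3 :: (real ^ 'n \<Rightarrow> real) \<Rightarrow> real ^ 'n \<Rightarrow> real"

text \<open>This is d\<omega>(E1, E2), without the factor 1/2; the bracket of \<open>E1\<close> and
  \<open>E2\<close> contributes \<open>w1 * w2\<close> twice.\<close>

definition \<kappa> :: "real ^ 'n \<Rightarrow> real" where
  "\<kappa> x = D1 w2 x - D2 w1 x + 2 * (w1 x * w2 x)"

lemmas smooth_D = smooth_on_dir_deriv[OF open_D smooth_E(1)] smooth_on_dir_deriv[OF open_D smooth_E(2)]
  smooth_on_dir_deriv[OF open_D smooth_E(3)]

lemma smooth_\<kappa>: "smooth_on D \<kappa>"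
  unfolding \<kappa>_def[abs_def]
  by (intro smooth_on_add smooth_on_diff smooth_D smooth_w smooth_on_mult smooth_on_const open_D)

lemma cov_frame_dir:
  assumes x: "x \<in> D"
  defines "\<omega> \<equiv> \<lambda>u. g x u (E2 x) * w1 x + g x u (E1 x) * w2 x + g x u (E3 x) * w3 x"
  shows "cov (\<lambda>_. u) E1 x = \<omega> u *\<^sub>R E1 x" "cov (\<lambda>_. u) E2 x = - \<omega> u *\<^sub>R E2 x" "cov (\<lambda>_. u) E3 x = 0"
proof -
  have "cov (\<lambda>_. u) E x = g x u (E2 x) *\<^sub>R cov E1 E x + g x u (E1 x) *\<^sub>R cov E2 E x + g x u (E3 x) *\<^sub>R cov E3 E x"
    if "smooth_on D E" for E
  proof -
    note l = linear_dir[OF that x]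
    have "cov (\<lambda>_. g x u (E2 x) *\<^sub>R E1 x + g x u (E1 x) *\<^sub>R E2 x + g x u (E3 x) *\<^sub>R E3 x) E x =
      g x u (E2 x) *\<^sub>R cov (\<lambda>_. E1 x) E x + g x u (E1 x) *\<^sub>R cov (\<lambda>_. E2 x) E x + g x u (E3 x) *\<^sub>R cov (\<lambda>_. E3 x) E x"
      by (simp only: linear_add[OF l] linear_scale[OF l])
    then show ?thesis
      using expand[OF x, of u] cov_at[of E1 E x] cov_at[of E2 E x] cov_at[of E3 E x] by metis
  qed
  note this[OF smooth_E(1)] this[OF smooth_E(2)] this[OF smooth_E(3)]
  then show "cov (\<lambda>_. u) E1 x = \<omega> u *\<^sub>R E1 x" "cov (\<lambda>_. u) E2 x = - \<omega> u *\<^sub>R E2 x" "cov (\<lambda>_. u) E3 x = 0"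
    by (simp_all add: cov_frame[OF x] \<omega>_def algebra_simps)
qed

text \<open>The products of \<open>a\<close> and \<open>b\<close> cancel in the commutator. So the
  curvature multiplies \<open>E\<close> by a scalar, namely the exterior derivative on
  \<open>X\<close> and \<open>Y\<close> of the one-form that gives the covariant derivatives of
  \<open>E\<close>.\<close>

lemma curv_eigen:
  assumes s: "smooth_on D X" "smooth_on D Y" "smooth_on D E" "smooth_on D a" "smooth_on D b"
    and X: "\<And>y. y \<in> D \<Longrightarrow> cov X E y = a y *\<^sub>R E y" and Y: "\<And>y. y \<in> D \<Longrightarrow> cov Y E y = b y *\<^sub>R E y"
    and x: "x \<in> D" and c: "cov (\<lambda>_. lie_bracket X Y x) E x = c *\<^sub>R E x"
  shows "curv x (X x) (Y x) (E x) = (dir_deriv X b x - dir_deriv Y a x - c) *\<^sub>R E x"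
proof -
  have "cov X (cov Y E) x = dir_deriv X b x *\<^sub>R E x + (b x * a x) *\<^sub>R E x"
    using cov_cong[of "cov Y E" "\<lambda>y. b y *\<^sub>R E y" x X] Y X x cov_scaleR[OF s(5,3) x, of X] by simp
  moreover have "cov Y (cov X E) x = dir_deriv Y a x *\<^sub>R E x + (a x * b x) *\<^sub>R E x"
    using cov_cong[of "cov X E" "\<lambda>y. a y *\<^sub>R E y" x Y] Y X x cov_scaleR[OF s(4,3) x, of Y] by simp
  ultimately show ?thesis
    unfolding riemann_cov[OF s(1-3) x, symmetric] riemann_def
    using c by (simp add: cov_at[of "lie_bracket X Y"] algebra_simps)
qed

lemma curv_frame12:
  assumes x: "x \<in> D"
  shows "curv x (E1 x) (E2 x) (E1 x) = \<kappa> x *\<^sub>R E1 x" "curv x (E1 x) (E2 x) (E2 x) = - \<kappa> x *\<^sub>R E2 x"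
    "curv x (E1 x) (E2 x) (E3 x) = 0"
proof -
  note simps = bracket[OF x] g_E[OF x] g_E'[OF x] g_simps[OF x] cov_frame_dir[OF x]
  show "curv x (E1 x) (E2 x) (E1 x) = \<kappa> x *\<^sub>R E1 x"
    using curv_eigen[OF smooth_E(1,2,1) smooth_w(1,2) cov_frame(1,2) x cov_frame_dir(1)[OF x]]
    by (simp add: simps \<kappa>_def algebra_simps)
  show "curv x (E1 x) (E2 x) (E2 x) = - \<kappa> x *\<^sub>R E2 x"
    using curv_eigen[OF smooth_E(1,2,2) smooth_on_minus[OF open_D smooth_w(1)]
        smooth_on_minus[OF open_D smooth_w(2)] cov_frame(4,5) x cov_frame_dir(2)[OF x]]
    by (simp add: simps \<kappa>_def dir_deriv_minus[OF smooth_w(1) x] dir_deriv_minus[OF smooth_w(2) x] algebra_simps)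
  show "curv x (E1 x) (E2 x) (E3 x) = 0"
    using curv_eigen[OF smooth_E(1,2,3) smooth_on_const[of D 0] smooth_on_const[of D 0] _ _ x, of 0]
    by (simp add: simps cov_frame)
qed

text \<open>\<open>k1\<close> and \<open>k2\<close> are d\<omega>(E3, E1) and d\<omega>(E3, E2); the
  Bianchi identity will show that they vanish.\<close>

lemma curv_frame3:
  assumes x: "x \<in> D"
  defines "k1 \<equiv> D3 w1 x - D1 w3 x - w3 x * w1 x" and "k2 \<equiv> D3 w2 x - D2 w3 x + w3 x * w2 x"
  shows "curv x (E3 x) (E1 x) (E1 x) = k1 *\<^sub>R E1 x" "curv x (E3 x) (E1 x) (E2 x) = - k1 *\<^sub>R E2 x"
    "curv x (E3 x) (E2 x) (E1 x) = k2 *\<^sub>R E1 x" "curv x (E3 x) (E2 x) (E2 x) = - k2 *\<^sub>R E2 x"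
    "curv x (E3 x) (E1 x) (E3 x) = 0" "curv x (E3 x) (E2 x) (E3 x) = 0"
proof -
  note simps = bracket[OF x] g_E[OF x] g_E'[OF x] g_simps[OF x] cov_frame_dir[OF x]
    dir_deriv_minus[OF smooth_w(1) x] dir_deriv_minus[OF smooth_w(2) x] dir_deriv_minus[OF smooth_w(3) x]
  note m = smooth_on_minus[OF open_D smooth_w(1)] smooth_on_minus[OF open_D smooth_w(2)]
    smooth_on_minus[OF open_D smooth_w(3)]
  show "curv x (E3 x) (E1 x) (E1 x) = k1 *\<^sub>R E1 x"
    using curv_eigen[OF smooth_E(3,1,1) smooth_w(3,1) cov_frame(3,1) x cov_frame_dir(1)[OF x]]
    by (simp add: simps k1_def algebra_simps)
  show "curv x (E3 x) (E1 x) (E2 x) = - k1 *\<^sub>R E2 x"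
    using curv_eigen[OF smooth_E(3,1,2) m(3,1) cov_frame(6,4) x cov_frame_dir(2)[OF x]]
    by (simp add: simps k1_def algebra_simps)
  show "curv x (E3 x) (E2 x) (E1 x) = k2 *\<^sub>R E1 x"
    using curv_eigen[OF smooth_E(3,2,1) smooth_w(3,2) cov_frame(3,2) x cov_frame_dir(1)[OF x]]
    by (simp add: simps k2_def algebra_simps)
  show "curv x (E3 x) (E2 x) (E2 x) = - k2 *\<^sub>R E2 x"
    using curv_eigen[OF smooth_E(3,2,2) m(3,2) cov_frame(6,5) x cov_frame_dir(2)[OF x]]
    by (simp add: simps k2_def algebra_simps)
  show "curv x (E3 x) (E1 x) (E3 x) = 0"
    using curv_eigen[OF smooth_E(3,1,3) smooth_on_const[of D 0] smooth_on_const[of D 0] _ _ x, of 0]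
    by (simp add: simps cov_frame)
  show "curv x (E3 x) (E2 x) (E3 x) = 0"
    using curv_eigen[OF smooth_E(3,2,3) smooth_on_const[of D 0] smooth_on_const[of D 0] _ _ x, of 0]
    by (simp add: simps cov_frame)
qed

text \<open>Equivalently, d\<omega> vanishes on pairs containing \<open>E3\<close>. In the first
  Bianchi identity for the three frame fields the term with the curvature of \<open>E3\<close> is
  zero, and the other two are multiples of the independent vectors \<open>E2 x\<close> and
  \<open>E1 x\<close>.\<close>

lemma D3_w:
  assumes x: "x \<in> D"
  shows "D3 w1 x = D1 w3 x + w3 x * w1 x" "D3 w2 x = D2 w3 x - w3 x * w2 x"
proof -
  define k1 where "k1 = D3 w1 x - D1 w3 x - w3 x * w1 x"
  define k2 where "k2 = D3 w2 x - D2 w3 x + w3 x * w2 x"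
  have *: "k1 *\<^sub>R E2 x + k2 *\<^sub>R E1 x = 0"
    using curv_Bianchi[OF x, of "E3 x" "E1 x" "E2 x"] curv_antisym[of x "E2 x" "E3 x" "E1 x"]
      curv_frame3[OF x] curv_frame12[OF x]
    unfolding k1_def[symmetric] k2_def[symmetric]
    by (simp add: algebra_simps) (metis add.commute neg_eq_iff_add_eq_0)
  have "g x (k1 *\<^sub>R E2 x + k2 *\<^sub>R E1 x) (E1 x) = 0" "g x (k1 *\<^sub>R E2 x + k2 *\<^sub>R E1 x) (E2 x) = 0"
    unfolding * by (simp_all add: g_simps[OF x])
  then show "D3 w1 x = D1 w3 x + w3 x * w1 x" "D3 w2 x = D2 w3 x - w3 x * w2 x"
    by (simp_all add: g_simps[OF x] g_E[OF x] g_E'[OF x] k1_def k2_def)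
qed

text \<open>Trilinear expansion in the frame, where \<open>E1\<close>, \<open>E2\<close> is the only
  pair of directions that can contribute.\<close>

lemma curv_formula:
  assumes x: "x \<in> D"
  shows "curv x u v w = (\<kappa> x * (g x u (E2 x) * g x v (E1 x) - g x u (E1 x) * g x v (E2 x))) *\<^sub>R
    (g x w (E2 x) *\<^sub>R E1 x - g x w (E1 x) *\<^sub>R E2 x)"
proof -
  have lin: "h u = g x u (E2 x) *\<^sub>R h (E1 x) + g x u (E1 x) *\<^sub>R h (E2 x) + g x u (E3 x) *\<^sub>R h (E3 x)"
    if "linear h" for h :: "real ^ 'n \<Rightarrow> real ^ 'n" and u
    by (subst (1) expand[OF x, of u]) (simp add: linear_add[OF that] linear_scale[OF that])
  note l = linear_curv[OF x]
  have zero: "curv x a a b = 0" for a b by (simp add: curv_def)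
  have e: "curv x a b w = g x w (E2 x) *\<^sub>R curv x a b (E1 x) + g x w (E1 x) *\<^sub>R curv x a b (E2 x)
      + g x w (E3 x) *\<^sub>R curv x a b (E3 x)" for a b by (rule lin[OF l(3)])
  have c12: "curv x (E1 x) (E2 x) w = \<kappa> x *\<^sub>R (g x w (E2 x) *\<^sub>R E1 x - g x w (E1 x) *\<^sub>R E2 x)"
    unfolding e[of "E1 x"] curv_frame12[OF x] by (simp add: algebra_simps)
  have c31: "curv x (E3 x) (E1 x) w = 0" and c32: "curv x (E3 x) (E2 x) w = 0"
    unfolding e[of "E3 x"] using curv_frame3[OF x] by (simp_all add: D3_w[OF x])
  have c21: "curv x (E2 x) (E1 x) w = - curv x (E1 x) (E2 x) w"
    "curv x (E1 x) (E3 x) w = - curv x (E3 x) (E1 x) w" "curv x (E2 x) (E3 x) w = - curv x (E3 x) (E2 x) w"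
    by (rule curv_antisym)+
  have f: "curv x u v w = g x u (E2 x) *\<^sub>R curv x (E1 x) v w + g x u (E1 x) *\<^sub>R curv x (E2 x) v w
      + g x u (E3 x) *\<^sub>R curv x (E3 x) v w" by (rule lin[OF l(1)])
  have h: "curv x a v w = g x v (E2 x) *\<^sub>R curv x a (E1 x) w + g x v (E1 x) *\<^sub>R curv x a (E2 x) w
      + g x v (E3 x) *\<^sub>R curv x a (E3 x) w" for a by (rule lin[OF l(2)])
  show ?thesis
    unfolding f h[of "E1 x"] h[of "E2 x"] h[of "E3 x"]
    by (simp add: c21 c31 c32 zero) (simp add: c12 algebra_simps)
qed

text \<open>As a function of \<open>z\<close> the curvature is a scalar times the fixed vector
  \<open>W\<close>, so its trace is that scalar evaluated at \<open>W\<close>.\<close>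

lemma trace_curv:
  assumes x: "x \<in> D"
  shows "trace (matrix (\<lambda>z. curv x z u v)) = \<kappa> x * (g x u v - g x u (E3 x) * g x v (E3 x))"
proof -
  define W where "W = g x v (E2 x) *\<^sub>R E1 x - g x v (E1 x) *\<^sub>R E2 x"
  have lin: "linear (\<lambda>z. \<kappa> x * (g x z (E2 x) * g x u (E1 x) - g x z (E1 x) * g x u (E2 x)))"
    by (rule linearI) (simp_all add: g_simps[OF x] algebra_simps)
  \<comment> \<open>The metric in the frame; without its product along \<open>E3\<close> it is the
    symmetric expression that the trace produces.\<close>
  have "g x u v = g x u (g x v (E2 x) *\<^sub>R E1 x + g x v (E1 x) *\<^sub>R E2 x + g x v (E3 x) *\<^sub>R E3 x)"
    using expand[OF x, of v] by simp
  then have guv: "g x u v = g x v (E2 x) * g x u (E1 x) + g x v (E1 x) * g x u (E2 x) + g x v (E3 x) * g x u (E3 x)"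
    by (simp add: g_simps[OF x])
  show ?thesis
    unfolding curv_formula[OF x] W_def[symmetric] trace_rank_one[OF lin]
    unfolding guv W_def
    by (simp add: g_simps[OF x] g_E[OF x] g_E'[OF x] algebra_simps)
qed

end

section \<open>Derivatives of functions along the frame\<close>

context null_frame
begin

text \<open>The brackets read as operator identities, the means of moving \<open>D3\<close> past
  \<open>D1\<close> and \<open>D2\<close> in all that follows.\<close>

lemma commutator:
  fixes f :: "real ^ 'n \<Rightarrow> real"
  assumes f: "smooth_on D f" and x: "x \<in> D"
  shows "D1 (D2 f) x = D2 (D1 f) x - w2 x * D1 f x - w1 x * D2 f x"
    "D3 (D1 f) x = D1 (D3 f) x + w3 x * D1 f x"
    "D3 (D2 f) x = D2 (D3 f) x - w3 x * D2 f x"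
proof -
  note l = linear_frechet_derivative[OF smooth_on_differentiable[OF f x]]
  note s = linear_diff[OF l] linear_neg[OF l] linear_scale[OF l] linear_add[OF l]
  show "D1 (D2 f) x = D2 (D1 f) x - w2 x * D1 f x - w1 x * D2 f x"
    using dir_deriv_lie_bracket[OF open_D smooth_E(1,2) f x]
    unfolding dir_deriv_def[of "lie_bracket E1 E2"] bracket[OF x] by (simp add: s) (simp add: dir_deriv_def)
  show "D3 (D1 f) x = D1 (D3 f) x + w3 x * D1 f x"
    using dir_deriv_lie_bracket[OF open_D smooth_E(3,1) f x]
    unfolding dir_deriv_def[of "lie_bracket E3 E1"] bracket[OF x] by (simp add: s) (simp add: dir_deriv_def)
  show "D3 (D2 f) x = D2 (D3 f) x - w3 x * D2 f x"
    using dir_deriv_lie_bracket[OF open_D smooth_E(3,2) f x]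
    unfolding dir_deriv_def[of "lie_bracket E3 E2"] bracket[OF x] by (simp add: s) (simp add: dir_deriv_def)
qed

lemmas d_mult = dir_deriv_mult[where D = D] and d_add = dir_deriv_add[where D = D]
  and d_diff = dir_deriv_diff[OF open_D] and d_minus = dir_deriv_minus[where D = D]
  and s_mult = smooth_on_mult[OF open_D] and s_add = smooth_on_add[OF open_D]
  and s_diff = smooth_on_diff[OF open_D] and s_minus = smooth_on_minus[OF open_D]
  and d_cong = dir_deriv_cong[OF open_D]

text \<open>This is d(d\<omega>) = 0 on the three frame fields: as d\<omega> vanishes on pairs
  containing \<open>E3\<close>, only the derivative of \<open>\<kappa>\<close> and two bracket terms
  of opposite sign remain. The computation carries this out with commutators.\<close>

lemma D3_\<kappa>:
  assumes x: "x \<in> D"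
  shows "D3 \<kappa> x = 0"
proof -
  note simps = d_mult d_add d_diff d_minus s_mult s_add s_diff s_minus smooth_on_const smooth_D smooth_w x
  have "D1 (D3 w2) x = D1 (\<lambda>y. D2 w3 y - w3 y * w2 y) x"
    by (rule d_cong[OF x]) (rule D3_w)
  then have a: "D3 (D1 w2) x = D1 (D2 w3) x - w2 x * D1 w3 x"
    using commutator(2)[OF smooth_w(2) x] by (simp add: simps)
  have "D2 (D3 w1) x = D2 (\<lambda>y. D1 w3 y + w3 y * w1 y) x"
    by (rule d_cong[OF x]) (rule D3_w)
  then have b: "D3 (D2 w1) x = D2 (D1 w3) x + w1 x * D2 w3 x"
    using commutator(3)[OF smooth_w(1) x] by (simp add: simps)
  have "D3 \<kappa> x = D3 (D1 w2) x - D3 (D2 w1) x + 2 * (w1 x * D3 w2 x + D3 w1 x * w2 x)"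
    unfolding \<kappa>_def[abs_def] by (simp add: simps)
  then show ?thesis
    unfolding a b D3_w[OF x] using commutator(1)[OF smooth_w(3) x] by (simp add: algebra_simps)
qed

end

text \<open>The left side of \<open>conformal\<close> is the Lie derivative of the metric in terms
  of the connection. \<open>\<sigma>\<close> is kept independent of \<open>\<kappa>\<close>: besides
  the conformal equation only its invariance along \<open>E3\<close> is recorded.\<close>

locale yamabe_frame = null_frame D g \<Gamma> E1 E2 E3 w1 w2 w3
  for D :: "(real ^ 'n::finite) set" and g \<Gamma> E1 E2 E3 w1 w2 w3 +
  fixes V :: "'n vec_field" and \<sigma> :: "real ^ 'n \<Rightarrow> real"
  assumes smooth_V: "smooth_on D V" and smooth_\<sigma>: "smooth_on D \<sigma>"
    and conformal: "x \<in> D \<Longrightarrow> g x (cov (\<lambda>_. u) V x) v + g x u (cov (\<lambda>_. v) V x) = 2 * \<sigma> x * g x u v"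
    and D3_\<sigma>: "x \<in> D \<Longrightarrow> D3 \<sigma> x = 0"
begin

text \<open>Supplies, from the computations for \<open>E1\<close>, the mixed Hessian component with
  the null fields in reverse order and the statement about the derivative along
  \<open>E2\<close>.\<close>

lemma swap_yamabe: "yamabe_frame D g \<Gamma> E2 E1 E3 (\<lambda>x. - w2 x) (\<lambda>x. - w1 x) (\<lambda>x. - w3 x) V \<sigma>"
proof -
  interpret s: null_frame D g \<Gamma> E2 E1 E3 "\<lambda>x. - w2 x" "\<lambda>x. - w1 x" "\<lambda>x. - w3 x"
    by (rule swap)
  show ?thesis by unfold_locales (fact smooth_V smooth_\<sigma> conformal D3_\<sigma>)+
qed

text \<open>Components of \<open>V\<close> in the frame; the indices are crossed because each null
  field is dual to the other.\<close>

definition "V1 x = g x (V x) (E2 x)"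
definition "V2 x = g x (V x) (E1 x)"
definition "V3 x = g x (V x) (E3 x)"

lemma smooth_components: "smooth_on D V1" "smooth_on D V2" "smooth_on D V3"
  unfolding V1_def[abs_def] V2_def[abs_def] V3_def[abs_def]
  by (rule smooth_metric smooth_V smooth_E)+

text \<open>The conformal equation on the pairs (E1, E1), (E2, E2), (E1, E2), (E1, E3), (E2, E3) and
  (E3, E3), in this order. The last one makes \<open>\<sigma>\<close> a derivative of
  \<open>V3\<close>.\<close>

lemma conformal_frame:
  assumes x: "x \<in> D"
  shows "D1 V2 x = w1 x * V2 x" "D2 V1 x = - w2 x * V1 x"
    "D1 V1 x + w1 x * V1 x + D2 V2 x - w2 x * V2 x = 2 * \<sigma> x"
    "D3 V2 x = w3 x * V2 x - D1 V3 x" "D3 V1 x = - w3 x * V1 x - D2 V3 x" "D3 V3 x = \<sigma> x"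
proof -
  have c: "dir_deriv X (\<lambda>y. g y (V y) (E y)) x = g x (cov (\<lambda>_. X x) V x) (E x) + g x (V x) (cov X E x)"
    if "smooth_on D E" for X E
    using cov_metric[OF smooth_V that x, of X] cov_at[of X V x] by simp
  note sy = sym_g[OF x, of "E1 x" "cov X Y x" for X Y] sym_g[OF x, of "E2 x" "cov X Y x" for X Y]
    sym_g[OF x, of "E3 x" "cov X Y x" for X Y]
  note K = conformal[OF x, unfolded sy]
  note simps = V1_def[abs_def] V2_def[abs_def] V3_def[abs_def] c smooth_E cov_frame[OF x] g_simps[OF x]
    g_E[OF x] g_E'[OF x]
  show "D1 V2 x = w1 x * V2 x" using K[of "E1 x" "E1 x"] by (simp add: simps sy)
  show "D2 V1 x = - w2 x * V1 x" using K[of "E2 x" "E2 x"] by (simp add: simps sy)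
  show "D3 V3 x = \<sigma> x" using K[of "E3 x" "E3 x"] by (simp add: simps sy)
  show "D1 V1 x + w1 x * V1 x + D2 V2 x - w2 x * V2 x = 2 * \<sigma> x"
    using K[of "E1 x" "E2 x"] by (simp add: simps sy)
  show "D3 V2 x = w3 x * V2 x - D1 V3 x" using K[of "E1 x" "E3 x"] by (simp add: simps sy)
  show "D3 V1 x = - w3 x * V1 x - D2 V3 x" using K[of "E2 x" "E3 x"] by (simp add: simps sy)
qed

section \<open>Hessians of the \<open>\<xi>\<close>-component of the field and of the conformal
  factor\<close>

lemmas smooths = d_mult d_add d_diff d_minus s_mult s_add s_diff s_minus smooth_on_const smooth_D smooth_w
  smooth_components smooth_\<sigma> smooth_\<kappa>

text \<open>The (E1, E1) component of the Hessian of \<open>V3\<close> is zero: differentiate the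
  (E1, E1) equation along \<open>E3\<close>, insert the (E1, E3) equation, and all terms with
  \<open>V2\<close> cancel.\<close>

lemma D1_D1_V3:
  assumes x: "x \<in> D"
  shows "D1 (D1 V3) x = w1 x * D1 V3 x"
proof -
  have "D3 (D1 V2) x = D3 (\<lambda>y. w1 y * V2 y) x" by (rule d_cong[OF x]) (rule conformal_frame)
  moreover have "D1 (D3 V2) x = D1 (\<lambda>y. w3 y * V2 y - D1 V3 y) x" by (rule d_cong[OF x]) (rule conformal_frame)
  ultimately show ?thesis
    using commutator(2)[OF smooth_components(2) x] by (simp add: smooths x conformal_frame D3_w algebra_simps)
qed

lemma D1_D3_V3: "x \<in> D \<Longrightarrow> D1 (D3 V3) x = D1 \<sigma> x"
  by (rule d_cong) (auto simp: conformal_frame)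

lemma D2_D3_V3: "x \<in> D \<Longrightarrow> D2 (D3 V3) x = D2 \<sigma> x"
  by (rule d_cong) (auto simp: conformal_frame)

text \<open>Since \<open>D3 V3\<close> is \<open>\<sigma>\<close>, differentiating the Hessian
  equation of \<open>V3\<close> along \<open>E3\<close> turns it into the same equation for
  \<open>\<sigma>\<close>.\<close>

lemma D1_D1_\<sigma>:
  assumes x: "x \<in> D"
  shows "D1 (D1 \<sigma>) x = w1 x * D1 \<sigma> x"
proof -
  have "D3 (D1 (D1 V3)) x = D3 (\<lambda>y. w1 y * D1 V3 y) x" by (rule d_cong[OF x]) (rule D1_D1_V3)
  moreover have "D1 (D3 (D1 V3)) x = D1 (\<lambda>y. D1 \<sigma> y + w3 y * D1 V3 y) x"
    by (rule d_cong[OF x]) (simp add: commutator smooth_components D1_D3_V3)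
  ultimately show ?thesis
    using commutator(2)[OF smooth_D(1)[OF smooth_components(3)] x] commutator(2)[OF smooth_components(3) x]
    by (simp add: smooths x D1_D3_V3 D1_D1_V3 D3_w algebra_simps)
qed

text \<open>The mixed Hessian component, from the (E1, E2) equation differentiated along
  \<open>E3\<close>. The right side becomes \<open>2 * D3 \<sigma>\<close>, which is zero by the
  invariance of \<open>\<sigma>\<close>.\<close>

lemma D1_D2_V3:
  assumes x: "x \<in> D"
  shows "D1 (D2 V3) x = - w1 x * D2 V3 x"
proof -
  have "D3 (\<lambda>y. D1 V1 y + w1 y * V1 y + D2 V2 y - w2 y * V2 y) x = D3 (\<lambda>y. 2 * \<sigma> y) x"
    by (rule d_cong[OF x]) (rule conformal_frame)
  moreover have "D1 (D3 V1) x = D1 (\<lambda>y. - w3 y * V1 y - D2 V3 y) x" by (rule d_cong[OF x]) (rule conformal_frame)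
  moreover have "D2 (D3 V2) x = D2 (\<lambda>y. w3 y * V2 y - D1 V3 y) x" by (rule d_cong[OF x]) (rule conformal_frame)
  ultimately show ?thesis
    using commutator(2)[OF smooth_components(1) x] commutator(3)[OF smooth_components(2) x] commutator(1)[OF smooth_components(3) x]
    by (simp add: smooths x conformal_frame(4-6) D3_w D3_\<sigma> algebra_simps)
qed

lemma D1_D2_\<sigma>:
  assumes x: "x \<in> D"
  shows "D1 (D2 \<sigma>) x = - w1 x * D2 \<sigma> x"
proof -
  have "D3 (D1 (D2 V3)) x = D3 (\<lambda>y. - w1 y * D2 V3 y) x" by (rule d_cong[OF x]) (rule D1_D2_V3)
  moreover have "D1 (D3 (D2 V3)) x = D1 (\<lambda>y. D2 \<sigma> y - w3 y * D2 V3 y) x"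
    by (rule d_cong[OF x]) (simp add: commutator(3) smooth_components D2_D3_V3)
  ultimately show ?thesis
    using commutator(2)[OF smooth_D(2)[OF smooth_components(3)] x] commutator(3)[OF smooth_components(3) x]
    by (simp add: smooths x D2_D3_V3 D1_D2_V3 D3_w algebra_simps)
qed

text \<open>The Hessian of \<open>\<sigma>\<close> vanishes, so the Ricci identity for \<open>d\<sigma>\<close> leaves only the curvature
  term.\<close>

lemma \<kappa>_D1_\<sigma>:
  assumes x: "x \<in> D"
  shows "\<kappa> x * D1 \<sigma> x = 0"
proof -
  interpret sw: yamabe_frame D g \<Gamma> E2 E1 E3 "\<lambda>x. - w2 x" "\<lambda>x. - w1 x" "\<lambda>x. - w3 x" V \<sigma>
    by (rule swap_yamabe)
  have D2D1: "D2 (D1 \<sigma>) y = w2 y * D1 \<sigma> y" if "y \<in> D" for y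
    using sw.D1_D2_\<sigma>[OF that] by simp
  have "D1 (D2 (D1 \<sigma>)) x = D1 (\<lambda>y. w2 y * D1 \<sigma> y) x" by (rule d_cong[OF x]) (rule D2D1)
  moreover have "D2 (D1 (D1 \<sigma>)) x = D2 (\<lambda>y. w1 y * D1 \<sigma> y) x" by (rule d_cong[OF x]) (rule D1_D1_\<sigma>)
  ultimately show ?thesis
    using commutator(1)[OF smooth_D(1)[OF smooth_\<sigma>] x]
    by (simp add: smooths x D1_D1_\<sigma> D2D1 \<kappa>_def algebra_simps)
qed

text \<open>Exchanging the null fields changes the sign of \<omega> and the order of the arguments
  in d\<omega>(E1, E2), so \<open>\<kappa>\<close> is invariant and the result for \<open>E1\<close>
  carries over.\<close>

lemma \<kappa>_D2_\<sigma>: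
  assumes x: "x \<in> D"
  shows "\<kappa> x * D2 \<sigma> x = 0"
proof -
  interpret sw: yamabe_frame D g \<Gamma> E2 E1 E3 "\<lambda>x. - w2 x" "\<lambda>x. - w1 x" "\<lambda>x. - w3 x" V \<sigma>
    by (rule swap_yamabe)
  have "sw.\<kappa> x = \<kappa> x"
    by (simp add: sw.\<kappa>_def \<kappa>_def d_minus[OF _ x] smooth_w)
  then show ?thesis using sw.\<kappa>_D1_\<sigma>[OF x] by simp
qed

lemma \<kappa>_d\<sigma>:
  assumes x: "x \<in> D"
  shows "\<kappa> x * frechet_derivative \<sigma> (at x) v = 0"
proof -
  note l = linear_frechet_derivative[OF smooth_on_differentiable[OF smooth_\<sigma> x]]
  have "frechet_derivative \<sigma> (at x) v =
      g x v (E2 x) * D1 \<sigma> x + g x v (E1 x) * D2 \<sigma> x + g x v (E3 x) * D3 \<sigma> x"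
    by (subst (1) expand[OF x, of v]) (simp add: linear_add[OF l] linear_scale[OF l] dir_deriv_def)
  then show ?thesis
    using \<kappa>_D1_\<sigma>[OF x] \<kappa>_D2_\<sigma>[OF x] D3_\<sigma>[OF x] by (auto simp: algebra_simps)
qed

end

section \<open>Paracosymplectic structures in a chart\<close>

lemma trace_matrix_add:
  "trace (matrix (\<lambda>x. f x + h x)) = trace (matrix f) + trace (matrix h :: real ^ 'n ^ 'n)"
  by (simp add: trace_def matrix_def sum.distrib)

text \<open>Nondegeneracy gives the uniqueness that the definite description demands.\<close>

lemma ricci_operator_eqI:
  assumes bil: "bilinear (g x)" and nondeg: "\<And>u. (\<And>v. g x u v = 0) \<Longrightarrow> u = 0"
    and w: "\<And>v. ricci N x u v = g x w v"
  shows "ricci_operator g N x u = w"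
  unfolding ricci_operator_def
proof (rule the_equality)
  fix z assume z: "\<forall>v. ricci N x u v = g x z v"
  have "z - w = 0"
    by (rule nondeg) (use z w in \<open>simp add: bilinear_lsub[OF bil]\<close>)
  then show "z = w" by simp
qed (use w in blast)

text \<open>The factor two is 3 - 1: the identity of a three-dimensional space has trace three, and
  the rank-one part has trace \<open>\<eta> \<xi> = 1\<close>.\<close>

lemma scalar_curvature_eqI:
  fixes g :: "3 bil_field"
  assumes bil: "bilinear (g x)" and nondeg: "\<And>u. (\<And>v. g x u v = 0) \<Longrightarrow> u = 0"
    and \<eta>: "linear \<eta>" "\<eta> \<xi> = 1" "\<And>v. g x \<xi> v = \<eta> v"
    and ricci: "\<And>u v. ricci N x u v = k * (g x u v - \<eta> u * \<eta> v)"
  shows "ricci_operator g N x u = k *\<^sub>R (u - \<eta> u *\<^sub>R \<xi>)"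
    and "scalar_curvature g N x = 2 * k"
proof -
  show Q: "ricci_operator g N x u = k *\<^sub>R (u - \<eta> u *\<^sub>R \<xi>)" for u
    by (rule ricci_operator_eqI[where g = g and x = x, OF bil nondeg])
      (simp_all add: ricci \<eta> bilinear_lsub[OF bil] bilinear_lmul[OF bil])
  have l: "linear (\<lambda>u. - k * \<eta> u)"
    using \<eta>(1) by (auto intro!: linearI simp: linear_add linear_scale algebra_simps)
  have "ricci_operator g N x = (\<lambda>u. k *\<^sub>R u + (- k * \<eta> u) *\<^sub>R \<xi>)"
    by (rule ext) (simp add: Q algebra_simps)
  moreover have "trace (matrix (\<lambda>u::real^3. k *\<^sub>R u)) = 3 * k"
    by (simp add: trace_def matrix_def axis_def)
  ultimately show "scalar_curvature g N x = 2 * k"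
    unfolding scalar_curvature_def by (simp only: trace_matrix_add trace_rank_one[OF l] \<eta>)
qed

text \<open>\<open>k * k\<close> has zero derivative, so it is constant on a ball. If
  \<open>k x\<close> is zero, then \<open>k\<close> vanishes on the ball; otherwise \<open>k\<close>
  has no zero there and its own derivative must vanish.\<close>

lemma locally_constant_of_mult_derivative:
  fixes k :: "'e::euclidean_space \<Rightarrow> real"
  assumes D: "open D" and k: "smooth_on D k" and x: "x \<in> D"
    and z: "\<And>y v. y \<in> D \<Longrightarrow> k y * frechet_derivative k (at y) v = 0"
  shows "\<exists>W. open W \<and> x \<in> W \<and> W \<subseteq> D \<and> (\<forall>y\<in>W. k y = k x)"
proof -
  obtain e where e: "e > 0" "ball x e \<subseteq> D" using D x open_contains_ball by blast
  have dk: "(k has_derivative frechet_derivative k (at y)) (at y)" if "y \<in> ball x e" for y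
    by (rule has_frechet_derivative[OF smooth_on_differentiable[OF k]]) (use e that in blast)
  have dk2: "((\<lambda>y. k y * k y) has_derivative (\<lambda>v. 0)) (at y)" if y: "y \<in> ball x e" for y
  proof -
    have "((\<lambda>y. k y * k y) has_derivative
        (\<lambda>v. k y * frechet_derivative k (at y) v + frechet_derivative k (at y) v * k y)) (at y)"
      by (rule has_derivative_mult[OF dk[OF y] dk[OF y]])
    moreover have "k y * frechet_derivative k (at y) v + frechet_derivative k (at y) v * k y = 0" for v
      using z[of y v] y e by (auto simp: mult.commute)
    ultimately show ?thesis by simp
  qed
  have sq: "k y * k y = k x * k x" if "y \<in> ball x e" for y
    by (rule has_derivative_zero_unique[of "ball x e" "\<lambda>y. k y * k y"])
      (use that e in \<open>auto intro!: has_derivative_at_withinI[OF dk2]\<close>)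
  have "k y = k x" if y: "y \<in> ball x e" for y
  proof (cases "k x = 0")
    case True
    then show ?thesis using sq[OF y] by simp
  next
    case False
    have "(k has_derivative (\<lambda>v. 0)) (at y)" if y: "y \<in> ball x e" for y
    proof -
      have "k y \<noteq> 0" using sq[OF y] False by auto
      then have "frechet_derivative k (at y) = (\<lambda>v. 0)"
        using z[of y] y e by (auto simp: fun_eq_iff)
      then show ?thesis using dk[OF y] by simp
    qed
    note d = has_derivative_at_withinI[OF this]
    show ?thesis
      by (rule has_derivative_zero_unique[of "ball x e" k]) (use y e in \<open>auto intro!: d\<close>)
  qed
  moreover have "open (ball x e)" "x \<in> ball x e" using e by simp_all
  ultimately show ?thesis using e by blast
qed

text \<open>The structure inside one chart. In dimension three both eigendistributions are lines, so
  a bracket that stays in one of them is known up to a single coefficient.\<close>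

locale paracosymplectic_chart = christoffel_chart D g \<Gamma>
  for D :: "(real ^ 3) set" and g \<Gamma> +
  fixes \<phi> :: "3 endo_field" and \<xi> :: "3 vec_field" and \<eta> :: "3 one_form"
  assumes lin_\<phi>: "x \<in> D \<Longrightarrow> linear (\<phi> x)" and smooth_\<phi>: "smooth_on D (\<lambda>x. \<phi> x v)"
    and lin_\<eta>: "x \<in> D \<Longrightarrow> linear (\<eta> x)" and smooth_\<eta>: "smooth_on D (\<lambda>x. \<eta> x v)"
    and smooth_\<xi>: "smooth_on D \<xi>"
    and \<eta>_\<xi>: "x \<in> D \<Longrightarrow> \<eta> x (\<xi> x) = 1"
    and \<phi>_\<phi>: "x \<in> D \<Longrightarrow> \<phi> x (\<phi> x v) = v - \<eta> x v *\<^sub>R \<xi> x"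
    and dim_plus: "x \<in> D \<Longrightarrow> dim {v. \<eta> x v = 0 \<and> \<phi> x v = v} = 1"
    and dim_minus: "x \<in> D \<Longrightarrow> dim {v. \<eta> x v = 0 \<and> \<phi> x v = - v} = 1"
    and g_\<phi>: "x \<in> D \<Longrightarrow> g x (\<phi> x u) (\<phi> x v) = - g x u v + \<eta> x u * \<eta> x v"
    and normal: "smooth_on D X \<Longrightarrow> smooth_on D Y \<Longrightarrow> x \<in> D \<Longrightarrow>
      nijenhuis \<phi> X Y x - (2 * ext_deriv1 \<eta> X Y x) *\<^sub>R \<xi> x = 0"
    and closed_\<eta>: "smooth_on D X \<Longrightarrow> smooth_on D Y \<Longrightarrow> x \<in> D \<Longrightarrow> ext_deriv1 \<eta> X Y x = 0"
    and closed_\<Phi>: "smooth_on D X \<Longrightarrow> smooth_on D Y \<Longrightarrow> smooth_on D Z \<Longrightarrow> x \<in> D \<Longrightarrow>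
      ext_deriv2 (fundamental_form \<phi> g) X Y Z x = 0"
begin

section \<open>Linear algebra of the structure at a point\<close>

lemmas \<eta>_simps = linear_add[OF lin_\<eta>] linear_scale[OF lin_\<eta>] linear_diff[OF lin_\<eta>] linear_neg[OF lin_\<eta>]
  linear_0[OF lin_\<eta>]
lemmas \<phi>_simps = linear_add[OF lin_\<phi>] linear_scale[OF lin_\<phi>] linear_diff[OF lin_\<phi>] linear_neg[OF lin_\<phi>]
  linear_0[OF lin_\<phi>]

text \<open>The square of \<open>\<phi>\<close> kills \<open>\<xi>\<close>; evaluated on
  \<open>\<phi> \<xi>\<close> it shows that \<open>\<phi> \<xi>\<close> is a multiple
  \<open>c\<close> of \<open>\<xi>\<close>, and one more application of \<open>\<phi>\<close> gives
  \<open>c * c = 0\<close>.\<close>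

lemma \<phi>_\<xi>: assumes x: "x \<in> D" shows "\<phi> x (\<xi> x) = 0"
proof -
  let ?c = "\<eta> x (\<phi> x (\<xi> x))"
  have 0: "\<phi> x (\<phi> x (\<xi> x)) = 0" using \<phi>_\<phi>[OF x, of "\<xi> x"] \<eta>_\<xi>[OF x] by simp
  then have 1: "\<phi> x (\<xi> x) = ?c *\<^sub>R \<xi> x"
    using \<phi>_\<phi>[OF x, of "\<phi> x (\<xi> x)"] \<phi>_simps[OF x] by simp
  have "\<phi> x (\<phi> x (\<xi> x)) = (?c * ?c) *\<^sub>R \<xi> x"
    using arg_cong[OF 1, of "\<phi> x"] 1 by (metis \<phi>_simps(2)[OF x] scaleR_scaleR)
  with 0 have "?c * ?c * \<eta> x (\<xi> x) = 0"
    using \<eta>_simps[OF x] by (metis real_scaleR_def)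
  then have "?c = 0" using \<eta>_\<xi>[OF x] by simp
  with 1 show ?thesis by simp
qed

text \<open>\<open>\<phi>\<close> commutes with its square, and the two orders of application differ
  by \<open>\<eta> (\<phi> v)\<close> times \<open>\<xi>\<close>.\<close>

lemma \<eta>_\<phi>: assumes x: "x \<in> D" shows "\<eta> x (\<phi> x v) = 0"
proof -
  have "\<phi> x v - \<eta> x (\<phi> x v) *\<^sub>R \<xi> x = \<phi> x (v - \<eta> x v *\<^sub>R \<xi> x)"
    using \<phi>_\<phi>[OF x, of "\<phi> x v"] \<phi>_\<phi>[OF x, of v] by simp
  then have "\<eta> x (\<phi> x v) *\<^sub>R \<xi> x = 0" using \<phi>_\<xi>[OF x] \<phi>_simps[OF x] by simp
  then have "\<eta> x (\<phi> x v) * \<eta> x (\<xi> x) = \<eta> x 0" using \<eta>_simps[OF x] by (metis real_scaleR_def)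
  then show ?thesis using \<eta>_\<xi>[OF x] \<eta>_simps[OF x] by simp
qed

lemma g_\<xi>: assumes x: "x \<in> D" shows "g x v (\<xi> x) = \<eta> x v" "g x (\<xi> x) v = \<eta> x v"
proof -
  show "g x v (\<xi> x) = \<eta> x v"
    using g_\<phi>[OF x, of v "\<xi> x"] \<phi>_\<xi>[OF x] \<eta>_\<xi>[OF x] g_simps[OF x] by simp
  then show "g x (\<xi> x) v = \<eta> x v" using sym_g[OF x] by metis
qed

text \<open>Projection to an eigenline of \<open>\<phi>\<close>, as is \<open>eig_minus\<close>.
  Applied to a fixed vector it gives a smooth eigenfield, which is how an eigenvector at one point
  is extended.\<close>

definition eig_plus :: "real ^ 3 \<Rightarrow> 3 vec_field" where
  "eig_plus a x = (1/2) *\<^sub>R (a - \<eta> x a *\<^sub>R \<xi> x + \<phi> x a)"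
definition eig_minus :: "real ^ 3 \<Rightarrow> 3 vec_field" where
  "eig_minus a x = (1/2) *\<^sub>R (a - \<eta> x a *\<^sub>R \<xi> x - \<phi> x a)"

lemma smooth_eig_plus: "smooth_on D (eig_plus a)"
  unfolding eig_plus_def[abs_def]
  by (intro smooth_on_scaleR smooth_on_add smooth_on_diff smooth_on_const open_D smooth_\<xi> smooth_\<eta> smooth_\<phi>)

lemma smooth_eig_minus: "smooth_on D (eig_minus a)"
  unfolding eig_minus_def[abs_def]
  by (intro smooth_on_scaleR smooth_on_add smooth_on_diff smooth_on_const open_D smooth_\<xi> smooth_\<eta> smooth_\<phi>)

lemma plus_minus:
  assumes x: "x \<in> D"
  shows "\<eta> x (eig_plus a x) = 0" "\<phi> x (eig_plus a x) = eig_plus a x"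
    "\<eta> x (eig_minus a x) = 0" "\<phi> x (eig_minus a x) = - eig_minus a x"
    "a = eig_plus a x + eig_minus a x + \<eta> x a *\<^sub>R \<xi> x"
proof -
  show "a = eig_plus a x + eig_minus a x + \<eta> x a *\<^sub>R \<xi> x"
    by (simp add: eig_plus_def eig_minus_def vec_eq_iff field_simps)
qed (simp_all add: eig_plus_def eig_minus_def \<eta>_simps[OF x] \<phi>_simps[OF x] \<phi>_\<phi>[OF x] \<phi>_\<xi>[OF x] \<eta>_\<phi>[OF x] \<eta>_\<xi>[OF x]
    algebra_simps)

text \<open>On the kernel of \<open>\<eta>\<close> the map \<open>\<phi>\<close> reverses the sign
  of the metric, while two vectors of the same eigenline are multiplied by a common sign that
  cancels in their product.\<close>

lemma null:
  assumes x: "x \<in> D"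
  shows "\<eta> x u = 0 \<Longrightarrow> \<phi> x u = u \<Longrightarrow> \<phi> x v = v \<Longrightarrow> g x u v = 0"
    "\<eta> x u = 0 \<Longrightarrow> \<phi> x u = - u \<Longrightarrow> \<phi> x v = - v \<Longrightarrow> g x u v = 0"
  using g_\<phi>[OF x, of u v] g_simps[OF x] by simp_all

lemma eigenline:
  assumes x: "x \<in> D" and s: "s = 1 \<or> s = (-1::real)"
    and a: "\<eta> x a = 0" "\<phi> x a = s *\<^sub>R a" "a \<noteq> 0" and u: "\<eta> x u = 0" "\<phi> x u = s *\<^sub>R u"
  shows "\<exists>c. u = c *\<^sub>R a"
proof -
  let ?S = "{v. \<eta> x v = 0 \<and> \<phi> x v = s *\<^sub>R v}"
  have dim: "dim ?S = 1" using s dim_plus[OF x] dim_minus[OF x] by auto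
  have "?S \<subseteq> span {a}"
    by (rule card_ge_dim_independent) (use a dim in auto)
  then have "u \<in> span {a}" using u by blast
  then show ?thesis by (auto simp: span_singleton)
qed

lemma eigenvector:
  assumes x: "x \<in> D"
  shows "\<exists>a. \<eta> x a = 0 \<and> \<phi> x a = a \<and> a \<noteq> 0" "\<exists>a. \<eta> x a = 0 \<and> \<phi> x a = - a \<and> a \<noteq> 0"
proof -
  have "\<not> {v. \<eta> x v = 0 \<and> \<phi> x v = v} \<subseteq> {0}" "\<not> {v. \<eta> x v = 0 \<and> \<phi> x v = - v} \<subseteq> {0}"
    unfolding dim_eq_0[symmetric] using dim_plus[OF x] dim_minus[OF x] by simp_all
  then show "\<exists>a. \<eta> x a = 0 \<and> \<phi> x a = a \<and> a \<noteq> 0" "\<exists>a. \<eta> x a = 0 \<and> \<phi> x a = - a \<and> a \<noteq> 0" by auto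
qed

text \<open>An eigenvector for 1 is orthogonal to its own eigenline and to \<open>\<xi>\<close>; if
  it were also orthogonal to the other eigenline, it would be orthogonal to everything.\<close>

lemma g_eigenvectors:
  assumes x: "x \<in> D" and a: "\<eta> x a = 0" "\<phi> x a = a" "a \<noteq> 0" and b: "\<eta> x b = 0" "\<phi> x b = - b" "b \<noteq> 0"
  shows "g x a b \<noteq> 0"
proof
  assume ab: "g x a b = 0"
  have "g x a v = 0" for v
  proof -
    obtain c where c: "eig_minus v x = c *\<^sub>R b"
      using eigenline[OF x, of "-1" b "eig_minus v x"] b plus_minus[OF x] by auto
    have "g x a (eig_plus v x) = 0" by (rule null(1)[OF x a(1,2) plus_minus(2)[OF x]])
    then have "g x a (eig_plus v x + eig_minus v x + \<eta> x v *\<^sub>R \<xi> x) = 0"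
      by (simp add: g_simps[OF x] c ab g_\<xi>[OF x] a)
    then show ?thesis using plus_minus(5)[OF x, of v] by simp
  qed
  then show False using nondegenerate_g[OF x] a(3) by blast
qed

text \<open>With constant \<open>\<eta> X\<close> and \<open>\<eta> Y\<close> the bracket term is
  all that remains of the exterior derivative.\<close>

lemma \<eta>_lie_bracket:
  assumes s: "smooth_on D X" "smooth_on D Y"
    and "\<And>y. y \<in> D \<Longrightarrow> \<eta> y (X y) = c" "\<And>y. y \<in> D \<Longrightarrow> \<eta> y (Y y) = c'" and x: "x \<in> D"
  shows "\<eta> x (lie_bracket X Y x) = 0"
proof -
  have "dir_deriv Y (\<lambda>y. \<eta> y (X y)) x = 0" "dir_deriv X (\<lambda>y. \<eta> y (Y y)) x = 0"
    by (rule dir_deriv_const_on[OF open_D x], erule assms)+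
  then show ?thesis using closed_\<eta>[OF s x] by (simp add: ext_deriv1_def)
qed

text \<open>Because \<open>\<phi> \<xi> = 0\<close>, two of the four terms of the Nijenhuis tensor
  vanish. For \<open>s\<close> equal to 1 or -1 the result means that bracketing with
  \<open>\<xi>\<close> preserves the eigenlines.\<close>

lemma nijenhuis_\<xi>:
  assumes X: "smooth_on D X" and eig: "\<And>y. y \<in> D \<Longrightarrow> \<eta> y (X y) = 0" "\<And>y. y \<in> D \<Longrightarrow> \<phi> y (X y) = s *\<^sub>R X y"
    and x: "x \<in> D"
  shows "\<eta> x (lie_bracket \<xi> X x) = 0" "lie_bracket \<xi> X x = s *\<^sub>R \<phi> x (lie_bracket \<xi> X x)"
proof -
  show e: "\<eta> x (lie_bracket \<xi> X x) = 0"
    by (rule \<eta>_lie_bracket[OF smooth_\<xi> X \<eta>_\<xi> eig(1) x])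
  have z: "lie_bracket (\<lambda>y. \<phi> y (\<xi> y)) Y x = 0" if "smooth_on D Y" for Y
  proof -
    have "lie_bracket (\<lambda>y. \<phi> y (\<xi> y)) Y x = lie_bracket (\<lambda>_. 0) Y x"
      by (rule lie_bracket_cong[OF open_D x]) (simp_all add: \<phi>_\<xi>)
    also have "\<dots> = 0"
      using linear_0[OF linear_frechet_derivative[OF smooth_on_differentiable[OF that x]]]
      by (simp add: lie_bracket_def dir_deriv_def)
    finally show ?thesis .
  qed
  have \<phi>X: "smooth_on D (\<lambda>y. \<phi> y (X y))"
    by (rule smooth_on_linear_apply[where F = \<phi>, OF open_D lin_\<phi> smooth_\<phi> X])
  have "lie_bracket \<xi> (\<lambda>y. \<phi> y (X y)) x = lie_bracket \<xi> (\<lambda>y. s *\<^sub>R X y) x"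
    by (rule lie_bracket_cong[OF open_D x]) (simp_all add: eig)
  also have "\<dots> = s *\<^sub>R lie_bracket \<xi> X x"
    using lie_bracket_scaleR_right[OF smooth_on_const X smooth_\<xi> x, of s] by simp
  finally have "nijenhuis \<phi> \<xi> X x = lie_bracket \<xi> X x - s *\<^sub>R \<phi> x (lie_bracket \<xi> X x)"
    unfolding nijenhuis_def z[OF X] z[OF \<phi>X] by (simp add: \<phi>_\<phi>[OF x] e \<phi>_simps[OF x])
  then show "lie_bracket \<xi> X x = s *\<^sub>R \<phi> x (lie_bracket \<xi> X x)"
    using normal[OF smooth_\<xi> X x] closed_\<eta>[OF smooth_\<xi> X x] by simp
qed

text \<open>The product \<open>h\<close> of the two extended eigenvectors is nonzero at
  \<open>x0\<close>, hence nearby, where one field can be divided by it. Normality fixes the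
  direction of the brackets with \<open>\<xi>\<close>, closedness of \<open>\<eta>\<close> excludes
  components along \<open>\<xi>\<close>, and closedness of \<Phi> ties the two coefficients
  together.\<close>

lemma exists_null_frame:
  assumes x0: "x0 \<in> D"
  shows "\<exists>U E1 E2 w1 w2 w3. open U \<and> x0 \<in> U \<and> U \<subseteq> D \<and> null_frame U g \<Gamma> E1 E2 \<xi> w1 w2 w3"
proof -
  obtain a where a: "\<eta> x0 a = 0" "\<phi> x0 a = a" "a \<noteq> 0" using eigenvector(1)[OF x0] by blast
  obtain b where b: "\<eta> x0 b = 0" "\<phi> x0 b = - b" "b \<noteq> 0" using eigenvector(2)[OF x0] by blast
  define F1 F2 where "F1 = eig_plus a" and "F2 = eig_minus b"
  define h where "h x = g x (F1 x) (F2 x)" for x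
  define U where "U = {x \<in> D. h x \<noteq> 0}"
  have smooth_F: "smooth_on D F1" "smooth_on D F2"
    by (simp_all add: F1_def F2_def smooth_eig_plus smooth_eig_minus)
  have F: "\<eta> x (F1 x) = 0" "\<phi> x (F1 x) = F1 x" "\<eta> x (F2 x) = 0" "\<phi> x (F2 x) = - F2 x" if "x \<in> D" for x
    by (simp_all add: F1_def F2_def plus_minus[OF that])
  have smooth_h: "smooth_on D h"
    unfolding h_def[abs_def] by (rule smooth_metric[OF smooth_F])
  have "open (D \<inter> h -` (- {0}))"
    by (rule continuous_open_preimage[OF smooth_on_continuous_on[OF smooth_h] open_D]) auto
  moreover have "D \<inter> h -` (- {0}) = U" by (auto simp: U_def)
  ultimately have U: "open U" "U \<subseteq> D" by (auto simp: U_def)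
  have "F1 x0 = a" "F2 x0 = b" using a b by (simp_all add: F1_def F2_def eig_plus_def eig_minus_def scaleR_2[symmetric])
  then have x0U: "x0 \<in> U" using g_eigenvectors[OF x0 a b] x0 by (simp add: U_def h_def)
  define E2 where "E2 x = inverse (h x) *\<^sub>R F2 x" for x
  have smooth_ih: "smooth_on U (\<lambda>x. inverse (h x))"
    by (rule smooth_on_inverse[OF U(1) smooth_on_subset[OF smooth_h U(2)]]) (simp add: U_def)
  have smooth_E: "smooth_on U F1" "smooth_on U E2" "smooth_on U \<xi>" "smooth_on U F2"
    using smooth_on_scaleR[OF U(1) smooth_ih smooth_on_subset[OF smooth_F(2) U(2)]]
      smooth_on_subset[OF _ U(2)] smooth_F smooth_\<xi> by (simp_all add: E2_def[abs_def])
  interpret U: christoffel_chart U g \<Gamma> by (rule restrict[OF U])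
  \<comment> \<open>Read off from the brackets that the frame has to satisfy, using that the
    component along one null field is the product with the other.\<close>
  define w1 where "w1 x = - g x (lie_bracket F1 E2 x) (F1 x)" for x
  define w2 where "w2 x = - g x (lie_bracket F1 E2 x) (E2 x)" for x
  define w3 where "w3 x = g x (lie_bracket \<xi> F1 x) (E2 x)" for x
  have frame: "null_frame U g \<Gamma> F1 E2 \<xi> w1 w2 w3"
  proof
    show "smooth_on U F1" "smooth_on U E2" "smooth_on U \<xi>" by (fact smooth_E)+
    show "smooth_on U w1" "smooth_on U w2" "smooth_on U w3"
      unfolding w1_def[abs_def] w2_def[abs_def] w3_def[abs_def]
      by (intro smooth_on_minus U.smooth_metric smooth_on_lie_bracket smooth_E U)+
    fix x assume xU: "x \<in> U"
    then have x: "x \<in> D" and h: "h x \<noteq> 0" by (auto simp: U_def)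
    have gF: "g x (F1 x) (F1 x) = 0" "g x (F2 x) (F2 x) = 0" "g x (F1 x) (F2 x) = h x" "g x (F2 x) (F1 x) = h x"
      using null[OF x] F[OF x] sym_g[OF x] by (simp_all add: h_def)
    have nz: "F1 x \<noteq> 0" "F2 x \<noteq> 0" using gF h g_simps[OF x] by auto
    show "g x (F1 x) (F1 x) = 0" "g x (F1 x) (E2 x) = 1" "g x (E2 x) (E2 x) = 0" "g x (F1 x) (\<xi> x) = 0"
      "g x (E2 x) (\<xi> x) = 0" "g x (\<xi> x) (\<xi> x) = 1"
      using h by (simp_all add: E2_def gF g_simps[OF x] g_\<xi>[OF x] F[OF x] \<eta>_\<xi>[OF x] \<eta>_simps[OF x])
    note gE = this
    have gE': "g x (E2 x) (F1 x) = 1" using gE sym_g[OF x] by simp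
    have expand: "v = g x v (E2 x) *\<^sub>R F1 x + g x v (F1 x) *\<^sub>R E2 x + g x v (\<xi> x) *\<^sub>R \<xi> x" for v
    proof -
      obtain c where c: "eig_plus v x = c *\<^sub>R F1 x"
        using eigenline[OF x, of 1 "F1 x" "eig_plus v x"] F[OF x] nz plus_minus[OF x] by auto
      obtain d where d: "eig_minus v x = d *\<^sub>R F2 x"
        using eigenline[OF x, of "-1" "F2 x" "eig_minus v x"] F[OF x] nz plus_minus[OF x] by auto
      have v: "v = c *\<^sub>R F1 x + (d * h x) *\<^sub>R E2 x + \<eta> x v *\<^sub>R \<xi> x"
      proof -
        have "d * h x * inverse (h x) = d" using h by (simp add: field_simps)
        then have "(d * h x) *\<^sub>R E2 x = d *\<^sub>R F2 x" by (simp only: E2_def scaleR_scaleR)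
        then show ?thesis using plus_minus(5)[OF x, of v] by (simp only: c d)
      qed
      have "g x (c *\<^sub>R F1 x + (d * h x) *\<^sub>R E2 x + \<eta> x v *\<^sub>R \<xi> x) (E2 x) = c"
        "g x (c *\<^sub>R F1 x + (d * h x) *\<^sub>R E2 x + \<eta> x v *\<^sub>R \<xi> x) (F1 x) = d * h x"
        using F[OF x] gE(5) by (simp_all add: g_simps[OF x] gE gE' g_\<xi>[OF x])
      then show ?thesis using v g_\<xi>[OF x] by metis
    qed
    then show "v = g x v (E2 x) *\<^sub>R F1 x + g x v (F1 x) *\<^sub>R E2 x + g x v (\<xi> x) *\<^sub>R \<xi> x" for v .
    define \<alpha> where "\<alpha> = w3 x"
    note n1 = nijenhuis_\<xi>[OF smooth_F(1), of 1 x] nijenhuis_\<xi>[OF smooth_F(2), of "-1" x]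
    have br1: "lie_bracket \<xi> F1 x = \<alpha> *\<^sub>R F1 x"
    proof -
      have "\<eta> x (lie_bracket \<xi> F1 x) = 0" "\<phi> x (lie_bracket \<xi> F1 x) = 1 *\<^sub>R lie_bracket \<xi> F1 x"
        using n1(1,2) F x by simp_all
      then obtain c where "lie_bracket \<xi> F1 x = c *\<^sub>R F1 x"
        using eigenline[OF x, of 1 "F1 x"] F[OF x] nz by auto
      then show ?thesis by (simp add: \<alpha>_def w3_def g_simps[OF x] gE)
    qed
    then show "lie_bracket \<xi> F1 x = w3 x *\<^sub>R F1 x" by (simp add: \<alpha>_def)
    \<comment> \<open>So far \<open>\<beta>\<close> is unrelated to \<open>\<alpha>\<close>; for the
      rescaled field \<open>E2\<close> the coefficient has to become
      \<open>- \<alpha>\<close>.\<close>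
    obtain \<beta> where br2: "lie_bracket \<xi> F2 x = \<beta> *\<^sub>R F2 x"
    proof -
      have e: "\<eta> x (lie_bracket \<xi> F2 x) = 0" using n1(3) F x by simp
      have "lie_bracket \<xi> F2 x = - \<phi> x (lie_bracket \<xi> F2 x)" using n1(4) F x by simp
      then have "\<phi> x (lie_bracket \<xi> F2 x) = (-1) *\<^sub>R lie_bracket \<xi> F2 x"
        by (metis minus_minus scaleR_minus1_left)
      then show ?thesis
        using eigenline[OF x, of "-1" "F2 x", OF _ _ _ _ e] F[OF x] nz that by auto
    qed
    have \<eta>_br: "\<eta> x (lie_bracket F1 F2 x) = 0"
      by (rule \<eta>_lie_bracket[OF smooth_F F(1) F(3) x])
    have "dir_deriv \<xi> (\<lambda>y. fundamental_form \<phi> g y (F1 y) (F2 y)) x = dir_deriv \<xi> (\<lambda>y. - h y) x"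
      by (rule dir_deriv_cong[OF open_D x]) (simp add: fundamental_form_def F h_def g_simps)
    then have d1: "dir_deriv \<xi> (\<lambda>y. fundamental_form \<phi> g y (F1 y) (F2 y)) x = - dir_deriv \<xi> h x"
      by (simp add: dir_deriv_minus[OF smooth_h x])
    have d2: "dir_deriv F1 (\<lambda>y. fundamental_form \<phi> g y (F2 y) (\<xi> y)) x = 0"
      by (rule dir_deriv_const_on[OF open_D x]) (simp add: fundamental_form_def \<phi>_\<xi> g_simps)
    have d3: "dir_deriv F2 (\<lambda>y. fundamental_form \<phi> g y (\<xi> y) (F1 y)) x = 0"
      by (rule dir_deriv_const_on[OF open_D x]) (simp add: fundamental_form_def F g_\<xi>)
    have br2': "lie_bracket F2 \<xi> x = - (\<beta> *\<^sub>R F2 x)" using br2 by (simp add: lie_bracket_def algebra_simps)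
    \<comment> \<open>The condition d\<Phi>(\<xi>, F1, F2) = 0, where \<Phi>(F1, F2) = -h. Dividing
      \<open>F2\<close> by \<open>h\<close> therefore lowers its bracket coefficient by
      \<open>\<alpha> + \<beta>\<close>, from \<open>\<beta>\<close> to
      \<open>- \<alpha>\<close>.\<close>
    have \<xi>h: "dir_deriv \<xi> h x = (\<alpha> + \<beta>) * h x"
      using closed_\<Phi>[OF smooth_\<xi> smooth_F x] d1 d2 d3
      by (simp add: ext_deriv2_def br1 br2' fundamental_form_def F[OF x] \<phi>_\<xi>[OF x] g_simps[OF x] gF algebra_simps)
    have dih: "dir_deriv X (\<lambda>y. inverse (h y)) x = - (inverse (h x) * dir_deriv X h x * inverse (h x))" for X
      unfolding dir_deriv_def
      by (rule frechet_derivative_inverse[OF smooth_on_differentiable[OF smooth_h x] h])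
    have "lie_bracket \<xi> E2 x = inverse (h x) *\<^sub>R (\<beta> *\<^sub>R F2 x) - (inverse (h x) * (\<alpha> + \<beta>)) *\<^sub>R F2 x"
      unfolding E2_def[abs_def] lie_bracket_scaleR_right[OF smooth_ih smooth_E(4) smooth_E(3) xU] br2 dih \<xi>h
      using h by (simp add: field_simps)
    then show "lie_bracket \<xi> E2 x = - (w3 x *\<^sub>R E2 x)"
      by (simp add: E2_def \<alpha>_def[symmetric] algebra_simps)
    \<comment> \<open>Rescaling adds a multiple of \<open>F2\<close>, which lies in the kernel of
      \<open>\<eta>\<close>, so the bracket still has no component along
      \<open>\<xi>\<close>.\<close>
    have "\<eta> x (lie_bracket F1 E2 x) = 0"
      unfolding E2_def[abs_def] lie_bracket_scaleR_right[OF smooth_ih smooth_E(4) smooth_E(1) xU]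
      by (simp add: \<eta>_simps[OF x] \<eta>_br F[OF x])
    then show "lie_bracket F1 E2 x = - (w2 x *\<^sub>R F1 x) - w1 x *\<^sub>R E2 x"
      using expand[of "lie_bracket F1 E2 x"] g_\<xi>[OF x] by (simp add: w1_def w2_def)
  qed
  show ?thesis using frame U x0U by blast
qed

text \<open>\<open>N\<close> and \<open>cov\<close> are known to agree on \<open>D\<close> and for
  smooth fields. The inner derivative is exchanged by agreement on the open set, the outer one
  because \<open>N Y Z\<close> is smooth again.\<close>

lemma ricci_trace:
  assumes LC: "\<And>X Y. smooth_on D X \<Longrightarrow> smooth_on D Y \<Longrightarrow> smooth_on D (N X Y)"
    and N: "\<And>X Y x. smooth_on D X \<Longrightarrow> smooth_on D Y \<Longrightarrow> x \<in> D \<Longrightarrow> N X Y x = cov X Y x"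
    and x: "x \<in> D"
  shows "ricci N x u v = trace (matrix (\<lambda>z. curv x z u v))"
proof -
  have "riemann N X Y Z x = curv x (X x) (Y x) (Z x)"
    if s: "smooth_on D X" "smooth_on D Y" "smooth_on D Z" for X Y Z
  proof -
    have "N X (N Y Z) x = cov X (cov Y Z) x" if "smooth_on D X" "smooth_on D Y" for X Y
      unfolding N[OF that(1) LC[OF that(2) s(3)] x] by (rule cov_cong[OF N[OF that(2) s(3)] x])
    then have "riemann N X Y Z x = riemann cov X Y Z x"
      unfolding riemann_def using s N[OF smooth_on_lie_bracket[OF open_D s(1,2)] s(3) x] by simp
    then show ?thesis using riemann_cov[OF s x] by simp
  qed
  note this[OF smooth_on_const smooth_on_const smooth_on_const]
  then show ?thesis by (simp add: ricci_def)
qed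

text \<open>\<open>N\<close> acts on fields over \<open>D\<close>, the frame lives on
  \<open>U\<close>; the tensor \<open>curv\<close>, evaluated at a point, mediates between
  them.\<close>

lemma ricci_frame:
  assumes N: "\<And>X Y. smooth_on D X \<Longrightarrow> smooth_on D Y \<Longrightarrow> smooth_on D (N X Y)"
    "\<And>X Y x. smooth_on D X \<Longrightarrow> smooth_on D Y \<Longrightarrow> x \<in> D \<Longrightarrow> N X Y x = cov X Y x"
    and U: "U \<subseteq> D" "null_frame U g \<Gamma> E1 E2 \<xi> w1 w2 w3" and x: "x \<in> U"
  shows "ricci N x u v = null_frame.\<kappa> E1 E2 w1 w2 x * (g x u v - \<eta> x u * \<eta> x v)"
    "ricci_operator g N x u = null_frame.\<kappa> E1 E2 w1 w2 x *\<^sub>R (u - \<eta> x u *\<^sub>R \<xi> x)"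
    "scalar_curvature g N x = 2 * null_frame.\<kappa> E1 E2 w1 w2 x"
proof -
  have xD: "x \<in> D" using x U by blast
  show r: "ricci N x u v = null_frame.\<kappa> E1 E2 w1 w2 x * (g x u v - \<eta> x u * \<eta> x v)" for u v
    using ricci_trace[OF N xD] null_frame.trace_curv[OF U(2) x] g_\<xi>[OF xD] by simp
  note e = scalar_curvature_eqI[where g = g and x = x and N = N and \<eta> = "\<eta> x" and \<xi> = "\<xi> x",
      OF bil_g[OF xD] nondegenerate_g[OF xD] lin_\<eta>[OF xD] \<eta>_\<xi>[OF xD] g_\<xi>(2)[OF xD] r]
  show "ricci_operator g N x u = null_frame.\<kappa> E1 E2 w1 w2 x *\<^sub>R (u - \<eta> x u *\<^sub>R \<xi> x)"
    by (rule e(1))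
  show "scalar_curvature g N x = 2 * null_frame.\<kappa> E1 E2 w1 w2 x"
    by (rule e(2))
qed

text \<open>Some null frame exists near each point, and it enters the Ricci formulas only through
  \<open>\<kappa>\<close>, which is half the scalar curvature. So the frame can be
  eliminated.\<close>

lemma ricci_scalar:
  assumes N: "\<And>X Y. smooth_on D X \<Longrightarrow> smooth_on D Y \<Longrightarrow> smooth_on D (N X Y)"
    "\<And>X Y x. smooth_on D X \<Longrightarrow> smooth_on D Y \<Longrightarrow> x \<in> D \<Longrightarrow> N X Y x = cov X Y x"
    and x: "x \<in> D"
  shows "ricci N x u v = scalar_curvature g N x / 2 * (g x u v - \<eta> x u * \<eta> x v)"
    "ricci_operator g N x u = (scalar_curvature g N x / 2) *\<^sub>R (u - \<eta> x u *\<^sub>R \<xi> x)"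
proof -
  obtain U E1 E2 w1 w2 w3 where U: "x \<in> U" "U \<subseteq> D" "null_frame U g \<Gamma> E1 E2 \<xi> w1 w2 w3"
    using exists_null_frame[OF x] by blast
  note r = ricci_frame[OF N U(2,3,1)]
  show "ricci N x u v = scalar_curvature g N x / 2 * (g x u v - \<eta> x u * \<eta> x v)"
    "ricci_operator g N x u = (scalar_curvature g N x / 2) *\<^sub>R (u - \<eta> x u *\<^sub>R \<xi> x)"
    by (simp_all add: r)
qed

lemma scalar_curvature_locally_constant:
  assumes N: "\<And>X Y. smooth_on D X \<Longrightarrow> smooth_on D Y \<Longrightarrow> smooth_on D (N X Y)"
    "\<And>X Y x. smooth_on D X \<Longrightarrow> smooth_on D Y \<Longrightarrow> x \<in> D \<Longrightarrow> N X Y x = cov X Y x"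
    and V: "smooth_on D V"
    and soliton: "\<And>x u v. x \<in> D \<Longrightarrow> lie_deriv_metric V g (\<lambda>_. u) (\<lambda>_. v) x =
      (lam - scalar_curvature g N x) * g x u v"
    and x0: "x0 \<in> D"
  shows "\<exists>W. open W \<and> x0 \<in> W \<and> W \<subseteq> D \<and> (\<forall>x\<in>W. scalar_curvature g N x = scalar_curvature g N x0)"
proof -
  obtain U E1 E2 w1 w2 w3 where U: "open U" "x0 \<in> U" "U \<subseteq> D" "null_frame U g \<Gamma> E1 E2 \<xi> w1 w2 w3"
    using exists_null_frame[OF x0] by blast
  interpret F: null_frame U g \<Gamma> E1 E2 \<xi> w1 w2 w3 by (rule U(4))
  have r: "scalar_curvature g N x = 2 * F.\<kappa> x" if "x \<in> U" for x
    by (rule ricci_frame(3)[OF N U(3,4) that])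
  \<comment> \<open>Half of \<open>lam - r\<close>, with \<open>r = 2 * \<kappa>\<close>.\<close>
  define \<sigma> where "\<sigma> x = lam / 2 - F.\<kappa> x" for x
  have d\<sigma>: "frechet_derivative \<sigma> (at x) v = - frechet_derivative F.\<kappa> (at x) v" if "x \<in> U" for x v
    using dir_deriv_diff[OF U(1) smooth_on_const F.smooth_\<kappa> that, of "\<lambda>_. v" "lam / 2"]
    by (simp add: \<sigma>_def[abs_def] dir_deriv_def)
  interpret Y: yamabe_frame U g \<Gamma> E1 E2 \<xi> w1 w2 w3 V \<sigma>
  proof
    show "smooth_on U V" by (rule smooth_on_subset[OF V U(3)])
    show "smooth_on U \<sigma>" unfolding \<sigma>_def[abs_def]
      by (rule smooth_on_diff[OF U(1) smooth_on_const F.smooth_\<kappa>])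
    fix x assume xU: "x \<in> U"
    then have x: "x \<in> D" using U by blast
    show "dir_deriv \<xi> \<sigma> x = 0"
      using F.D3_\<kappa>[OF xU] d\<sigma>[OF xU] by (simp add: dir_deriv_def)
    fix u v
    \<comment> \<open>By \<open>compat\<close> the derivative of the metric is a sum of two
      \<open>\<Gamma>\<close> terms, and symmetry of \<open>\<Gamma>\<close> lets them complete the
      derivatives of \<open>V\<close> to covariant ones.\<close>
    have "lie_deriv_metric V g (\<lambda>_. u) (\<lambda>_. v) x = g x (cov (\<lambda>_. u) V x) v + g x u (cov (\<lambda>_. v) V x)"
      by (simp add: lie_deriv_metric_def lie_bracket_def cov_def dir_deriv_def compat[OF x] g_simps[OF x]
          sym_\<Gamma>[OF x, of "V x" u] sym_\<Gamma>[OF x, of "V x" v])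
    then show "g x (cov (\<lambda>_. u) V x) v + g x u (cov (\<lambda>_. v) V x) = 2 * \<sigma> x * g x u v"
      using soliton[OF x] r[OF xU] by (simp add: \<sigma>_def algebra_simps)
  qed
  \<comment> \<open>Here the argument closes up: the identity for \<open>\<sigma>\<close> becomes
    one for \<open>\<kappa>\<close> alone, as the two differ by a sign and a constant.\<close>
  have "F.\<kappa> x * frechet_derivative F.\<kappa> (at x) v = 0" if "x \<in> U" for x v
    using Y.\<kappa>_d\<sigma>[OF that, of v] d\<sigma>[OF that, of v] by simp
  then obtain W where W: "open W" "x0 \<in> W" "W \<subseteq> U" "\<And>y. y \<in> W \<Longrightarrow> F.\<kappa> y = F.\<kappa> x0"
    using locally_constant_of_mult_derivative[OF U(1) F.smooth_\<kappa> U(2)] by blast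
  have "scalar_curvature g N x = scalar_curvature g N x0" if "x \<in> W" for x
    using r[of x] r[OF U(2)] W(3) W(4)[OF that] that by auto
  then show ?thesis using W(1-3) U(3) by blast
qed

end

section \<open>Charts and the invariance of the scalar curvature\<close>

lemma smooth_manifoldD:
  assumes "smooth_manifold M A" "c \<in> A"
  shows "openin M (fst c)" "open (chart_image c)"
    "homeomorphic_map (subtopology M (fst c)) (top_of_set (chart_image c)) (snd c)"
    "topspace (subtopology M (fst c)) = fst c"
  using assms openin_subset[of M "fst c"] by (auto simp: smooth_manifold_def)

lemma chart_inv_apply:
  assumes "smooth_manifold M A" "c \<in> A" "p \<in> fst c"
  shows "chart_inv c (snd c p) = p"
  using homeomorphic_imp_injective_map[OF smooth_manifoldD(3)[OF assms(1,2)]]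
    smooth_manifoldD(4)[OF assms(1,2)] assms(3)
  by (simp add: chart_inv_def inv_into_f_f)

lemma openin_chart_preimage:
  assumes M: "smooth_manifold M A" "c \<in> A" and W: "open W" "W \<subseteq> chart_image c"
  shows "openin M {p \<in> fst c. snd c p \<in> W}"
proof -
  note m = smooth_manifoldD[OF M]
  have "openin (top_of_set (chart_image c)) W" using W by (simp add: open_subset)
  then have "openin (subtopology M (fst c)) {p \<in> fst c. snd c p \<in> W}"
    using openin_continuous_map_preimage[OF homeomorphic_imp_continuous_map[OF m(3)], of W]
    by (simp only: m(4))
  then show ?thesis using m(1) by (simp add: openin_open_subtopology)
qed

lemma open_overlap:
  assumes M: "smooth_manifold M A" "c \<in> A" "d \<in> A"
  shows "open (overlap c d)"
proof -
  note m = smooth_manifoldD[OF M(1,2)]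
  have "openin (subtopology M (fst c)) (fst c \<inter> fst d)"
    using m(1) smooth_manifoldD(1)[OF M(1,3)] by (simp add: openin_open_subtopology openin_Int)
  then have "openin (top_of_set (chart_image c)) (overlap c d)"
    using homeomorphic_imp_open_map[OF m(3)] by (simp add: open_map_def overlap_def)
  then show ?thesis using m(2) openin_open_trans by blast
qed

lemma transition_image:
  assumes M: "smooth_manifold M A" "c \<in> A" "d \<in> A" and x: "x \<in> overlap c d"
  shows "transition c d x \<in> chart_image d" "x \<in> chart_image c"
  using x chart_inv_apply[OF M(1,2)] by (auto simp: overlap_def transition_def chart_image_def)

lemma lie_deriv_metric_const:
  assumes D: "open D" and bil: "bilinear (g x)"
  shows "lie_deriv_metric V g (\<lambda>_. u) (\<lambda>_. v) x = frechet_derivative (\<lambda>y. g y u v) (at x) (V x)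
    + g x (frechet_derivative V (at x) u) v + g x u (frechet_derivative V (at x) v)"
  by (simp add: lie_deriv_metric_def lie_bracket_def dir_deriv_def bilinear_lneg[OF bil] bilinear_rneg[OF bil])

text \<open>The second derivatives of the transition map enter both through the metric and through the
  field, and cancel by their symmetry.\<close>

lemma lie_deriv_metric_transition:
  fixes A :: "('a, 'n::finite) chart set"
  assumes M: "smooth_manifold M A" "c \<in> A" "d \<in> A" and g: "bilinear_field A g"
    and V: "vector_field A V" and x: "x \<in> overlap c d"
  shows "lie_deriv_metric (V d) (g d) (\<lambda>_. d_transition c d x u) (\<lambda>_. d_transition c d x v) (transition c d x) =
    lie_deriv_metric (V c) (g c) (\<lambda>_. u) (\<lambda>_. v) x"
proof -
  define \<tau> where "\<tau> = transition c d"
  define S where "S = overlap c d"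
  define T where "T y = frechet_derivative \<tau> (at y)" for y
  have T: "d_transition c d y = T y" for y by (simp add: T_def \<tau>_def d_transition_def[abs_def])
  have S: "open S" unfolding S_def by (rule open_overlap[OF M])
  have xS: "x \<in> S" using x by (simp add: S_def)
  have s\<tau>: "smooth_on S \<tau>" using M by (simp add: smooth_manifold_def S_def \<tau>_def)
  have \<tau>S: "\<tau> y \<in> chart_image d" "y \<in> chart_image c" if "y \<in> S" for y
    using transition_image[OF M] that by (simp_all add: S_def \<tau>_def)
  note op = smooth_manifoldD(2)[OF M(1,2)] smooth_manifoldD(2)[OF M(1,3)]
  have bil: "bilinear (g c y)" if "y \<in> chart_image c" for y
    using g M that by (simp add: bilinear_field_def)
  have bil_d: "bilinear (g d y)" if "y \<in> chart_image d" for y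
    using g M that by (simp add: bilinear_field_def)
  have sg: "smooth_on (chart_image d) (\<lambda>y. g d y a b)" for a b
    using g M by (simp add: bilinear_field_def)
  have tg: "g d (\<tau> y) (T y a) (T y b) = g c y a b" if "y \<in> S" for y a b
    using g M that unfolding bilinear_field_def T[symmetric] \<tau>_def S_def by blast
  have sV: "smooth_on (chart_image c) (V c)" "smooth_on (chart_image d) (V d)"
    using V M by (simp_all add: vector_field_def)
  have tV: "V d (\<tau> y) = T y (V c y)" if "y \<in> S" for y
    using V M that unfolding vector_field_def T[symmetric] \<tau>_def S_def by blast
  let ?y = "\<tau> x"
  have d\<tau>: "(\<tau> has_derivative T x) (at x)"
    unfolding T_def by (rule has_frechet_derivative[OF smooth_on_differentiable[OF s\<tau> xS]])
  have sT: "smooth_on S (\<lambda>y. T y a)" for a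
    unfolding T_def by (rule smooth_on_frechet_derivative[OF s\<tau>])
  have lT: "linear (T y)" if "y \<in> S" for y
    unfolding T_def by (rule linear_frechet_derivative[OF smooth_on_differentiable[OF s\<tau> that]])
  have chain: "((\<lambda>z. h (\<tau> z)) has_derivative (\<lambda>w. frechet_derivative h (at ?y) (T x w))) (at x)"
    if "smooth_on (chart_image d) h" for h :: "real ^ 'n \<Rightarrow> 'c::real_normed_vector"
    by (rule has_derivative_compose[OF d\<tau> has_frechet_derivative[OF smooth_on_differentiable[OF that \<tau>S(1)[OF xS]]]])
  define H where "H a w = frechet_derivative (\<lambda>z. T z a) (at x) w" for a w
  have H: "H a w = H w a" for a w
    unfolding H_def T_def by (rule second_derivative_symmetric[OF S s\<tau> xS])
  have DV: "frechet_derivative (V d) (at ?y) (T x a) = H (V c x) a + T x (frechet_derivative (V c) (at x) a)" for a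
  proof -
    have "frechet_derivative (\<lambda>z. V d (\<tau> z)) (at x) a = frechet_derivative (\<lambda>z. T z (V c z)) (at x) a"
      by (rule fun_cong[OF frechet_derivative_cong_open[OF S xS tV]])
    also have "\<dots> = H (V c x) a + T x (frechet_derivative (V c) (at x) a)"
      unfolding H_def
      by (rule frechet_derivative_linear_apply[where F = T, OF S lT xS
            smooth_on_differentiable[OF sT xS] smooth_on_differentiable[OF sV(1) \<tau>S(2)[OF xS]]])
    finally show ?thesis using frechet_derivative_eqI[OF chain[OF sV(2)]] by simp
  qed
  let ?w = "V c x"
  have dg: "frechet_derivative (\<lambda>z. g c z u v) (at x) ?w =
      frechet_derivative (\<lambda>y. g d y (T x u) (T x v)) (at ?y) (T x ?w)
      + g d ?y (H u ?w) (T x v) + g d ?y (T x u) (H v ?w)"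
  proof -
    have "frechet_derivative (\<lambda>z. g c z u v) (at x) ?w = frechet_derivative (\<lambda>z. g d (\<tau> z) (T z u) (T z v)) (at x) ?w"
      by (rule fun_cong[OF frechet_derivative_cong_open[OF S xS tg[symmetric]]])
    also have "\<dots> = frechet_derivative (\<lambda>z. g d (\<tau> z) (T x u) (T x v)) (at x) ?w
      + g d ?y (H u ?w) (T x v) + g d ?y (T x u) (H v ?w)"
      unfolding H_def
      by (rule frechet_derivative_bilinear_apply[where B = "\<lambda>z. g d (\<tau> z)", OF S bil_d[OF \<tau>S(1)] xS
            differentiableI[OF chain[OF sg]] smooth_on_differentiable[OF sT xS] smooth_on_differentiable[OF sT xS]])
    finally show ?thesis using frechet_derivative_eqI[OF chain[OF sg]] by simp
  qed
  note b = bil_d[OF \<tau>S(1)[OF xS]]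
  show ?thesis
    unfolding T \<tau>_def[symmetric] lie_deriv_metric_const[where g = "g d" and x = ?y, OF op(2) b]
      lie_deriv_metric_const[where g = "g c" and x = x, OF op(1) bil[OF \<tau>S(2)[OF xS]]] DV dg tV[OF xS]
    by (simp add: H[of u] H[of v] bilinear_ladd[OF b] bilinear_radd[OF b] tg[OF xS])
qed

text \<open>\<open>V\<close> and \<open>g\<close> are global tensor fields, so the factors can be
  compared without relating the local connections. One pair of vectors with nonzero product is
  enough.\<close>

lemma lie_deriv_factor_chart_independent:
  fixes A :: "('a, 'n::finite) chart set" and \<rho> :: "('a, 'n) chart \<Rightarrow> real ^ 'n \<Rightarrow> real"
  assumes M: "smooth_manifold M A" "c \<in> A" "d \<in> A" and g: "semi_riemannian_metric A g"
    and V: "vector_field A V"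
    and L: "\<And>c X Y x. c \<in> A \<Longrightarrow> smooth_on (chart_image c) X \<Longrightarrow> smooth_on (chart_image c) Y \<Longrightarrow>
      x \<in> chart_image c \<Longrightarrow> lie_deriv_metric (V c) (g c) X Y x = \<rho> c x * g c x (X x) (Y x)"
    and p: "p \<in> fst c" "p \<in> fst d"
  shows "\<rho> c (snd c p) = \<rho> d (snd d p)"
proof -
  let ?x = "snd c p" and ?T = "d_transition c d (snd c p)"
  have x: "?x \<in> overlap c d" using p by (simp add: overlap_def)
  have y: "transition c d ?x = snd d p"
    using chart_inv_apply[OF M(1,2) p(1)] by (simp add: transition_def)
  have bf: "bilinear_field A g" using g by (simp add: semi_riemannian_metric_def)
  have "\<exists>u v. g c ?x u v \<noteq> 0"
  proof (rule ccontr)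
    assume "\<not> ?thesis"
    then have "u = 0" for u :: "real ^ 'n"
      using g M(2) transition_image(2)[OF M x] unfolding semi_riemannian_metric_def by blast
    \<comment> \<open>Any index will do; a nonzero vector exists because the index type is
      nonempty.\<close>
    from this[of "axis undefined 1"] show False by (simp add: axis_eq_0_iff)
  qed
  then obtain u v where uv: "g c ?x u v \<noteq> 0" by blast
  have "g d (snd d p) (?T u) (?T v) = g c ?x u v"
    using bf M x y unfolding bilinear_field_def by metis
  then have "\<rho> d (snd d p) * g c ?x u v = \<rho> c ?x * g c ?x u v"
    using lie_deriv_metric_transition[OF M bf V x, of u v]
      L[OF M(2) smooth_on_const smooth_on_const transition_image(2)[OF M x], of u v]
      L[OF M(3) smooth_on_const smooth_on_const transition_image(1)[OF M x], of "?T u" "?T v"]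
    unfolding y by simp
  then show ?thesis using uv by simp
qed

text \<open>A level set is open and closed, hence everything once it contains a point.\<close>

lemma locally_constant_imp_constant:
  assumes "connected_space M"
    and loc: "\<And>p. p \<in> topspace M \<Longrightarrow> \<exists>W. openin M W \<and> p \<in> W \<and> (\<forall>q\<in>W. f q = f p)"
  shows "\<exists>c. \<forall>p\<in>topspace M. f p = c"
proof (cases "topspace M = {}")
  case False
  then obtain p0 where p0: "p0 \<in> topspace M" by blast
  \<comment> \<open>Stated for an arbitrary predicate, so that it gives openness of the level set
    and of its complement.\<close>
  have o: "openin M {p \<in> topspace M. P (f p)}" for P
  proof (subst openin_subopen, intro ballI)
    fix p assume "p \<in> {p \<in> topspace M. P (f p)}"
    then have p: "p \<in> topspace M" "P (f p)" by auto
    obtain W where W: "openin M W" "p \<in> W" "\<forall>q\<in>W. f q = f p" using loc[OF p(1)] by blast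
    have "W \<subseteq> {p \<in> topspace M. P (f p)}"
    proof
      fix q assume "q \<in> W"
      then show "q \<in> {p \<in> topspace M. P (f p)}"
        using W p(2) openin_subset[OF W(1)] by (metis (mono_tags, lifting) mem_Collect_eq subsetD)
    qed
    with W show "\<exists>T. openin M T \<and> p \<in> T \<and> T \<subseteq> {p \<in> topspace M. P (f p)}" by blast
  qed
  have "topspace M - {p \<in> topspace M. f p = f p0} = {p \<in> topspace M. f p \<noteq> f p0}" by auto
  then have "closedin M {p \<in> topspace M. f p = f p0}"
    using o[of "\<lambda>r. r \<noteq> f p0"] by (simp add: closedin_def)
  then have "{p \<in> topspace M. f p = f p0} = {} \<or> {p \<in> topspace M. f p = f p0} = topspace M"
    using assms(1) o[of "\<lambda>r. r = f p0"] unfolding connected_space_clopen_in by blast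
  then have "{p \<in> topspace M. f p = f p0} = topspace M" using p0 by blast
  then show ?thesis by blast
qed simp

text \<open>Passage from the global hypotheses to one chart; \<open>CARD(3) = 2 * n + 1\<close>
  forces \<open>n = 1\<close>, so the eigendistributions become lines.\<close>

lemma paracosymplectic_imp_chart:
  assumes M: "smooth_manifold M A" and P: "paracosymplectic A \<phi> \<xi> \<eta> g"
    and LC: "levi_civita A g nabla" and c: "c \<in> A"
  defines "\<Gamma> \<equiv> \<lambda>x u v. nabla c (\<lambda>_. u) (\<lambda>_. v) x"
  shows "paracosymplectic_chart (chart_image c) (g c) \<Gamma> (\<phi> c) (\<xi> c) (\<eta> c)"
    and "smooth_on (chart_image c) X \<Longrightarrow> smooth_on (chart_image c) Y \<Longrightarrow> smooth_on (chart_image c) (nabla c X Y)"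
    and "smooth_on (chart_image c) X \<Longrightarrow> smooth_on (chart_image c) Y \<Longrightarrow> x \<in> chart_image c \<Longrightarrow>
      nabla c X Y x = christoffel_chart.cov \<Gamma> X Y x"
proof -
  let ?D = "chart_image c"
  note o = smooth_manifoldD(2)[OF M c]
  have P': "almost_paracontact A \<phi> \<xi> \<eta>" "semi_riemannian_metric A g"
    "\<And>x u v. x \<in> ?D \<Longrightarrow> g c x (\<phi> c x u) (\<phi> c x v) = - g c x u v + \<eta> c x u * \<eta> c x v"
    "normal_structure A \<phi> \<xi> \<eta>" "closed_one_form A \<eta>" "closed_two_form A (\<lambda>c. fundamental_form (\<phi> c) (g c))"
    using P c by (simp_all add: paracosymplectic_def almost_paracontact_metric_def)
  have E: "endomorphism_field A \<phi>" "vector_field A \<xi>" "one_form_field A \<eta>"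
    using P'(1) by (simp_all add: almost_paracontact_def)
  obtain n where "CARD(3) = 2 * n + 1" and n: "\<forall>c\<in>A. \<forall>x\<in>chart_image c. \<eta> c x (\<xi> c x) = 1 \<and>
          (\<forall>v. \<phi> c x (\<phi> c x v) = v - \<eta> c x v *\<^sub>R \<xi> c x) \<and>
          dim {v. \<eta> c x v = 0 \<and> \<phi> c x v = v} = n \<and>
          dim {v. \<eta> c x v = 0 \<and> \<phi> c x v = - v} = n"
    using P'(1) unfolding almost_paracontact_def by blast
  then have n1: "n = 1" by simp
  have G: "bilinear (g c x)" "g c x u v = g c x v u" "(\<And>v. g c x u v = 0) \<Longrightarrow> u = 0" if "x \<in> ?D" for x u v
    using P'(2) c that by (simp_all add: semi_riemannian_metric_def bilinear_field_def)
  have Gs: "smooth_on ?D (\<lambda>x. g c x u v)" for u v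
    using P'(2) c by (simp_all add: semi_riemannian_metric_def bilinear_field_def)
  have LC': "levi_civita_on ?D (g c) (nabla c)" using LC c by (simp add: levi_civita_def)
  note chart = levi_civita_on_christoffel[where g = "g c" and N = "nabla c", OF o G(1) Gs G(2) G(3) LC', folded \<Gamma>_def]
  interpret christoffel_chart ?D "g c" \<Gamma> by (rule chart(1))
  show "smooth_on ?D X \<Longrightarrow> smooth_on ?D Y \<Longrightarrow> smooth_on ?D (nabla c X Y)"
    using LC' by (simp add: levi_civita_on_def affine_connection_on_def)
  show "smooth_on ?D X \<Longrightarrow> smooth_on ?D Y \<Longrightarrow> x \<in> ?D \<Longrightarrow> nabla c X Y x = christoffel_chart.cov \<Gamma> X Y x"
    by (rule chart(2))
  show "paracosymplectic_chart ?D (g c) \<Gamma> (\<phi> c) (\<xi> c) (\<eta> c)"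
  proof (intro paracosymplectic_chart.intro paracosymplectic_chart_axioms.intro chart(1))
    show "smooth_on ?D (\<lambda>x. \<phi> c x v)" "smooth_on ?D (\<lambda>x. \<eta> c x v)" "smooth_on ?D (\<xi> c)" for v
      using E c by (simp_all add: endomorphism_field_def one_form_field_def vector_field_def)
    fix x assume x: "x \<in> ?D"
    show "linear (\<phi> c x)" "linear (\<eta> c x)"
      using E c x by (simp_all add: endomorphism_field_def one_form_field_def)
    show "\<eta> c x (\<xi> c x) = 1" "\<phi> c x (\<phi> c x v) = v - \<eta> c x v *\<^sub>R \<xi> c x"
      "dim {v. \<eta> c x v = 0 \<and> \<phi> c x v = v} = 1" "dim {v. \<eta> c x v = 0 \<and> \<phi> c x v = - v} = 1" for v
      using n c x n1 by simp_all
    show "g c x (\<phi> c x u) (\<phi> c x v) = - g c x u v + \<eta> c x u * \<eta> c x v" for u v by (rule P'(3)[OF x])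
    fix X Y :: "3 vec_field" assume XY: "smooth_on ?D X" "smooth_on ?D Y"
    show "nijenhuis (\<phi> c) X Y x - (2 * ext_deriv1 (\<eta> c) X Y x) *\<^sub>R \<xi> c x = 0"
      by (rule P'(4)[unfolded normal_structure_def, rule_format, OF c XY x])
    show "ext_deriv1 (\<eta> c) X Y x = 0"
      by (rule P'(5)[unfolded closed_one_form_def, rule_format, OF c XY x])
    show "ext_deriv2 (fundamental_form (\<phi> c) (g c)) X Y Z x = 0" if "smooth_on ?D Z" for Z
      by (rule P'(6)[unfolded closed_two_form_def, rule_format, OF c XY that x])
  qed
qed

theorem theorem3:
  fixes M :: "'a topology" and A :: "('a, 3) chart set"
    and \<phi> :: "('a, 3) chart \<Rightarrow> 3 endo_field"
    and \<xi> :: "('a, 3) chart \<Rightarrow> 3 vec_field"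
    and \<eta> :: "('a, 3) chart \<Rightarrow> 3 one_form"
    and g :: "('a, 3) chart \<Rightarrow> 3 bil_field"
    and nabla :: "('a, 3) chart \<Rightarrow> 3 connection"
  assumes "smooth_manifold M A" and "connected_space M"
    and "paracosymplectic A \<phi> \<xi> \<eta> g"
    and "levi_civita A g nabla"
    and "yamabe_soliton A g nabla"
  shows "\<exists>r0. (\<forall>c\<in>A. \<forall>p\<in>fst c. scalar_curvature (g c) (nabla c) (snd c p) = r0) \<and>
    (r0 \<noteq> 0 \<longrightarrow> eta_einstein A \<xi> \<eta> g nabla) \<and>
    (r0 = 0 \<longrightarrow> ricci_flat A nabla)"
proof -
  note M = assms(1)
  obtain V lam where V: "vector_field A V"
    and L: "\<And>c X Y x. c \<in> A \<Longrightarrow> smooth_on (chart_image c) X \<Longrightarrow> smooth_on (chart_image c) Y \<Longrightarrow>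
      x \<in> chart_image c \<Longrightarrow> lie_deriv_metric (V c) (g c) X Y x =
        (lam - scalar_curvature (g c) (nabla c) x) * g c x (X x) (Y x)"
    using assms(5) unfolding yamabe_soliton_def by metis
  have g: "semi_riemannian_metric A g"
    using assms(3) by (simp add: paracosymplectic_def almost_paracontact_metric_def)
  let ?r = "\<lambda>c. scalar_curvature (g c) (nabla c)"
  note C = paracosymplectic_imp_chart[OF M assms(3,4)]
  have indep: "?r c (snd c p) = ?r d (snd d p)" if "c \<in> A" "d \<in> A" "p \<in> fst c" "p \<in> fst d" for c d p
    using lie_deriv_factor_chart_independent[where \<rho> = "\<lambda>c x. lam - ?r c x", OF M that(1,2) g V L that(3,4)]
    by simp
  \<comment> \<open>The connectedness argument needs a function on the manifold: the scalar
    curvature is evaluated in some chart around the point, and \<open>indep\<close> makes the choice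
    harmless.\<close>
  define R where "R p = (let c = (SOME c. c \<in> A \<and> p \<in> fst c) in ?r c (snd c p))" for p
  have R: "R p = ?r c (snd c p)" if "c \<in> A" "p \<in> fst c" for c p
  proof -
    have "(SOME c. c \<in> A \<and> p \<in> fst c) \<in> A \<and> p \<in> fst (SOME c. c \<in> A \<and> p \<in> fst c)"
      by (rule someI[of _ c]) (use that in simp)
    then show ?thesis using indep that unfolding R_def Let_def by blast
  qed
  have top: "topspace M = (\<Union>c\<in>A. fst c)" using M by (simp add: smooth_manifold_def)
  have "\<exists>W. openin M W \<and> p \<in> W \<and> (\<forall>q\<in>W. R q = R p)" if p: "p \<in> topspace M" for p
  proof -
    obtain c where c: "c \<in> A" "p \<in> fst c" using p top by blast
    interpret c: paracosymplectic_chart "chart_image c" "g c" "\<lambda>x u v. nabla c (\<lambda>_. u) (\<lambda>_. v) x" "\<phi> c" "\<xi> c" "\<eta> c"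
      by (rule C(1)[OF c(1)])
    have pc: "snd c p \<in> chart_image c" using c by (simp add: chart_image_def)
    have sV: "smooth_on (chart_image c) (V c)" using V c by (simp add: vector_field_def)
    have "\<exists>W. open W \<and> snd c p \<in> W \<and> W \<subseteq> chart_image c \<and> (\<forall>x\<in>W. ?r c x = ?r c (snd c p))"
    proof (rule c.scalar_curvature_locally_constant[where N = "nabla c" and V = "V c" and lam = lam])
      show "lie_deriv_metric (V c) (g c) (\<lambda>_. u) (\<lambda>_. v) x = (lam - ?r c x) * g c x u v"
        if "x \<in> chart_image c" for x u v
        by (rule L[of c "\<lambda>_. u" "\<lambda>_. v" x, OF c(1) smooth_on_const smooth_on_const that])
    qed (fact sV pc | erule (2) C(3)[OF c(1)] | erule (1) C(2)[OF c(1)])+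
    then obtain W where W: "open W" "snd c p \<in> W" "W \<subseteq> chart_image c"
      "\<forall>x\<in>W. ?r c x = ?r c (snd c p)" by blast
    have "R q = R p" if "q \<in> {q \<in> fst c. snd c q \<in> W}" for q
      using that R[OF c] R[OF c(1), of q] W(4) by auto
    then show ?thesis
      using openin_chart_preimage[OF M c(1) W(1,3)] c(2) W(2) by blast
  qed
  then have "\<exists>r0. \<forall>p\<in>topspace M. R p = r0"
    by (rule locally_constant_imp_constant[OF assms(2)])
  then obtain r0 where r0: "\<And>p. p \<in> topspace M \<Longrightarrow> R p = r0" by blast
  have r: "?r c (snd c p) = r0" if "c \<in> A" "p \<in> fst c" for c p
  proof -
    have "p \<in> topspace M" using that top by blast
    then show ?thesis using r0[of p] R[OF that] by simp
  qed
  have Q: "ricci_operator (g c) (nabla c) (snd c p) v = (r0 / 2) *\<^sub>R (v - \<eta> c (snd c p) v *\<^sub>R \<xi> c (snd c p))"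
    "ricci (nabla c) (snd c p) u v = r0 / 2 * (g c (snd c p) u v - \<eta> c (snd c p) u * \<eta> c (snd c p) v)"
    if c: "c \<in> A" "p \<in> fst c" for c p u v
  proof -
    interpret c: paracosymplectic_chart "chart_image c" "g c" "\<lambda>x u v. nabla c (\<lambda>_. u) (\<lambda>_. v) x" "\<phi> c" "\<xi> c" "\<eta> c"
      by (rule C(1)[OF c(1)])
    have pc: "snd c p \<in> chart_image c" using c by (simp add: chart_image_def)
    show "ricci_operator (g c) (nabla c) (snd c p) v = (r0 / 2) *\<^sub>R (v - \<eta> c (snd c p) v *\<^sub>R \<xi> c (snd c p))"
      using c.ricci_scalar(2)[OF C(2)[OF c(1)] C(3)[OF c(1)] pc, of v] r[OF c] by simp
    show "ricci (nabla c) (snd c p) u v = r0 / 2 * (g c (snd c p) u v - \<eta> c (snd c p) u * \<eta> c (snd c p) v)"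
      using c.ricci_scalar(1)[OF C(2)[OF c(1)] C(3)[OF c(1)] pc, of u v] r[OF c] by simp
  qed
  have "eta_einstein A \<xi> \<eta> g nabla"
    unfolding eta_einstein_def
  \<comment> \<open>The Ricci operator is multiplication by \<open>r0 / 2\<close> on the kernel of
    \<open>\<eta>\<close> and annihilates \<open>\<xi>\<close>, hence the two opposite
    constants.\<close>
  proof (rule exI[of _ "\<lambda>_. r0 / 2"], rule exI[of _ "\<lambda>_. - r0 / 2"], intro conjI ballI allI)
    show "smooth_function A (\<lambda>_. r0 / 2)" "smooth_function A (\<lambda>_. - r0 / 2)"
      by (simp_all add: smooth_function_def o_def smooth_on_const)
    show "ricci_operator (g c) (nabla c) (snd c p) v =
        (r0 / 2) *\<^sub>R v + (- r0 / 2 * \<eta> c (snd c p) v) *\<^sub>R \<xi> c (snd c p)"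
      if "c \<in> A" "p \<in> fst c" for c p v
      using Q(1)[OF that] by (simp add: algebra_simps)
  qed
  moreover have "ricci_flat A nabla" if "r0 = 0"
    unfolding ricci_flat_def
  proof (intro ballI allI)
    fix c x u v assume c: "c \<in> A" and "x \<in> chart_image c"
    then obtain p where p: "p \<in> fst c" "x = snd c p" by (auto simp: chart_image_def)
    show "ricci (nabla c) x u v = 0" using Q(2)[OF c p(1), of u v] by (simp add: p(2) that)
  qed
  ultimately show ?thesis using r by (intro exI[of _ r0]) simp
qed

end
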